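(* Let $F$ be the cyclic quartic field defined by $a,b,c,d$. Let $p_I\ge 1$ be a divisor of $d$ and let $q_J\ge 1$ be a divisor of $a$ such that $d$ is a quadratic non-residue modulo $q$ for each prime divisor $q$ of $q_J$. Then there is a unique ideal $P_I$ of $\mathcal{O}_F$ of norm $p_I$ and a unique ideal $Q_J$ of $\mathcal{O}_F$ of norm $q_J^2$. Put $$\mathcal{M}=\{16q_J^2d,\ 8|a|d,\ 4q_J^2d+4|a|d,\ 16p_I^2q_J^2,\ 4p_I^2q_J^2+4|a|d,\ 4p_I^2q_J^2+4q_J^2d\}.$$ Then the ideal $P_IQ_J$ is well-rounded if and only if $$d\equiv 1\pmod 4,\quad b\equiv 0\pmod 2,\quad a+b\equiv 1\pmod 4,\quad\text{and}\quad p_I^2q_J^2+q_J^2d+2|a|d\le\min\mathcal{M}.$$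
   Context: Cyclic quartic fields: $a,b,c,d$ are integers with $a$ squarefree and odd, $d=b^2+c^2$ squarefree, $b>0$, $c>0$, $\gcd(a,d)=1$; $\beta=\sqrt{a(d-b\sqrt d)}$ and $F=\mathbb{Q}(\beta)$, with defining polynomial $x^4-2adx^2+a^2c^2d$. $F$ is a cyclic quartic field, totally real if $a>0$ and totally imaginary if $a<0$. All ideals are nonzero integral ideals of the ring of integers $\mathcal{O}_F$. An ideal is viewed as a full rank lattice in $F\otimes\mathbb{R}\cong\mathbb{R}^4$ with Euclidean norm $\|\delta\|^2=\sum_{\tau}|\tau(\delta)|^2$, the sum over all four embeddings $\tau:F\to\mathbb{C}$. A full rank lattice in $\mathbb{R}^n$ is well-rounded (WR) if its nonzero vectors of minimal norm contain $n$ linearly independent vectors. *)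

theory Defs
  imports
    "HOL-Algebra.Generated_Fields"
    "HOL-Algebra.QuotRing"
    "HOL-Algebra.Ideal_Product"
    "HOL-Algebra.Algebraic_Closure_Type"
    "HOL-Computational_Algebra.Computational_Algebra"
    "HOL-Number_Theory.Number_Theory"
    "HOL-Analysis.Analysis"
begin

text \<open>
  Number fields are subfields of the complex numbers, given by their carrier sets.  The record
  \<^const>\<open>ring_of_type_algebra\<close> is the type-class structure of a type viewed as a ring
  in the sense of HOL-Algebra.
\<close>

abbreviation complex_ring :: "complex ring" where
  "complex_ring \<equiv> ring_of_type_algebra"

definition ring_of_integers :: "complex set \<Rightarrow> complex ring" where
  "ring_of_integers K = complex_ring\<lparr>carrier := {x \<in> K. algebraic_int x}\<rparr>"

definition nonzero_ideal :: "complex set \<Rightarrow> complex set \<Rightarrow> bool" where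
  "nonzero_ideal K I \<longleftrightarrow> ideal I (ring_of_integers K) \<and> I \<noteq> {0}"

definition ideal_norm :: "complex set \<Rightarrow> complex set \<Rightarrow> nat" where
  "ideal_norm K I = card (carrier (ring_of_integers K Quot I))"

text \<open>
  \<^const>\<open>ring_hom\<close> does not constrain values outside the carrier; extensionality makes
  each field embedding occur exactly once.
\<close>

definition embeddings :: "complex set \<Rightarrow> (complex \<Rightarrow> complex) set" where
  "embeddings K = ring_hom (complex_ring\<lparr>carrier := K\<rparr>) complex_ring \<inter> extensional K"

definition full_rank_lattice :: "'a::euclidean_space set \<Rightarrow> 'a set \<Rightarrow> bool" where
  "full_rank_lattice V L \<longleftrightarrow>
     0 \<in> L \<and> (\<forall>x\<in>L. \<forall>y\<in>L. x - y \<in> L) \<and> discrete L \<and> span L = V"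

definition minimal_vectors :: "'a::real_normed_vector set \<Rightarrow> 'a set" where
  "minimal_vectors L = {v \<in> L - {0}. \<forall>w \<in> L - {0}. norm v \<le> norm w}"

definition well_rounded :: "'a::euclidean_space set \<Rightarrow> 'a set \<Rightarrow> bool" where
  "well_rounded V L \<longleftrightarrow> full_rank_lattice V L \<and>
     (\<exists>B \<subseteq> minimal_vectors L. independent B \<and> card B = dim V)"

text \<open>
  For an enumeration \<open>\<tau>\<close> of the embeddings of \<open>K\<close>, the norm of
  \<open>minkowski \<tau> x\<close> is the square root of the sum of all \<open>\<bar>\<tau> i x\<bar>\<^sup>2\<close>,
  and the real span of the image of \<open>K\<close> is a copy of the tensor product of \<open>K\<close>
  with the reals, of real dimension \<open>CARD('n)\<close>.  Other enumerations only permute the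
  coordinates.
\<close>

definition minkowski :: "('n \<Rightarrow> complex \<Rightarrow> complex) \<Rightarrow> complex \<Rightarrow> complex ^ 'n" where
  "minkowski \<tau> x = (\<chi> i. \<tau> i x)"

definition well_rounded_quartic_ideal :: "complex set \<Rightarrow> complex set \<Rightarrow> bool" where
  "well_rounded_quartic_ideal K I \<longleftrightarrow>
     (\<exists>\<tau> :: 4 \<Rightarrow> complex \<Rightarrow> complex. bij_betw \<tau> UNIV (embeddings K) \<and>
        well_rounded (span (minkowski \<tau> ` K)) (minkowski \<tau> ` I))"

text \<open>
  The radicand is negative for \<open>a < 0\<close>, hence the complex square root; the choice of the
  root does not affect the field.
\<close>

definition cyclic_quartic_beta :: "int \<Rightarrow> int \<Rightarrow> int \<Rightarrow> complex" where
  "cyclic_quartic_beta a b d =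
     csqrt (of_real (of_int a * (of_int d - of_int b * sqrt (of_int d))))"

definition cyclic_quartic_field :: "int \<Rightarrow> int \<Rightarrow> int \<Rightarrow> complex set" where
  "cyclic_quartic_field a b d = generate_field complex_ring {cyclic_quartic_beta a b d}"

end

theory Submission
  imports Defs "Jordan_Normal_Form.Char_Poly" "HOL-Algebra.Sylow"
begin

text \<open>
  Write \<open>rt\<close> for the square root of \<open>d\<close> and put \<open>\<gamma> = a c rt / \<beta>\<close>.  The
  numbers \<open>1, rt, \<beta>, \<gamma>\<close> are a rational basis of \<open>F\<close> on which the cyclic
  Galois group acts by signed permutations: a generator sends \<open>rt\<close> to \<open>- rt\<close>,
  \<open>\<beta>\<close> to \<open>\<gamma>\<close> and \<open>\<gamma>\<close> to \<open>- \<beta>\<close>.  In this basis the sum of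
  \<open>\<bar>h x\<bar>\<^sup>2\<close> over the four embeddings \<open>h\<close> is the diagonal form
  \<open>4 (w\<^sup>2 + d x\<^sup>2 + \<bar>a\<bar> d (y\<^sup>2 + z\<^sup>2))\<close>, so once integers and ideals are described by
  congruences on coordinates, the theorem becomes a question about a diagonal quadratic form on a
  sublattice of \<open>\<int>\<^sup>4\<close>.

  The integers of \<open>F\<close> are found from relative trace and norm over \<open>\<rat>(rt)\<close>.  Since
  \<open>d\<close> and \<open>a d\<close> are squarefree, every integer has coordinates in \<open>\<int>/4\<close>, and
  parity considerations leave four congruence lattices, according to the parities of \<open>d\<close> and
  \<open>b\<close> and to \<open>a + b\<close> modulo 4 (lemma \<open>algebraic_int_iff_integral_coords\<close>).

  For \<open>p\<close> dividing \<open>d\<close> and \<open>q\<close> dividing \<open>a\<close>, the integers whose first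
  coordinate is divisible by \<open>p q\<close> and whose second one is divisible by \<open>q\<close> form an
  ideal \<open>idl p q\<close> of norm \<open>p q\<^sup>2\<close>.  Uniqueness comes from the field norm: for an element
  of an ideal it is again in the ideal, hence divisible by every prime dividing the ideal norm, and
  modulo a prime divisor of \<open>d\<close> or of \<open>a\<close> the field norm is, up to a factor prime to
  it, \<open>w\<^sup>4\<close> or \<open>(w\<^sup>2 - d x\<^sup>2)\<^sup>2\<close>.  So an ideal of norm \<open>p\<close> lies in
  \<open>idl p 1\<close>; if \<open>d\<close> is a non-residue modulo every prime divisor of \<open>q\<close>, an ideal
  of norm \<open>q\<^sup>2\<close> lies in \<open>idl 1 q\<close>; equal indices force equality.  The product of the
  two ideals is \<open>idl p q\<close>.

  Well-roundedness gives, for each of the four orthogonal basis directions, a minimal vector with a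
  nonzero coordinate in that direction.  Put \<open>A0 = p\<^sup>2 q\<^sup>2\<close>, \<open>A1 = q\<^sup>2 d\<close> and
  \<open>A2 = \<bar>a\<bar> d\<close>.
  For even \<open>d\<close> the lattice is an orthogonal box and this would force \<open>A0 = A1\<close>, that is
  \<open>p\<^sup>2 = d\<close>.  For odd \<open>d\<close> and a lattice inside \<open>(\<int>/2)\<^sup>4\<close> it is an orthogonal
  sum of two plane lattices, and it would force \<open>A0 + A1 = \<kappa> A2\<close> with \<open>\<kappa>\<close> equal
  to 2 or 4, which divisibility by \<open>d\<close> excludes.  In the remaining case, the quarter lattice, there are
  vectors all of whose coordinates are odd quarters; their norm is at least that of the four sign vectors
  \<open>(p q, \<plusminus>q, \<plusminus>1, \<plusminus>\<eta>)\<close>, proportional to \<open>S = A0 + A1 + 2 A2\<close>.  All other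
  vectors lie in a weighted checkerboard lattice, whose short vectors have, on the same scale, norms
  \<open>4 (Ai + Aj)\<close> for \<open>i \<noteq> j\<close>, \<open>8 A2\<close>, \<open>16 A0\<close> and \<open>16 A1\<close>; these
  are the six numbers bounding \<open>S\<close>.  If \<open>S\<close> is at most all of them, the sign vectors are
  minimal, and they are independent because their signs form a Hadamard matrix.  Conversely,
  checkerboard vectors alone cannot be minimal in every direction when they are shorter than
  \<open>S\<close>.
\<close>

section \<open>Algebraic integers form a ring\<close>

text \<open>
  A list of generators rather than a set: multiplication by a complex number that preserves the span
  is then described by an integer matrix indexed by positions in the list.
\<close>

definition int_span :: "complex list \<Rightarrow> complex set" where
  "int_span vs = {x. \<exists>c :: nat \<Rightarrow> int. x = (\<Sum>j<length vs. of_int (c j) * vs ! j)}"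

text \<open>
  The generators form an eigenvector, with eigenvalue \<open>z\<close>, of the integer matrix that
  expresses \<open>z v\<close> through the generators; hence \<open>z\<close> is a root of its monic
  characteristic polynomial.
\<close>

lemma algebraic_int_of_int_span:
  assumes stable: "\<And>v. v \<in> set vs \<Longrightarrow> z * v \<in> int_span vs" and ex: "\<exists>v\<in>set vs. v \<noteq> 0"
  shows "algebraic_int z"
proof -
  let ?n = "length vs"
  define C :: "nat \<Rightarrow> nat \<Rightarrow> int"
    where "C i = (SOME c. z * vs ! i = (\<Sum>j<?n. of_int (c j) * vs ! j))" for i
  have C: "z * vs ! i = (\<Sum>j<?n. of_int (C i j) * vs ! j)" if "i < ?n" for i
  proof -
    have "\<exists>c. z * vs ! i = (\<Sum>j<?n. of_int (c j) * vs ! j)"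
      using stable[of "vs ! i"] that by (simp add: int_span_def)
    then show ?thesis unfolding C_def by (rule someI_ex)
  qed
  define A where "A = mat ?n ?n (\<lambda>(i, j). C i j)"
  define w where "w = vec_of_list vs"
  let ?A = "map_mat complex_of_int A"
  have A: "A \<in> carrier_mat ?n ?n" and w: "w \<in> carrier_vec ?n"
    by (simp add: A_def) (simp add: w_def carrier_vecI)
  have "w \<noteq> 0\<^sub>v ?n"
  proof
    assume w0: "w = 0\<^sub>v ?n"
    have "vs ! i = 0" if "i < ?n" for i
    proof -
      have "vs ! i = w $ i" using that by (simp add: w_def vec_of_list_index)
      then show ?thesis using that w0 by simp
    qed
    then show False using ex by (auto simp: in_set_conv_nth)
  qed
  moreover have "?A *\<^sub>v w = z \<cdot>\<^sub>v w"
  proof (rule eq_vecI)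
    fix i assume "i < dim_vec (z \<cdot>\<^sub>v w)"
    then have i: "i < ?n" by (simp add: w_def)
    have "(?A *\<^sub>v w) $ i = (\<Sum>j<?n. of_int (C i j) * vs ! j)"
    proof -
      have "(?A *\<^sub>v w) $ i = (\<Sum>j\<in>{0..<?n}. ?A $$ (i, j) * w $ j)"
        using i by (simp add: A_def w_def scalar_prod_def)
      also have "\<dots> = (\<Sum>j<?n. of_int (C i j) * vs ! j)"
        unfolding atLeast0LessThan
        by (rule sum.cong) (use i in \<open>simp_all add: A_def w_def vec_of_list_index\<close>)
      finally show ?thesis .
    qed
    also have "\<dots> = (z \<cdot>\<^sub>v w) $ i"
      using C[OF i] i by (simp add: w_def vec_of_list_index)
    finally show "(?A *\<^sub>v w) $ i = (z \<cdot>\<^sub>v w) $ i" .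
  qed (simp add: A_def w_def)
  ultimately have "eigenvalue ?A z"
    using w A unfolding eigenvalue_def eigenvector_def by (intro exI[of _ w]) simp
  then have "poly (char_poly ?A) z = 0"
    using eigenvalue_root_char_poly[of ?A ?n z] A by simp
  then have "poly (map_poly of_int (char_poly A)) z = 0"
    by (simp add: of_int_hom.char_poly_hom[OF A])
  moreover have "lead_coeff (char_poly A) = 1"
    using degree_monic_char_poly[OF A] by simp
  ultimately show ?thesis
    by (auto simp: algebraic_int_altdef_ipoly)
qed

lemma int_span_add: "x \<in> int_span vs \<Longrightarrow> y \<in> int_span vs \<Longrightarrow> x + y \<in> int_span vs"
proof -
  assume "x \<in> int_span vs" "y \<in> int_span vs"
  then obtain c e where "x = (\<Sum>j<length vs. of_int (c j) * vs ! j)"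
      "y = (\<Sum>j<length vs. of_int (e j) * vs ! j)"
    by (auto simp: int_span_def)
  then have "x + y = (\<Sum>j<length vs. of_int (c j + e j) * vs ! j)"
    by (simp add: algebra_simps sum.distrib)
  then show ?thesis unfolding int_span_def by (intro CollectI exI)
qed

lemma int_span_scale: "x \<in> int_span vs \<Longrightarrow> of_int k * x \<in> int_span vs"
proof -
  assume "x \<in> int_span vs"
  then obtain c where "x = (\<Sum>j<length vs. of_int (c j) * vs ! j)"
    by (auto simp: int_span_def)
  then have "of_int k * x = (\<Sum>j<length vs. of_int (k * c j) * vs ! j)"
    by (simp add: algebra_simps sum_distrib_left)
  then show ?thesis unfolding int_span_def by (intro CollectI exI)
qed

lemma int_span_base: "v \<in> set vs \<Longrightarrow> v \<in> int_span vs"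
proof -
  assume "v \<in> set vs"
  then obtain i where i: "i < length vs" "v = vs ! i" by (auto simp: in_set_conv_nth)
  have "v = (\<Sum>j<length vs. of_int (if j = i then 1 else 0) * vs ! j)"
    using i by (simp add: if_distrib if_distribR cong: if_cong)
  then show ?thesis unfolding int_span_def by (intro CollectI exI)
qed

lemma int_span_sum:
  "finite A \<Longrightarrow> (\<And>i. i \<in> A \<Longrightarrow> f i \<in> int_span vs) \<Longrightarrow> sum f A \<in> int_span vs"
proof (induction A rule: finite_induct)
  case empty
  have "(0 :: complex) = (\<Sum>j<length vs. of_int 0 * vs ! j)" by simp
  then have "(0 :: complex) \<in> int_span vs" unfolding int_span_def by (intro CollectI exI)
  then show ?case by simp
qed (auto intro: int_span_add)

lemma int_span_mult:
  assumes "\<And>v. v \<in> set vs \<Longrightarrow> z * v \<in> int_span vs" "x \<in> int_span vs"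
  shows "z * x \<in> int_span vs"
proof -
  obtain c where c: "x = (\<Sum>j<length vs. of_int (c j) * vs ! j)"
    using assms(2) by (auto simp: int_span_def)
  have "z * x = (\<Sum>j<length vs. of_int (c j) * (z * vs ! j))"
    by (simp add: c sum_distrib_left mult_ac)
  also have "\<dots> \<in> int_span vs"
    using assms(1) by (intro int_span_sum int_span_scale) auto
  finally show ?thesis .
qed

text \<open>
  All powers of an algebraic integer reduce to those below the degree; this is what makes the
  monomials in the next lemma a stable finite generating set.
\<close>

lemma algebraic_int_power_reduction:
  assumes "algebraic_int (x :: complex)"
  obtains m :: nat and c :: "nat \<Rightarrow> int"
  where "m > 0" "x ^ m = (\<Sum>i<m. of_int (c i) * x ^ i)"
proof -
  obtain p :: "int poly" where p: "poly (map_poly of_int p) x = 0" "lead_coeff p = 1"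
    using assms by (auto simp: algebraic_int_altdef_ipoly)
  have "degree p > 0"
  proof (rule ccontr)
    assume "\<not> degree p > 0"
    then have "p = [:1:]" using p(2) by (auto elim!: degree_eq_zeroE)
    then show False using p(1) by simp
  qed
  have "0 = (\<Sum>i\<le>degree p. of_int (coeff p i) * x ^ i)"
    using p(1) by (simp add: poly_altdef coeff_map_poly degree_map_poly)
  also have "{..degree p} = insert (degree p) {..<degree p}" by auto
  finally have "x ^ degree p = (\<Sum>i<degree p. of_int (- coeff p i) * x ^ i)"
    using p(2) by (simp add: sum_negf add_eq_0_iff)
  with \<open>degree p > 0\<close> show ?thesis by (rule that)
qed

lemma algebraic_int_common_module:
  assumes "algebraic_int x" "algebraic_int y"
  obtains vs where "\<And>v. v \<in> set vs \<Longrightarrow> x * v \<in> int_span vs"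
    "\<And>v. v \<in> set vs \<Longrightarrow> y * v \<in> int_span vs" "1 \<in> set vs"
proof -
  obtain m c where m: "m > 0" "x ^ m = (\<Sum>i<m. of_int (c i) * x ^ i)"
    by (rule algebraic_int_power_reduction[OF assms(1)])
  obtain n e where n: "n > 0" "y ^ n = (\<Sum>i<n. of_int (e i) * y ^ i)"
    by (rule algebraic_int_power_reduction[OF assms(2)])
  define vs where "vs = map (\<lambda>(i, j). x ^ i * y ^ j) (List.product [0..<m] [0..<n])"
  have set_vs: "set vs = {x ^ i * y ^ j | i j. i < m \<and> j < n}"
    by (force simp: vs_def)
  have base: "x ^ i * y ^ j \<in> int_span vs" if "i < m" "j < n" for i j
    using that by (intro int_span_base) (auto simp: set_vs)
  have "x * v \<in> int_span vs" if v: "v \<in> set vs" for v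
  proof -
    obtain i j where ij: "v = x ^ i * y ^ j" "i < m" "j < n" using v by (auto simp: set_vs)
    show ?thesis
    proof (cases "Suc i < m")
      case True
      then show ?thesis using base[of "Suc i" j] ij by (simp add: mult_ac)
    next
      case False
      then have "x * v = x ^ m * y ^ j" using ij by (metis Suc_lessI mult.assoc power_Suc)
      also have "\<dots> = (\<Sum>i<m. of_int (c i) * (x ^ i * y ^ j))"
        unfolding m(2) by (simp add: sum_distrib_right mult.assoc)
      finally show ?thesis using base ij by (auto intro!: int_span_sum int_span_scale)
    qed
  qed
  moreover have "y * v \<in> int_span vs" if v: "v \<in> set vs" for v
  proof -
    obtain i j where ij: "v = x ^ i * y ^ j" "i < m" "j < n" using v by (auto simp: set_vs)
    show ?thesis
    proof (cases "Suc j < n")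
      case True
      then show ?thesis using base[of i "Suc j"] ij by (simp add: mult_ac)
    next
      case False
      then have "Suc j = n" using ij by simp
      then have "y * v = x ^ i * y ^ n" using ij by (auto simp: mult_ac)
      also have "\<dots> = (\<Sum>j<n. of_int (e j) * (x ^ i * y ^ j))"
        unfolding n(2) by (simp add: sum_distrib_left mult_ac)
      finally show ?thesis using base ij by (auto intro!: int_span_sum int_span_scale)
    qed
  qed
  moreover have "1 \<in> set vs"
    unfolding set_vs using m(1) n(1) by (force intro!: exI[of _ "0 :: nat"])
  ultimately show ?thesis using that by blast
qed

lemma algebraic_int_add:
  assumes "algebraic_int (x :: complex)" "algebraic_int y"
  shows "algebraic_int (x + y)"
proof -
  obtain vs where vs: "\<And>v. v \<in> set vs \<Longrightarrow> x * v \<in> int_span vs"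
      "\<And>v. v \<in> set vs \<Longrightarrow> y * v \<in> int_span vs" "1 \<in> set vs"
    using algebraic_int_common_module[OF assms] by blast
  show ?thesis
  proof (rule algebraic_int_of_int_span[of vs])
    show "(x + y) * v \<in> int_span vs" if "v \<in> set vs" for v
      using int_span_add[OF vs(1)[OF that] vs(2)[OF that]] by (simp add: distrib_right)
  qed (use vs(3) in \<open>auto intro!: bexI[of _ 1]\<close>)
qed

lemma algebraic_int_mult:
  assumes "algebraic_int (x :: complex)" "algebraic_int y"
  shows "algebraic_int (x * y)"
proof -
  obtain vs where vs: "\<And>v. v \<in> set vs \<Longrightarrow> x * v \<in> int_span vs"
      "\<And>v. v \<in> set vs \<Longrightarrow> y * v \<in> int_span vs" "1 \<in> set vs"
    using algebraic_int_common_module[OF assms] by blast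
  show ?thesis
  proof (rule algebraic_int_of_int_span[of vs])
    show "x * y * v \<in> int_span vs" if "v \<in> set vs" for v
      using int_span_mult[OF vs(1) vs(2)[OF that]] by (simp add: mult.assoc)
  qed (use vs(3) in \<open>auto intro!: bexI[of _ 1]\<close>)
qed

lemma algebraic_int_diff:
  "algebraic_int (x :: complex) \<Longrightarrow> algebraic_int y \<Longrightarrow> algebraic_int (x - y)"
  using algebraic_int_add[of x "- y"] by simp

text \<open>
  If \<open>us\<close> generates a module stable under both coefficients, then \<open>us\<close> together with
  \<open>x us\<close> generates one that is stable under \<open>x\<close>.  This transitivity of integrality is
  needed only for quadratic equations, because \<open>F\<close> is a tower of two quadratic extensions.
\<close>

lemma algebraic_int_monic_quadratic:
  assumes "algebraic_int (t :: complex)" "algebraic_int n" "x\<^sup>2 = t * x - n"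
  shows "algebraic_int x"
proof -
  obtain us where us: "\<And>v. v \<in> set us \<Longrightarrow> t * v \<in> int_span us"
      "\<And>v. v \<in> set us \<Longrightarrow> n * v \<in> int_span us" "1 \<in> set us"
    using algebraic_int_common_module[OF assms(1,2)] by blast
  define vs where "vs = us @ map ((*) x) us"
  have inclusion: "v \<in> int_span vs" if v: "v \<in> int_span us" for v
  proof -
    obtain c where c: "v = (\<Sum>j<length us. of_int (c j) * us ! j)"
      using v by (auto simp: int_span_def)
    show ?thesis unfolding c
      by (intro int_span_sum int_span_scale int_span_base) (auto simp: vs_def)
  qed
  have shift: "x * v \<in> int_span vs" if v: "v \<in> int_span us" for v
  proof -
    obtain c where "v = (\<Sum>j<length us. of_int (c j) * us ! j)"
      using v by (auto simp: int_span_def)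
    then have c: "x * v = (\<Sum>j<length us. of_int (c j) * (x * us ! j))"
      by (simp add: sum_distrib_left mult_ac)
    show ?thesis unfolding c
      by (intro int_span_sum int_span_scale int_span_base) (auto simp: vs_def)
  qed
  have "x * v \<in> int_span vs" if v: "v \<in> set vs" for v
  proof -
    consider "v \<in> set us" | u where "u \<in> set us" "v = x * u"
      using v unfolding vs_def set_append set_map by blast
    then show ?thesis
    proof cases
      case 1 then show ?thesis using shift[OF int_span_base[OF 1]] by simp
    next
      case (2 u)
      have "x * v = x * (t * u) + of_int (- 1) * (n * u)"
      proof -
        have "x * v = x\<^sup>2 * u" by (simp only: 2(2) power2_eq_square mult.assoc)
        also have "\<dots> = (t * x - n) * u" by (simp only: assms(3))
        finally show ?thesis by (simp add: algebra_simps)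
      qed
      also have "\<dots> \<in> int_span vs"
      proof (rule int_span_add)
        show "x * (t * u) \<in> int_span vs" by (rule shift) (rule us(1)[OF 2(1)])
        show "of_int (- 1) * (n * u) \<in> int_span vs"
          by (rule int_span_scale, rule inclusion) (rule us(2)[OF 2(1)])
      qed
      finally show ?thesis .
    qed
  qed
  moreover have "\<exists>v\<in>set vs. v \<noteq> 0" using us(3) by (auto simp: vs_def)
  ultimately show ?thesis by (rule algebraic_int_of_int_span)
qed

section \<open>Coordinates on the cyclic quartic field\<close>

text \<open>
  The square of the denominator would have to divide \<open>m\<close>.
\<close>

lemma rat_Ints_if_squarefree_multiple:
  fixes m :: int and x :: rat
  assumes m: "squarefree m" and int: "of_int m * x\<^sup>2 \<in> \<int>"
  shows "x \<in> \<int>"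
proof -
  obtain n k where nk: "quotient_of x = (n, k)" by (cases "quotient_of x") auto
  have k: "k > 0" "coprime n k" and x: "x = of_int n / of_int k"
    using quotient_of_denom_pos[OF nk] quotient_of_coprime[OF nk] quotient_of_div[OF nk] by auto
  obtain N :: int where "of_int m * x\<^sup>2 = of_int N" using int by (auto elim: Ints_cases)
  then have "of_int (m * n\<^sup>2) = (of_int (N * k\<^sup>2) :: rat)"
    using k by (simp add: x field_simps power2_eq_square)
  then have "m * n\<^sup>2 = N * k\<^sup>2" by (simp only: of_int_eq_iff)
  then have "k\<^sup>2 dvd m * n\<^sup>2" by simp
  moreover have "coprime (k\<^sup>2) (n\<^sup>2)" using k(2) by (simp add: coprime_commute)
  ultimately have "k\<^sup>2 dvd m" by (simp add: coprime_dvd_mult_left_iff)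
  then have "k dvd 1" using m by (auto simp: squarefree_def)
  then have "k = 1" using k(1) by simp
  then show ?thesis by (simp add: x)
qed

type_synonym quad = "rat \<times> rat \<times> rat \<times> rat"

locale cyclic_quartic_data =
  fixes a b c d :: int
  assumes squarefree_a: "squarefree a" and odd_a: "odd a"
    and d_eq: "d = b\<^sup>2 + c\<^sup>2" and squarefree_d: "squarefree d"
    and b_pos: "b > 0" and c_pos: "c > 0" and gcd_ad: "gcd a d = 1"
begin

definition rt :: complex where "rt = of_real (sqrt (of_int d))"
definition \<beta> :: complex where "\<beta> = cyclic_quartic_beta a b d"
definition \<gamma> :: complex where "\<gamma> = of_int (a * c) * rt / \<beta>"

fun elt :: "quad \<Rightarrow> complex" where
  "elt (w, x, y, z) = of_rat w + of_rat x * rt + of_rat y * \<beta> + of_rat z * \<gamma>"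

text \<open>
  The structure constants come from \<open>rt \<beta> = c \<gamma> - b \<beta>\<close>,
  \<open>rt \<gamma> = c \<beta> + b \<gamma>\<close>, \<open>\<beta>\<^sup>2 = a (d - b rt)\<close>,
  \<open>\<gamma>\<^sup>2 = a (d + b rt)\<close> and \<open>\<beta> \<gamma> = a c rt\<close>, proved below.
\<close>

fun mulq :: "quad \<Rightarrow> quad \<Rightarrow> quad" where
  "mulq (w, x, y, z) (w', x', y', z') =
    (w * w' + of_int d * (x * x') + of_int (a * d) * (y * y' + z * z'),
     w * x' + x * w' - of_int (a * b) * (y * y' - z * z') + of_int (a * c) * (y * z' + z * y'),
     w * y' + y * w' - of_int b * (x * y' + y * x') + of_int c * (x * z' + z * x'),
     w * z' + z * w' + of_int c * (x * y' + y * x') + of_int b * (x * z' + z * x'))"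

text \<open>
  A generator of the Galois group: \<open>rt\<close> goes to \<open>- rt\<close>, \<open>\<beta>\<close> to
  \<open>\<gamma>\<close> and \<open>\<gamma>\<close> to \<open>- \<beta>\<close>.
\<close>

fun conjq :: "quad \<Rightarrow> quad" where
  "conjq (w, x, y, z) = (w, - x, - z, y)"

lemma a_nonzero: "a \<noteq> 0" using odd_a by auto

lemma d_ge_2: "d \<ge> 2"
proof -
  have "b\<^sup>2 \<ge> 1" "c\<^sup>2 \<ge> 1" using b_pos c_pos by (simp_all add: int_one_le_iff_zero_less)
  then show ?thesis by (simp add: d_eq)
qed

lemma sqrt_d_gt_b: "real_of_int b < sqrt (of_int d)"
proof -
  have "real_of_int b = sqrt ((of_int b)\<^sup>2)" using b_pos by simp
  also have "\<dots> < sqrt (of_int d)"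
    using c_pos by (intro real_sqrt_less_mono) (simp add: d_eq)
  finally show ?thesis .
qed

lemma radicand_pos: "of_int d - of_int b * sqrt (of_int d) > (0 :: real)"
proof -
  have "of_int b * sqrt (of_int d) < sqrt (of_int d) * sqrt (of_int d)"
    using sqrt_d_gt_b d_ge_2 by (intro mult_strict_right_mono) auto
  then show ?thesis using d_ge_2 by simp
qed

lemma rt_square: "rt * rt = of_int d"
  using d_ge_2 by (simp add: rt_def flip: of_real_mult)

lemma \<beta>_square_real: "\<beta> * \<beta> = of_real (of_int a * (of_int d - of_int b * sqrt (of_int d)))"
  by (simp add: \<beta>_def cyclic_quartic_beta_def flip: power2_eq_square)

lemma \<beta>_square: "\<beta> * \<beta> = of_int a * (of_int d - of_int b * rt)"
  by (simp add: \<beta>_square_real rt_def)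

lemma \<beta>_nonzero: "\<beta> \<noteq> 0"
proof
  assume "\<beta> = 0"
  then have "of_int a * (of_int d - of_int b * sqrt (of_int d)) = (0 :: real)"
    using \<beta>_square_real by (metis mult_zero_left of_real_eq_0_iff)
  then show False using radicand_pos a_nonzero by simp
qed

lemma \<beta>\<gamma>: "\<beta> * \<gamma> = of_int (a * c) * rt"
  using \<beta>_nonzero by (simp add: \<gamma>_def)

lemma cancel_\<beta>: "\<beta> * x = \<beta> * y \<Longrightarrow> x = y" using \<beta>_nonzero by simp

lemma of_int_d: "(of_int d :: 'a :: comm_ring_1) = of_int b * of_int b + of_int c * of_int c"
  by (simp add: d_eq power2_eq_square)

lemma rt_\<beta>: "rt * \<beta> = of_int c * \<gamma> - of_int b * \<beta>"
proof (rule cancel_\<beta>)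
  have "\<beta> * (rt * \<beta>) = rt * (\<beta> * \<beta>)" by (simp add: mult_ac)
  also have "\<dots> = of_int a * (of_int d * rt - of_int b * (rt * rt))"
    by (simp add: \<beta>_square algebra_simps)
  also have "\<dots> = of_int c * (\<beta> * \<gamma>) - of_int b * (\<beta> * \<beta>)"
    unfolding \<beta>\<gamma> \<beta>_square rt_square by (simp add: of_int_d algebra_simps)
  finally show "\<beta> * (rt * \<beta>) = \<beta> * (of_int c * \<gamma> - of_int b * \<beta>)"
    by (simp add: algebra_simps)
qed

lemma rt_\<gamma>: "rt * \<gamma> = of_int c * \<beta> + of_int b * \<gamma>"
proof (rule cancel_\<beta>)
  have "\<beta> * (rt * \<gamma>) = rt * (\<beta> * \<gamma>)" by (simp add: mult_ac)
  also have "\<dots> = of_int a * of_int c * (rt * rt)" by (simp add: \<beta>\<gamma> mult_ac)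
  also have "\<dots> = of_int c * (\<beta> * \<beta>) + of_int b * (\<beta> * \<gamma>)"
    unfolding \<beta>\<gamma> \<beta>_square rt_square by (simp add: algebra_simps)
  finally show "\<beta> * (rt * \<gamma>) = \<beta> * (of_int c * \<beta> + of_int b * \<gamma>)"
    by (simp add: algebra_simps)
qed

lemma \<gamma>_square: "\<gamma> * \<gamma> = of_int a * (of_int d + of_int b * rt)"
proof (rule cancel_\<beta>)
  have "\<beta> * (\<gamma> * \<gamma>) = (\<beta> * \<gamma>) * \<gamma>" by (simp add: mult_ac)
  also have "\<dots> = of_int a * of_int c * (of_int c * \<beta> + of_int b * \<gamma>)"
    by (simp add: \<beta>\<gamma> rt_\<gamma> mult.assoc)
  also have "\<dots> = of_int a * (of_int d * \<beta> + of_int b * (rt * \<beta>))"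
    unfolding rt_\<beta> by (simp add: of_int_d algebra_simps)
  finally show "\<beta> * (\<gamma> * \<gamma>) = \<beta> * (of_int a * (of_int d + of_int b * rt))"
    by (simp add: algebra_simps)
qed

lemma elt_mulq: "elt (mulq A B) = elt A * elt B"
proof -
  obtain w x y z w' x' y' z' where AB: "A = (w, x, y, z)" "B = (w', x', y', z')"
    by (cases A; cases B) auto
  have "elt A * elt B = of_rat (w * w') + of_rat (w * x' + x * w') * rt
      + of_rat (w * y' + y * w') * \<beta> + of_rat (w * z' + z * w') * \<gamma>
      + of_rat (x * x') * (rt * rt) + of_rat (x * y' + y * x') * (rt * \<beta>)
      + of_rat (x * z' + z * x') * (rt * \<gamma>) + of_rat (y * y') * (\<beta> * \<beta>)
      + of_rat (z * z') * (\<gamma> * \<gamma>) + of_rat (y * z' + z * y') * (\<beta> * \<gamma>)"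
    by (simp add: AB of_rat_add of_rat_mult algebra_simps)
  also have "\<dots> = elt (mulq A B)"
    unfolding rt_square rt_\<beta> rt_\<gamma> \<beta>_square \<gamma>_square \<beta>\<gamma>
    by (simp add: AB of_rat_add of_rat_mult of_rat_diff algebra_simps)
  finally show ?thesis ..
qed

lemma elt_add: "elt (A + B) = elt A + elt B"
  by (cases A; cases B) (simp add: of_rat_add algebra_simps)

lemma elt_minus: "elt (- A) = - elt A"
  by (cases A) (simp add: of_rat_minus)

lemma elt_diff: "elt (A - B) = elt A - elt B"
  by (cases A; cases B) (simp add: of_rat_diff algebra_simps)

lemma elt_zero: "elt 0 = 0" by (simp add: zero_prod_def)

lemma elt_rat: "elt (w, 0, 0, 0) = of_rat w" by simp

lemma conjq_add: "conjq (A + B) = conjq A + conjq B"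
  by (cases A; cases B) simp

lemma conjq_mulq: "conjq (mulq A B) = mulq (conjq A) (conjq B)"
  by (cases A; cases B) (simp add: algebra_simps)

text \<open>
  Over the rationals, \<open>d\<close> is not a square.
\<close>

lemma rat_square_multiple:
  fixes r t :: rat
  assumes "r\<^sup>2 = of_int d * t\<^sup>2"
  shows "r = 0 \<and> t = 0"
proof -
  have "t = 0"
  proof (rule ccontr)
    assume "t \<noteq> 0"
    then have *: "(r / t)\<^sup>2 = of_int d" using assms by (simp add: power_divide)
    have "r / t \<in> \<int>"
      by (rule rat_Ints_if_squarefree_multiple[of 1]) (use * in auto)
    then obtain n where "r / t = of_int n" by (auto elim: Ints_cases)
    with * have "of_int (n\<^sup>2) = (of_int d :: rat)" by simp
    then have n: "n\<^sup>2 = d" by (simp only: of_int_eq_iff)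
    then have "n dvd 1" using squarefree_d by (auto simp: squarefree_def)
    then have "n\<^sup>2 = 1" by (metis abs_1 power2_abs zdvd1_eq power_one)
    then show False using n d_ge_2 by simp
  qed
  then show ?thesis using assms by simp
qed

lemma quadratic_independent:
  assumes "of_rat r + of_rat t * rt = 0"
  shows "r = 0 \<and> t = 0"
proof -
  have "of_rat r = - (of_rat t * rt)" using assms by (simp add: add_eq_0_iff)
  then have "of_rat r * of_rat r = of_rat t * of_rat t * (rt * rt)" by (simp add: mult_ac)
  then have "complex_of_rat (r\<^sup>2) = of_rat (of_int d * t\<^sup>2)"
    by (simp add: rt_square of_rat_mult power2_eq_square mult_ac)
  then show ?thesis using rat_square_multiple by (simp only: of_rat_eq_iff)
qed

text \<open>
  If \<open>w + x rt = - (y \<beta> + z \<gamma>)\<close>, squaring both sides and comparing coefficients in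
  \<open>\<rat>(rt)\<close> shows that \<open>(w\<^sup>2 - d x\<^sup>2)\<^sup>2\<close> is \<open>d\<close> times a rational square;
  as \<open>d\<close> is not a square, this makes the left side vanish, and then \<open>y\<^sup>2 + z\<^sup>2 = 0\<close>.
\<close>

lemma elt_eq_0:
  assumes "elt A = 0"
  shows "A = 0"
proof -
  obtain w x y z where A: "A = (w, x, y, z)" by (cases A) auto
  define u where "u = y\<^sup>2 - z\<^sup>2"
  define v where "v = 2 * y * z"
  note uv = u_def v_def
  let ?a = "of_int a :: rat" and ?b = "of_int b :: rat" and ?c = "of_int c :: rat"
    and ?d = "of_int d :: rat"
  have "elt (mulq (w, x, 0, 0) (w, x, 0, 0)) = elt (mulq (0, 0, y, z) (0, 0, y, z))"
  proof -
    have "elt (w, x, 0, 0) = - elt (0, 0, y, z)" using assms by (simp add: A add_eq_0_iff)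
    then show ?thesis unfolding elt_mulq by (simp only: minus_mult_minus)
  qed
  then have "of_rat (w\<^sup>2 + ?d * x\<^sup>2 - ?a * ?d * (y\<^sup>2 + z\<^sup>2))
      + of_rat (2 * w * x - ?a * (?c * v - ?b * u)) * rt = 0"
    by (simp add: uv power2_eq_square of_rat_add of_rat_mult of_rat_diff algebra_simps)
  from quadratic_independent[OF this]
  have 1: "w\<^sup>2 + ?d * x\<^sup>2 = ?a * ?d * (y\<^sup>2 + z\<^sup>2)" and 2: "2 * w * x = ?a * (?c * v - ?b * u)"
    by auto
  have "(w\<^sup>2 - ?d * x\<^sup>2)\<^sup>2 = (w\<^sup>2 + ?d * x\<^sup>2)\<^sup>2 - ?d * (2 * w * x)\<^sup>2"
    by (simp add: power2_eq_square algebra_simps)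
  also have "\<dots> = ?a\<^sup>2 * ?d * (?d * (u\<^sup>2 + v\<^sup>2) - (?c * v - ?b * u)\<^sup>2)"
    unfolding 1 2 uv by (simp add: power2_eq_square algebra_simps)
  also have "?d * (u\<^sup>2 + v\<^sup>2) - (?c * v - ?b * u)\<^sup>2 = (?c * u + ?b * v)\<^sup>2"
    unfolding of_int_d by (simp add: power2_eq_square algebra_simps)
  finally have "(w\<^sup>2 - ?d * x\<^sup>2)\<^sup>2 = ?d * (?a * (?c * u + ?b * v))\<^sup>2"
    by (simp add: power_mult_distrib mult_ac)
  from rat_square_multiple[OF this] have "w\<^sup>2 = ?d * x\<^sup>2" by simp
  from rat_square_multiple[OF this] have wx: "w = 0" "x = 0" by auto
  then have "y\<^sup>2 + z\<^sup>2 = 0" using 1 a_nonzero d_ge_2 by simp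
  then have "y = 0" "z = 0" by (simp_all add: sum_power2_eq_zero_iff)
  then show ?thesis by (simp add: A wx zero_prod_def)
qed

lemma elt_inject: "elt A = elt B \<longleftrightarrow> A = B"
proof
  assume "elt A = elt B"
  then have "elt (A - B) = 0" by (simp add: elt_diff)
  then show "A = B" using elt_eq_0 by fastforce
qed simp

end

lemma complex_ring_simps [simp]:
  "carrier complex_ring = UNIV" "x \<otimes>\<^bsub>complex_ring\<^esub> y = x * y" "x \<oplus>\<^bsub>complex_ring\<^esub> y = x + y"
  "\<one>\<^bsub>complex_ring\<^esub> = 1" "\<zero>\<^bsub>complex_ring\<^esub> = 0"
  by (simp_all add: ring_of_type_algebra_def)

lemma complex_ring_a_inv: "\<ominus>\<^bsub>complex_ring\<^esub> x = - x"
proof -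
  interpret C: cring complex_ring by (rule cring_from_type_algebra)
  show ?thesis by (rule C.minus_equality) simp_all
qed

lemma complex_ring_m_inv: "x \<noteq> 0 \<Longrightarrow> inv\<^bsub>complex_ring\<^esub> x = inverse x"
proof -
  assume x: "x \<noteq> 0"
  interpret C: cring complex_ring by (rule cring_from_type_algebra)
  show ?thesis by (rule C.comm_inv_char) (use x in simp_all)
qed

context cyclic_quartic_data
begin

text \<open>
  The product of an element with its conjugate over \<open>\<rat>(rt)\<close> is
  \<open>relnorm0 A + relnorm1 A * rt\<close>.
\<close>

fun relnorm0 :: "quad \<Rightarrow> rat" where
  "relnorm0 (w, x, y, z) = w\<^sup>2 + of_int d * x\<^sup>2 - of_int (a * d) * (y\<^sup>2 + z\<^sup>2)"

fun relnorm1 :: "quad \<Rightarrow> rat" where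
  "relnorm1 (w, x, y, z) = 2 * w * x + of_int (a * b) * (y\<^sup>2 - z\<^sup>2) - 2 * of_int (a * c) * y * z"

lemma mulq_conj2: "mulq A (conjq (conjq A)) = (relnorm0 A, relnorm1 A, 0, 0)"
  by (cases A) (simp add: power2_eq_square algebra_simps)

lemma mulq_conj1: "mulq (u, v, 0, 0) (u, - v, 0, 0) = (u\<^sup>2 - of_int d * v\<^sup>2, 0, 0, 0)"
  by (simp add: power2_eq_square)

lemma mulq_assoc: "mulq (mulq A B) C = mulq A (mulq B C)"
  by (simp add: elt_mulq mult.assoc flip: elt_inject)

lemma conjq_eq_0: "conjq A = 0 \<longleftrightarrow> A = 0"
  by (cases A) (auto simp: zero_prod_def)

lemma elt_eq_0_iff: "elt A = 0 \<longleftrightarrow> A = 0"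
  using elt_eq_0 elt_zero by blast

lemma norm_nonzero:
  assumes "A \<noteq> 0"
  shows "(relnorm0 A)\<^sup>2 - of_int d * (relnorm1 A)\<^sup>2 \<noteq> 0"
proof
  assume "(relnorm0 A)\<^sup>2 - of_int d * (relnorm1 A)\<^sup>2 = 0"
  then have "relnorm0 A = 0 \<and> relnorm1 A = 0" by (intro rat_square_multiple) simp
  then have "elt A * elt (conjq (conjq A)) = 0"
    using elt_mulq[of A "conjq (conjq A)"] by (simp add: mulq_conj2)
  then show False using assms by (simp add: elt_eq_0_iff conjq_eq_0)
qed

text \<open>
  Rationalising in two steps: first by the conjugate over \<open>\<rat>(rt)\<close>, then by
  \<open>rt \<mapsto> - rt\<close> on the relative norm.
\<close>

lemma elt_inverse: "\<exists>B. elt B = inverse (elt A)"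
proof (cases "A = 0")
  case True
  then have "elt 0 = inverse (elt A)" by (simp add: elt_zero)
  then show ?thesis by blast
next
  case False
  define N where "N = (relnorm0 A)\<^sup>2 - of_int d * (relnorm1 A)\<^sup>2"
  have N: "N \<noteq> 0" using norm_nonzero[OF False] by (simp add: N_def)
  define B where "B = mulq (conjq (conjq A)) (mulq (relnorm0 A,
      - relnorm1 A, 0, 0) (1 / N, 0, 0, 0))"
  have "mulq A B = mulq (mulq (relnorm0 A, relnorm1 A, 0, 0) (relnorm0 A,
      - relnorm1 A, 0, 0)) (1 / N, 0, 0, 0)"
    by (simp only: B_def mulq_assoc flip: mulq_conj2)
  also have "\<dots> = (1, 0, 0, 0)" unfolding mulq_conj1 using N by (simp add: N_def)
  finally have "elt A * elt B = 1" by (simp flip: elt_mulq)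
  then have "elt B = inverse (elt A)" by (metis inverse_unique)
  then show ?thesis by blast
qed

definition F :: "complex set" where "F = cyclic_quartic_field a b d"

lemma F_closed:
  "1 \<in> F" "x \<in> F \<Longrightarrow> y \<in> F \<Longrightarrow> x + y \<in> F" "x \<in> F \<Longrightarrow> y \<in> F \<Longrightarrow> x * y \<in> F"
  "x \<in> F \<Longrightarrow> - x \<in> F" "x \<in> F \<Longrightarrow> x \<noteq> 0 \<Longrightarrow> inverse x \<in> F" "\<beta> \<in> F"
  using generate_field.intros[where R = complex_ring and H = "{\<beta>}"]
  by (simp_all add: F_def cyclic_quartic_field_def \<beta>_def complex_ring_a_inv complex_ring_m_inv)

lemma F_of_rat: "of_rat r \<in> F"
proof -
  have zero: "0 \<in> F" using F_closed(2)[OF F_closed(1) F_closed(4)[OF F_closed(1)]] by simp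
  have nat: "of_nat n \<in> F" for n by (induction n) (simp_all add: zero F_closed)
  have int: "of_int n \<in> F" for n
    by (cases n rule: int_cases2) (simp_all add: nat F_closed(4))
  obtain n k where nk: "quotient_of r = (n, k)" by (cases "quotient_of r") auto
  have "k > 0" using quotient_of_denom_pos[OF nk] .
  have "of_rat r = of_int n * inverse (of_int k :: complex)"
    using quotient_of_div[OF nk] by (simp add: of_rat_divide divide_inverse of_rat_mult
      of_rat_inverse)
  also have "\<dots> \<in> F" using \<open>k > 0\<close> by (intro F_closed(3,5) int) simp
  finally show ?thesis .
qed

lemma F_eq: "F = range elt"
proof
  show "F \<subseteq> range elt"
  proof
    fix x assume "x \<in> F"
    then show "x \<in> range elt" unfolding F_def cyclic_quartic_field_def
    proof (induction rule: generate_field.induct)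
      case one
      have "elt (1, 0, 0, 0) = 1" by simp
      then show ?case by (metis complex_ring_simps(4) rangeI)
    next
      case (incl h)
      then have "h = elt (0, 0, 1, 0)" by (simp add: \<beta>_def)
      then show ?case by (simp only: rangeI)
    next
      case (a_inv h)
      then show ?case by (auto simp: complex_ring_a_inv simp flip: elt_minus simp del: elt.simps)
    next
      case (m_inv h)
      then obtain A where "h = elt A" by blast
      moreover obtain B where "elt B = inverse (elt A)" using elt_inverse by blast
      ultimately have "inv\<^bsub>complex_ring\<^esub> h = elt B" using m_inv by (simp add: complex_ring_m_inv)
      then show ?case by (simp only: rangeI)
    next
      case (eng_add h1 h2)
      then obtain A B where "h1 = elt A" "h2 = elt B" by blast
      then have "h1 \<oplus>\<^bsub>complex_ring\<^esub> h2 = elt (A + B)" by (simp add: elt_add)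
      then show ?case by (simp only: rangeI)
    next
      case (eng_mult h1 h2)
      then obtain A B where "h1 = elt A" "h2 = elt B" by blast
      then have "h1 \<otimes>\<^bsub>complex_ring\<^esub> h2 = elt (mulq A B)" by (simp add: elt_mulq)
      then show ?case by (simp only: rangeI)
    qed
  qed
  have "rt \<in> F"
  proof -
    have b: "of_int b \<noteq> (0 :: complex)" "of_int a \<noteq> (0 :: complex)"
      using b_pos a_nonzero by simp_all
    have "of_int d - of_rat (1 / of_int a) * (\<beta> * \<beta>) = of_int b * rt"
      using b(2) by (simp add: \<beta>_square of_rat_divide field_simps)
    then have "rt = of_rat (1 / of_int b) * (of_rat (of_int d) +
        - (of_rat (1 / of_int a) * (\<beta> * \<beta>)))"
      using b by (simp add: of_rat_divide)
    also have "\<dots> \<in> F" by (intro F_closed F_of_rat)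
    finally show ?thesis .
  qed
  have "\<gamma> = of_rat (of_int (a * c)) * rt * inverse \<beta>"
      by (simp add: \<gamma>_def divide_inverse of_rat_mult)
  also have "\<dots> \<in> F" by (intro F_closed F_of_rat \<open>rt \<in> F\<close> \<beta>_nonzero)
  finally have "\<gamma> \<in> F" .
  then have "elt (w, x, y, z) \<in> F" for w x y z
    using \<open>rt \<in> F\<close> by (simp add: F_closed F_of_rat)
  then show "range elt \<subseteq> F" by (auto simp del: elt.simps)
qed

lemma elt_in_F: "elt A \<in> F" by (simp add: F_eq)

lemma F_cases:
  assumes "x \<in> F" obtains A where "x = elt A"
  using assms by (auto simp: F_eq)

text \<open>
  Evaluating an integer polynomial commutes with the Galois generator, so a conjugate is a root of the
  same monic polynomial.
\<close>

lemma algebraic_int_conjq: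
  assumes "algebraic_int (elt A)"
  shows "algebraic_int (elt (conjq A))"
proof -
  obtain p :: "int poly" where p: "poly (map_poly of_int p) (elt A) = 0" "lead_coeff p = 1"
    using assms by (auto simp: algebraic_int_altdef_ipoly)
  have "\<exists>W. elt W = poly (map_poly of_int p) (elt A) \<and>
            elt (conjq W) = poly (map_poly of_int p) (elt (conjq A))" for p :: "int poly"
  proof (induction p)
    case 0
    show ?case by (rule exI[of _ 0]) (simp add: zero_prod_def)
  next
    case (pCons k p)
    then obtain W where W: "elt W = poly (map_poly of_int p) (elt A)"
        "elt (conjq W) = poly (map_poly of_int p) (elt (conjq A))" by blast
    let ?W = "(of_int k, 0, 0, 0) + mulq A W"
    have "elt ?W = poly (map_poly of_int (pCons k p)) (elt A)"
      unfolding elt_add elt_mulq W by (simp add: Polynomial.map_poly_pCons)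
    moreover have "elt (conjq ?W) = poly (map_poly of_int (pCons k p)) (elt (conjq A))"
      unfolding elt_add elt_mulq W conjq_add conjq_mulq by (simp add: Polynomial.map_poly_pCons)
    ultimately show ?case by blast
  qed
  then obtain W where "elt W = poly (map_poly of_int p) (elt A)"
      "elt (conjq W) = poly (map_poly of_int p) (elt (conjq A))" by blast
  with p(1) have "poly (map_poly of_int p) (elt (conjq A)) = 0"
    by (metis elt_eq_0 elt_eq_0_iff conjq_eq_0)
  with p(2) show ?thesis by (auto simp: algebraic_int_altdef_ipoly)
qed

end

section \<open>The integers in coordinates\<close>

lemma of_rat_algebraic_int: "algebraic_int (of_rat r :: complex) \<longleftrightarrow> r \<in> \<int>"
proof
  assume "algebraic_int (of_rat r :: complex)"
  then have "of_rat r \<in> (\<int> :: complex set)" by (rule rational_algebraic_int_is_int) simp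
  then obtain k where "of_rat r = (of_int k :: complex)" by (auto elim: Ints_cases)
  then have "of_rat r = (of_rat (of_int k) :: complex)" by simp
  then have "r = of_int k" by (simp only: of_rat_eq_iff)
  then show "r \<in> \<int>" by simp
qed (auto elim!: Ints_cases)

context cyclic_quartic_data
begin

text \<open>
  Trace and norm to \<open>\<rat>\<close> are integers, which makes \<open>d (2 v)\<^sup>2\<close> an integer; then
  \<open>2 v\<close> is one because \<open>d\<close> is squarefree.
\<close>

lemma quadratic_integer:
  assumes "algebraic_int (elt (u, v, 0, 0))"
  obtains U V :: int where "2 * u = of_int U" "2 * v = of_int V" "4 dvd U\<^sup>2 - d * V\<^sup>2"
proof -
  have conj: "algebraic_int (elt (u, - v, 0, 0))" using algebraic_int_conjq[OF assms] by simp
  have "elt (u, v, 0, 0) + elt (u, - v, 0, 0) = of_rat (2 * u)"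
    by (simp add: of_rat_mult of_rat_minus)
  then have "2 * u \<in> \<int>"
    using algebraic_int_add[OF assms conj] by (simp only: of_rat_algebraic_int)
  then obtain U where U: "2 * u = of_int U" by (auto elim: Ints_cases)
  have "elt (u, v, 0, 0) * elt (u, - v, 0, 0) = of_rat (u\<^sup>2 - of_int d * v\<^sup>2)"
    using elt_mulq[of "(u, v, 0, 0)" "(u, - v, 0, 0)"] unfolding mulq_conj1 by simp
  then have "u\<^sup>2 - of_int d * v\<^sup>2 \<in> \<int>"
    using algebraic_int_mult[OF assms conj] by (simp only: of_rat_algebraic_int)
  then obtain N where N: "u\<^sup>2 - of_int d * v\<^sup>2 = of_int N" by (auto elim: Ints_cases)
  have "of_int d * (2 * v)\<^sup>2 = (2 * u)\<^sup>2 - 4 * (u\<^sup>2 - of_int d * v\<^sup>2)"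
    by (simp add: power2_eq_square algebra_simps)
  also have "\<dots> = of_int (U\<^sup>2 - 4 * N)" by (simp only: U N) simp
  finally have dV: "of_int d * (2 * v)\<^sup>2 = of_int (U\<^sup>2 - 4 * N)" .
  have "2 * v \<in> \<int>"
    by (rule rat_Ints_if_squarefree_multiple[OF squarefree_d]) (simp only: dV Ints_of_int)
  then obtain V where V: "2 * v = of_int V" by (auto elim: Ints_cases)
  have "of_int (d * V\<^sup>2) = (of_int (U\<^sup>2 - 4 * N) :: rat)" using dV by (simp only: V) simp
  then have "d * V\<^sup>2 = U\<^sup>2 - 4 * N" by (simp only: of_int_eq_iff)
  then show ?thesis using that[OF U V] by simp
qed

lemma integral_relative_trace_norm:
  assumes "algebraic_int (elt (w, x, y, z))"
  shows "algebraic_int (elt (2 * w, 2 * x, 0, 0))" "algebraic_int (elt (0, 0, 2 * y, 2 * z))"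
    "algebraic_int (elt (relnorm0 (w, x, y, z), relnorm1 (w, x, y, z), 0, 0))"
proof -
  let ?A = "(w, x, y, z)"
  have conj: "algebraic_int (elt (conjq (conjq ?A)))"
    by (intro algebraic_int_conjq assms)
  have "?A + conjq (conjq ?A) = (2 * w, 2 * x, 0, 0)" "?A - conjq (conjq ?A) = (0, 0, 2 * y, 2 * z)"
    by simp_all
  then show "algebraic_int (elt (2 * w, 2 * x, 0, 0))" "algebraic_int (elt (0, 0, 2 * y, 2 * z))"
    using algebraic_int_add[OF assms conj] algebraic_int_diff[OF assms conj]
    by (simp_all only: flip: elt_add elt_diff)
  show "algebraic_int (elt (relnorm0 ?A, relnorm1 ?A, 0, 0))"
    using algebraic_int_mult[OF assms conj] by (simp only: mulq_conj2 flip: elt_mulq)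
qed

lemma squarefree_ad: "squarefree (a * d)"
  using squarefree_mult_coprime[OF _ squarefree_a squarefree_d] gcd_ad
  by (simp add: coprime_iff_gcd_eq_1)

text \<open>
  Let \<open>Z\<close> be the difference of an integer and its conjugate over \<open>\<rat>(rt)\<close>, and
  \<open>Z'\<close> the image of \<open>Z\<close> under the Galois generator.  Both \<open>Z\<^sup>2\<close> and
  \<open>Z Z'\<close> are integers of \<open>\<rat>(rt)\<close>.  Their coefficients are quadratic forms in the last
  two coordinates, from which \<open>a d X2\<^sup>2\<close> and \<open>a d X3\<^sup>2\<close> can be solved for, using
  \<open>d = b\<^sup>2 + c\<^sup>2\<close>; as \<open>a d\<close> is squarefree, \<open>X2\<close> and \<open>X3\<close> are integers.
  The other conclusions express in these coordinates that \<open>Z\<^sup>2\<close>, \<open>Z Z'\<close> and the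
  relative trace and norm are integral; they decide which quarters occur.
\<close>

lemma integral_coordinates:
  assumes int: "algebraic_int (elt A)"
  obtains X0 X1 X2 X3 U2 V2 V' U3 V3 :: int
  where "A = (of_int X0 / 4, of_int X1 / 4, of_int X2 / 4, of_int X3 / 4)"
    "4 dvd X0\<^sup>2 - d * X1\<^sup>2"
    "2 * U2 = a * d * (X2\<^sup>2 + X3\<^sup>2)" "2 * V2 = a * (2 * c * X2 * X3 - b * (X2\<^sup>2 - X3\<^sup>2))"
    "4 dvd U2\<^sup>2 - d * V2\<^sup>2"
    "2 * V' = a * (c * (X2\<^sup>2 - X3\<^sup>2) + 2 * b * X2 * X3)" "4 dvd d * V'\<^sup>2"
    "8 * U3 = X0\<^sup>2 + d * X1\<^sup>2 - a * d * (X2\<^sup>2 + X3\<^sup>2)"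
    "8 * V3 = 2 * X0 * X1 + a * b * (X2\<^sup>2 - X3\<^sup>2) - 2 * a * c * X2 * X3"
    "4 dvd U3\<^sup>2 - d * V3\<^sup>2"
proof -
  obtain w x y z where A: "A = (w, x, y, z)" by (cases A) auto
  note tn = integral_relative_trace_norm[OF int[unfolded A]]
  obtain X0 X1 where X01: "2 * (2 * w) = of_int X0" "2 * (2 * x) = of_int X1" "4 dvd X0\<^sup>2 - d * X1\<^sup>2"
    by (rule quadratic_integer[OF tn(1)])
  let ?Z = "(0, 0, 2 * y, 2 * z) :: quad"
  let ?u = "(4 * y)\<^sup>2 - (4 * z)\<^sup>2"
  let ?v = "2 * (4 * y) * (4 * z)"
  have "mulq ?Z ?Z = (of_int (a * d) * ((4 * y)\<^sup>2 + (4 * z)\<^sup>2) / 4,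
      of_int a * (of_int c * ?v - of_int b * ?u) / 4, 0, 0)"
    by (simp add: power2_eq_square algebra_simps)
  then have "algebraic_int (elt (of_int (a * d) * ((4 * y)\<^sup>2 + (4 * z)\<^sup>2) / 4,
      of_int a * (of_int c * ?v - of_int b * ?u) / 4, 0, 0))"
    using algebraic_int_mult[OF tn(2) tn(2)] by (simp only: flip: elt_mulq)
  then obtain U2 V2 where
      U2': "2 * (of_int (a * d) * ((4 * y)\<^sup>2 + (4 * z)\<^sup>2) / 4) = of_int U2"
    and V2': "2 * (of_int a * (of_int c * ?v - of_int b * ?u) / 4) = of_int V2"
    and UV2: "4 dvd U2\<^sup>2 - d * V2\<^sup>2"
    by (rule quadratic_integer)
  have "mulq ?Z (conjq ?Z) = (0, of_int a * (of_int c * ?u + of_int b * ?v) / 4, 0, 0)"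
    by (simp add: power2_eq_square algebra_simps)
  then have "algebraic_int (elt (0, of_int a * (of_int c * ?u + of_int b * ?v) / 4, 0, 0))"
    using algebraic_int_mult[OF tn(2) algebraic_int_conjq[OF tn(2)]] by (simp only: flip: elt_mulq)
  then obtain U' V' where U': "2 * 0 = (of_int U' :: rat)"
    and V'': "2 * (of_int a * (of_int c * ?u + of_int b * ?v) / 4) = of_int V'"
    and UV': "4 dvd U'\<^sup>2 - d * V'\<^sup>2"
    by (rule quadratic_integer)
  have U2: "of_int (a * d) * ((4 * y)\<^sup>2 + (4 * z)\<^sup>2) = of_int (2 * U2)" using U2' by simp
  have V2: "of_int a * (of_int c * ?v - of_int b * ?u) = of_int (2 * V2)" using V2' by simp
  have V': "of_int a * (of_int c * ?u + of_int b * ?v) = of_int (2 * V')" using V'' by simp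
  have "of_int (a * d) * ?u = of_int c * (of_int a * (of_int c * ?u + of_int b * ?v))
      - of_int b * (of_int a * (of_int c * ?v - of_int b * ?u))"
    unfolding of_int_mult of_int_d by (simp add: algebra_simps)
  also have "\<dots> = of_int (2 * (c * V' - b * V2))" unfolding V2 V' by (simp add: algebra_simps)
  finally have u: "of_int (a * d) * ?u = of_int (2 * (c * V' - b * V2))" .
  have "2 * (of_int (a * d) * (4 * y)\<^sup>2)
      = of_int (a * d) * ((4 * y)\<^sup>2 + (4 * z)\<^sup>2) + of_int (a * d) * ?u"
    by (simp add: algebra_simps)
  also have "\<dots> = 2 * of_int (U2 + (c * V' - b * V2))" unfolding U2 u by simp
  finally have a_d_y: "of_int (a * d) * (4 * y)\<^sup>2 = of_int (U2 + (c * V' - b * V2))" by simp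
  have "4 * y \<in> \<int>"
    by (rule rat_Ints_if_squarefree_multiple[OF squarefree_ad]) (simp only: a_d_y Ints_of_int)
  then obtain X2 where X2: "4 * y = of_int X2" by (auto elim: Ints_cases)
  have "2 * (of_int (a * d) * (4 * z)\<^sup>2)
      = of_int (a * d) * ((4 * y)\<^sup>2 + (4 * z)\<^sup>2) - of_int (a * d) * ?u"
    by (simp add: algebra_simps)
  also have "\<dots> = 2 * of_int (U2 - (c * V' - b * V2))" unfolding U2 u by simp
  finally have a_d_z: "of_int (a * d) * (4 * z)\<^sup>2 = of_int (U2 - (c * V' - b * V2))" by simp
  have "4 * z \<in> \<int>"
    by (rule rat_Ints_if_squarefree_multiple[OF squarefree_ad]) (simp only: a_d_z Ints_of_int)
  then obtain X3 where X3: "4 * z = of_int X3" by (auto elim: Ints_cases)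
  have wxyz: "w = of_int X0 / 4" "x = of_int X1 / 4" "y = of_int X2 / 4" "z = of_int X3 / 4"
    using X01 X2 X3 by simp_all
  obtain U3 V3 where U3: "2 * relnorm0 (w, x, y, z) = of_int U3"
      and V3: "2 * relnorm1 (w, x, y, z) = of_int V3"
    and UV3: "4 dvd U3\<^sup>2 - d * V3\<^sup>2"
    by (rule quadratic_integer[OF tn(3)])
  show ?thesis
  proof (rule that)
    show "A = (of_int X0 / 4, of_int X1 / 4, of_int X2 / 4, of_int X3 / 4)" by (simp only: A wxyz)
    show "2 * U2 = a * d * (X2\<^sup>2 + X3\<^sup>2)"
    proof -
      have "of_int (2 * U2) = (of_int (a * d * (X2\<^sup>2 + X3\<^sup>2)) :: rat)"
        using U2 unfolding X2 X3 by simp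
      then show ?thesis by (simp only: of_int_eq_iff)
    qed
    show "2 * V2 = a * (2 * c * X2 * X3 - b * (X2\<^sup>2 - X3\<^sup>2))"
    proof -
      have "of_int (2 * V2) = (of_int (a * (2 * c * X2 * X3 - b * (X2\<^sup>2 - X3\<^sup>2))) :: rat)"
        using V2 unfolding X2 X3 by (simp add: mult_ac)
      then show ?thesis by (simp only: of_int_eq_iff)
    qed
    show "2 * V' = a * (c * (X2\<^sup>2 - X3\<^sup>2) + 2 * b * X2 * X3)"
    proof -
      have "of_int (2 * V') = (of_int (a * (c * (X2\<^sup>2 - X3\<^sup>2) + 2 * b * X2 * X3)) :: rat)"
        using V' unfolding X2 X3 by (simp add: mult_ac)
      then show ?thesis by (simp only: of_int_eq_iff)
    qed
    show "4 dvd d * V'\<^sup>2" using UV' U' by simp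
    show "8 * U3 = X0\<^sup>2 + d * X1\<^sup>2 - a * d * (X2\<^sup>2 + X3\<^sup>2)"
    proof -
      have "of_int (8 * U3) = (of_int (X0\<^sup>2 + d * X1\<^sup>2 - a * d * (X2\<^sup>2 + X3\<^sup>2)) :: rat)"
        unfolding of_int_mult U3[symmetric] wxyz by (simp add: field_simps power2_eq_square)
      then show ?thesis by (simp only: of_int_eq_iff)
    qed
    show "8 * V3 = 2 * X0 * X1 + a * b * (X2\<^sup>2 - X3\<^sup>2) - 2 * a * c * X2 * X3"
    proof -
      have "of_int (8 * V3)
          = (of_int (2 * X0 * X1 + a * b * (X2\<^sup>2 - X3\<^sup>2) - 2 * a * c * X2 * X3) :: rat)"
        unfolding of_int_mult V3[symmetric] wxyz by (simp add: field_simps power2_eq_square)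
      then show ?thesis by (simp only: of_int_eq_iff)
    qed
  qed (rule X01(3) UV2 UV3)+
qed

end

text \<open>
  The condition on integers \<open>X0, X1, X2, X3\<close> for
  \<open>(X0 + X1 rt + X2 \<beta> + X3 \<gamma>) / 4\<close> to be an algebraic integer.  The first branch is the
  case of even \<open>d\<close>; only in the third branch do genuine quarters occur.
\<close>

definition integral_coords :: "int \<Rightarrow> int \<Rightarrow> int \<Rightarrow> int \<Rightarrow> int \<Rightarrow> int \<Rightarrow> int \<Rightarrow> bool" where
  "integral_coords a b c X0 X1 X2 X3 \<longleftrightarrow>
     (if odd b \<and> odd c then 4 dvd X0 \<and> 4 dvd X1 \<and> 4 dvd X2 \<and> 4 dvd X3
      else if odd b then even X0 \<and> 4 dvd X0 - X1 \<and> 4 dvd X2 \<and> 4 dvd X3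
      else if [a + b = 1] (mod 4)
        then even (X0 - X1) \<and> even (X0 - X2) \<and> even (X0 - X3) \<and> 4 dvd X0 - X1 - X2 + a * c * X3
      else even X0 \<and> 4 dvd X0 - X1 \<and> even X2 \<and> 4 dvd X2 - X3)"

lemma no_parity4: "4 * (p :: int) = 4 * q + 2 \<Longrightarrow> P" by presburger

lemma even_if_4_eq: "4 * (n :: int) = 2 * e + 4 * w \<Longrightarrow> even e" by presburger
lemma dvd_4_if_even: "even (e :: int) \<Longrightarrow> 4 dvd 2 * e + 4 * w" by presburger

lemma odd_square:
  assumes "odd (x :: int)" obtains k where "x\<^sup>2 = 8 * k + 1"
proof -
  obtain j where j: "x = 2 * j + 1" using assms by (auto elim: oddE)
  have "even (j * (j + 1))" by simp
  then obtain k where k: "j * (j + 1) = 2 * k" by (rule evenE)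
  have "x\<^sup>2 = 4 * (j * (j + 1)) + 1" unfolding j by (simp add: power2_eq_square algebra_simps)
  then show ?thesis using that[of k] k by simp
qed

lemma even_iff_of_square_diff: "odd d \<Longrightarrow> 4 dvd P\<^sup>2 - d * Q\<^sup>2 \<Longrightarrow> even (P :: int) \<longleftrightarrow> even Q"
proof -
  assume d: "odd d" and "4 dvd P\<^sup>2 - d * Q\<^sup>2"
  then have "even (P\<^sup>2 - d * Q\<^sup>2)" by (meson dvd_trans even_numeral)
  then show ?thesis using d by simp
qed

context cyclic_quartic_data
begin

lemma d_odd_iff: "odd d \<longleftrightarrow> \<not> (odd b \<and> odd c)"
proof -
  have "even b \<Longrightarrow> even c \<Longrightarrow> False"
  proof -
    assume "even b" "even c"
    then have "2\<^sup>2 dvd b\<^sup>2" "2\<^sup>2 dvd c\<^sup>2" by (simp_all only: dvd_power_same)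
    then have "2\<^sup>2 dvd d" unfolding d_eq by (rule dvd_add)
    then have "(2 :: int) dvd 1" using squarefree_d unfolding squarefree_def by blast
    then show False by simp
  qed
  then show ?thesis by (auto simp: d_eq)
qed

lemma d_mod4_odd: assumes "odd d" obtains m where "d = 4 * m + 1"
proof -
  consider "odd b" "even c" | "even b" "odd c" using assms by (auto simp: d_eq)
  then show ?thesis
  proof cases
    case 1
    obtain k where "b\<^sup>2 = 8 * k + 1" using odd_square[OF 1(1)] by blast
    moreover obtain j where "c = 2 * j" using 1(2) by (auto elim: evenE)
    ultimately have "d = 4 * (2 * k + j\<^sup>2) + 1" unfolding d_eq by (simp add: power2_eq_square)
    then show ?thesis by (rule that)
  next
    case 2
    obtain k where "c\<^sup>2 = 8 * k + 1" using odd_square[OF 2(2)] by blast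
    moreover obtain j where "b = 2 * j" using 2(1) by (auto elim: evenE)
    ultimately have "d = 4 * (2 * k + j\<^sup>2) + 1" unfolding d_eq by (simp add: power2_eq_square)
    then show ?thesis by (rule that)
  qed
qed

text \<open>
  For even \<open>d\<close> both \<open>b\<close> and \<open>c\<close> are odd, so that \<open>d\<close> is 2 modulo 8.
\<close>

lemma even_even_of_square_diff:
  assumes "even d" "4 dvd P\<^sup>2 - d * Q\<^sup>2"
  shows "even P \<and> even Q"
proof -
  have bc: "odd b" "odd c" using d_odd_iff assms(1) by auto
  obtain k l where kl: "b\<^sup>2 = 8 * k + 1" "c\<^sup>2 = 8 * l + 1"
    using odd_square[OF bc(1)] odd_square[OF bc(2)] by metis
  have "even (P\<^sup>2 - d * Q\<^sup>2)" using assms(2) by (meson dvd_trans even_numeral)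
  then have P: "even P" using assms(1) by simp
  obtain p where p: "P = 2 * p" using P by (auto elim: evenE)
  obtain N where N: "P\<^sup>2 - d * Q\<^sup>2 = 4 * N" using assms(2) by (auto elim: dvdE)
  have "even Q"
  proof (rule ccontr)
    assume "odd Q"
    then obtain q where q: "Q\<^sup>2 = 8 * q + 1" using odd_square by blast
    have "4 * (p\<^sup>2 - N) = 4 * (16 * k * q + 16 * l * q + 4 * q + 2 * k + 2 * l) + 2"
      using N unfolding p q d_eq kl by (simp add: power2_eq_square algebra_simps)
    then show False by (rule no_parity4)
  qed
  with P show ?thesis by simp
qed

text \<open>
  Two rounds of halving.  That \<open>X2\<close> and \<open>X3\<close> are even follows in the first round from
  \<open>Z\<^sup>2\<close> and in the second round from the relative norm, both times by the claim
  \<open>both_even\<close>.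
\<close>

lemma integral_coords_even:
  assumes d: "even d"
    and X01: "4 dvd X0\<^sup>2 - d * X1\<^sup>2"
    and U2: "2 * U2 = a * d * (X2\<^sup>2 + X3\<^sup>2)"
        and V2: "2 * V2 = a * (2 * c * X2 * X3 - b * (X2\<^sup>2 - X3\<^sup>2))"
    and UV2: "4 dvd U2\<^sup>2 - d * V2\<^sup>2"
    and U3: "8 * U3 = X0\<^sup>2 + d * X1\<^sup>2 - a * d * (X2\<^sup>2 + X3\<^sup>2)"
    and V3: "8 * V3 = 2 * X0 * X1 + a * b * (X2\<^sup>2 - X3\<^sup>2) - 2 * a * c * X2 * X3"
    and UV3: "4 dvd U3\<^sup>2 - d * V3\<^sup>2"
  shows "4 dvd X0 \<and> 4 dvd X1 \<and> 4 dvd X2 \<and> 4 dvd X3"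
proof -
  have bc: "odd b" "odd c" using d_odd_iff d by auto
  have both_even: "even x \<and> even y"
    if V: "2 * (2 * V) = a * (2 * c * x * y - b * (x\<^sup>2 - y\<^sup>2))" for x y V :: int
  proof -
    have "even (a * (2 * c * x * y - b * (x\<^sup>2 - y\<^sup>2)))" unfolding V[symmetric] by simp
    then have par: "even x \<longleftrightarrow> even y" using odd_a bc by simp
    moreover have False if xy: "odd x" "odd y"
    proof -
      obtain k l where kl: "x\<^sup>2 = 8 * k + 1" "y\<^sup>2 = 8 * l + 1"
        using odd_square[OF xy(1)] odd_square[OF xy(2)] by metis
      have "odd (a * c * x * y)" using odd_a bc xy by simp
      then obtain m where m: "a * c * x * y = 2 * m + 1" by (rule oddE)
      have "4 * (V + 2 * a * b * (k - l)) = 2 * (a * c * x * y)"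
        using V unfolding kl by (simp add: algebra_simps)
      then have "4 * (V + 2 * a * b * (k - l)) = 4 * m + 2" unfolding m by simp
      then show False by (rule no_parity4)
    qed
    ultimately show ?thesis by blast
  qed
  have "even V2" "even U2" using even_even_of_square_diff[OF d UV2] by auto
  then obtain V2' where "V2 = 2 * V2'" by (auto elim: evenE)
  then have X23: "even X2 \<and> even X3" using both_even V2 by simp
  have X01': "even X0 \<and> even X1" using even_even_of_square_diff[OF d X01] .
  obtain Y0 Y1 Y2 Y3 where Y: "X0 = 2 * Y0" "X1 = 2 * Y1" "X2 = 2 * Y2" "X3 = 2 * Y3"
    using X23 X01' by (auto elim!: evenE)
  obtain U3' V3' where UV3': "U3 = 2 * U3'" "V3 = 2 * V3'"
    using even_even_of_square_diff[OF d UV3] by (auto elim!: evenE)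
  have U: "4 * U3' = Y0\<^sup>2 + d * Y1\<^sup>2 - a * d * (Y2\<^sup>2 + Y3\<^sup>2)"
    using U3 unfolding Y UV3' by (simp add: algebra_simps)
  have V: "4 * V3' = 2 * Y0 * Y1 + a * b * (Y2\<^sup>2 - Y3\<^sup>2) - 2 * a * c * Y2 * Y3"
    using V3 unfolding Y UV3' by (simp add: algebra_simps)
  have "even (Y0\<^sup>2 + d * Y1\<^sup>2 - a * d * (Y2\<^sup>2 + Y3\<^sup>2))" unfolding U[symmetric] by simp
  then have "even Y0" using d by simp
  then obtain Z0 where Z0: "Y0 = 2 * Z0" by (auto elim: evenE)
  have "2 * (2 * (Z0 * Y1 - V3')) = a * (2 * c * Y2 * Y3 - b * (Y2\<^sup>2 - Y3\<^sup>2))"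
    using V unfolding Z0 by (simp add: algebra_simps)
  then have Y23: "even Y2 \<and> even Y3" by (rule both_even)
  then obtain Z2 Z3 where Z: "Y2 = 2 * Z2" "Y3 = 2 * Z3" by (auto elim!: evenE)
  have "0\<^sup>2 - d * Y1\<^sup>2 = 4 * (Z0\<^sup>2 - U3' - a * d * (Z2\<^sup>2 + Z3\<^sup>2))"
    using U unfolding Z0 Z by (simp add: algebra_simps)
  then have "4 dvd 0\<^sup>2 - d * Y1\<^sup>2" by simp
  then have "even Y1" using even_even_of_square_diff[OF d] by blast
  with \<open>even Y0\<close> Y23 show ?thesis unfolding Y by auto
qed

text \<open>
  Odd \<open>X2\<close>, \<open>X3\<close> force genuine quarters.  The product \<open>Z Z'\<close> then makes
  \<open>b\<close> even, the rational part of the relative norm modulo 8 gives the condition on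
  \<open>a + b\<close>, and its other part gives the congruence modulo 4.
\<close>

lemma both_odd_coords:
  assumes d: "odd d" and odd: "odd X2" "odd X3"
    and X01: "4 dvd X0\<^sup>2 - d * X1\<^sup>2"
    and V': "2 * V' = a * (c * (X2\<^sup>2 - X3\<^sup>2) + 2 * b * X2 * X3)" and dV': "4 dvd d * V'\<^sup>2"
    and U3: "8 * U3 = X0\<^sup>2 + d * X1\<^sup>2 - a * d * (X2\<^sup>2 + X3\<^sup>2)"
    and V3: "8 * V3 = 2 * X0 * X1 + a * b * (X2\<^sup>2 - X3\<^sup>2) - 2 * a * c * X2 * X3"
  shows "even b \<and> odd X0 \<and> odd X1 \<and> [a + b = 1] (mod 4) \<and> 4 dvd X0 - X1 - X2 + a * c * X3"
proof -
  obtain k2 k3 where k: "X2\<^sup>2 = 8 * k2 + 1" "X3\<^sup>2 = 8 * k3 + 1"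
    using odd_square[OF odd(1)] odd_square[OF odd(2)] by metis
  have "even (d * V'\<^sup>2)" using dV' by (meson dvd_trans even_numeral)
  then have "even V'" using d by simp
  have "2 * V' = 2 * (a * (c * (4 * (k2 - k3)) + b * X2 * X3))"
    using V' unfolding k by (simp add: algebra_simps)
  then have "V' = a * (c * (4 * (k2 - k3)) + b * X2 * X3)" by simp
  then have b: "even b" using \<open>even V'\<close> odd_a odd by auto
  then have c: "odd c" using d d_odd_iff by (auto simp: d_eq)
  have par: "even X0 \<longleftrightarrow> even X1" using even_iff_of_square_diff[OF d X01] .
  have X0: "odd X0"
  proof
    assume "even X0"
    then obtain i j where ij: "X0 = 2 * i" "X1 = 2 * j" using par by (auto elim!: evenE)
    have "odd (a * d)" using odd_a d by simp
    then obtain n where n: "a * d = 2 * n + 1" by (rule oddE)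
    have "4 * (i\<^sup>2 + d * j\<^sup>2 - 2 * U3) = (a * d) * (8 * k2 + 8 * k3 + 2)"
      using U3 unfolding ij k by (simp add: algebra_simps)
    also have "\<dots> = 4 * (a * d * (2 * k2 + 2 * k3) + n) + 2"
      by (simp only: n) (simp add: algebra_simps)
    finally show False by (rule no_parity4)
  qed
  then have X1: "odd X1" using par by simp
  obtain k0 k1 where k': "X0\<^sup>2 = 8 * k0 + 1" "X1\<^sup>2 = 8 * k1 + 1"
    using odd_square[OF X0] odd_square[OF X1] by metis
  have ab: "[a + b = 1] (mod 4)"
  proof -
    obtain n where n: "b = 2 * n" using b by (auto elim: evenE)
    obtain kc where kc: "c\<^sup>2 = 8 * kc + 1" using odd_square[OF c] .
    obtain ka where ka: "a = 2 * ka + 1" using odd_a by (auto elim: oddE)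
    have d': "d = 4 * n\<^sup>2 + 8 * kc + 1" by (simp add: d_eq n kc)
    have "8 * U3 = 8 * (k0 + d * k1 - a * d * (k2 + k3)) + (1 + d - 2 * (a * d))"
      using U3 unfolding k k' by (simp add: algebra_simps)
    then have "8 dvd 1 + d - 2 * (a * d)" by presburger
    moreover have "1 + d - 2 * (a * d)
        = 8 * (kc - a * n\<^sup>2 - 2 * a * kc) + 4 * (n\<^sup>2 - ka)"
      unfolding d' ka by (simp add: algebra_simps)
    ultimately have "8 dvd 4 * (n\<^sup>2 - ka)" by (simp add: dvd_add_right_iff)
    then have "even (n\<^sup>2 - ka)" by presburger
    then have "even (ka + n)" by simp
    then obtain t where t: "ka + n = 2 * t" by (rule evenE)
    have "a + b = 1 + 4 * t" unfolding ka n using t by simp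
    then show ?thesis by (simp add: cong_iff_dvd_diff)
  qed
  have "8 * V3 = 2 * (X0 * X1 + 4 * (a * b * (k2 - k3)) - a * c * X2 * X3)"
    using V3 unfolding k by (simp add: algebra_simps)
  then have "4 dvd X0 * X1 - a * c * X2 * X3" by presburger
  then obtain N where N: "X0 * X1 - a * c * X2 * X3 = 4 * N" by (rule dvdE)
  obtain j0 j1 j2 j3 where j: "X0 = 2 * j0 + 1" "X1 = 2 * j1 + 1" "X2 = 2 * j2 + 1"
      "X3 = 2 * j3 + 1"
    using X0 X1 odd by (metis oddE)
  have "odd (a * c)" using odd_a c by simp
  then obtain n where n: "a * c = 2 * n + 1" by (rule oddE)
  have "4 * N = X0 * X1 - (a * c) * (X2 * X3)" using N by (simp add: mult_ac)
  also have "\<dots> = 2 * (j0 + j1 - n - j2 - j3)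
      + 4 * (j0 * j1 - n * j2 - n * j3 - j2 * j3 - 2 * (n * j2 * j3))"
    unfolding n j by (simp add: algebra_simps)
  finally have "even (j0 + j1 - n - j2 - j3)" by (rule even_if_4_eq)
  moreover have "X0 - X1 - X2 + a * c * X3 = 2 * (j0 + j1 - n - j2 - j3)
      + 4 * (n * j3 + n + j3 - j1)"
    unfolding n j by (simp add: algebra_simps)
  ultimately have "4 dvd X0 - X1 - X2 + a * c * X3" by (simp only: dvd_4_if_even)
  with b X0 X1 ab show ?thesis by blast
qed

lemma half_integral_coords:
  assumes d: "odd d" and X01: "4 dvd X0\<^sup>2 - d * X1\<^sup>2" and even: "even X2" "even X3"
    and U3: "8 * U3 = X0\<^sup>2 + d * X1\<^sup>2 - a * d * (X2\<^sup>2 + X3\<^sup>2)"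
    and V3: "8 * V3 = 2 * X0 * X1 + a * b * (X2\<^sup>2 - X3\<^sup>2) - 2 * a * c * X2 * X3"
    and UV3: "4 dvd U3\<^sup>2 - d * V3\<^sup>2"
  obtains Y0 Y1 Y2 Y3 where "X0 = 2 * Y0" "X1 = 2 * Y1" "X2 = 2 * Y2" "X3 = 2 * Y3"
    "2 * U3 = Y0\<^sup>2 + d * Y1\<^sup>2 - a * d * (Y2\<^sup>2 + Y3\<^sup>2)"
    "2 * V3 = 2 * Y0 * Y1 + a * b * (Y2\<^sup>2 - Y3\<^sup>2) - 2 * a * c * Y2 * Y3"
    "even U3 \<longleftrightarrow> even V3"
proof -
  obtain m where m: "d = 4 * m + 1" using d_mod4_odd[OF d] .
  have par: "even X0 \<longleftrightarrow> even X1" using even_iff_of_square_diff[OF d X01] .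
  obtain Y2 Y3 where Y23: "X2 = 2 * Y2" "X3 = 2 * Y3" using even by (auto elim!: evenE)
  have "even X0"
  proof (rule ccontr)
    assume X0: "odd X0"
    then have X1: "odd X1" using par by simp
    obtain k0 k1 where k: "X0\<^sup>2 = 8 * k0 + 1" "X1\<^sup>2 = 8 * k1 + 1"
      using odd_square[OF X0] odd_square[OF X1] by metis
    have "4 * (2 * U3 - 2 * k0 - 2 * d * k1 + a * d * (Y2\<^sup>2 + Y3\<^sup>2)) = 1 + d"
      using U3 unfolding k Y23 by (simp add: algebra_simps)
    also have "\<dots> = 4 * m + 2" unfolding m by simp
    finally show False by (rule no_parity4)
  qed
  then obtain Y0 Y1 where Y01: "X0 = 2 * Y0" "X1 = 2 * Y1" using par by (auto elim!: evenE)
  show ?thesis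
  proof (rule that[OF Y01 Y23])
    show "2 * U3 = Y0\<^sup>2 + d * Y1\<^sup>2 - a * d * (Y2\<^sup>2 + Y3\<^sup>2)"
      using U3 unfolding Y01 Y23 by (simp add: algebra_simps)
    show "2 * V3 = 2 * Y0 * Y1 + a * b * (Y2\<^sup>2 - Y3\<^sup>2) - 2 * a * c * Y2 * Y3"
      using V3 unfolding Y01 Y23 by (simp add: algebra_simps)
    show "even U3 \<longleftrightarrow> even V3" using even_iff_of_square_diff[OF d UV3] .
  qed
qed

text \<open>
  Were \<open>Y2\<close> and \<open>Y3\<close> odd, the two coordinates of the doubled relative norm would have
  opposite parities.
\<close>

lemma half_coords_b_odd:
  assumes d: "odd d" and b: "odd b"
    and U3: "2 * U3 = Y0\<^sup>2 + d * Y1\<^sup>2 - a * d * (Y2\<^sup>2 + Y3\<^sup>2)"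
    and V3: "2 * V3 = 2 * Y0 * Y1 + a * b * (Y2\<^sup>2 - Y3\<^sup>2) - 2 * a * c * Y2 * Y3"
    and UV3: "even U3 \<longleftrightarrow> even V3"
  shows "even (Y0 - Y1) \<and> even Y2 \<and> even Y3"
proof -
  have c: "even c" using d b d_odd_iff by blast
  obtain m where m: "d = 4 * m + 1" using d_mod4_odd[OF d] .
  have "even (2 * Y0 * Y1 + a * b * (Y2\<^sup>2 - Y3\<^sup>2) - 2 * a * c * Y2 * Y3)"
    unfolding V3[symmetric] by simp
  then have Y23: "even Y2 \<longleftrightarrow> even Y3" using odd_a b by simp
  have "even (Y0\<^sup>2 + d * Y1\<^sup>2 - a * d * (Y2\<^sup>2 + Y3\<^sup>2))" unfolding U3[symmetric] by simp
  then have Y01: "even Y0 \<longleftrightarrow> even Y1" using odd_a d Y23 by auto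
  have "even Y2"
  proof (rule ccontr)
    assume Y2: "odd Y2"
    then have Y3: "odd Y3" using Y23 by simp
    obtain k2 k3 where k: "Y2\<^sup>2 = 8 * k2 + 1" "Y3\<^sup>2 = 8 * k3 + 1"
      using odd_square[OF Y2] odd_square[OF Y3] by metis
    have "2 * V3 = 2 * (Y0 * Y1 + 4 * (a * b * (k2 - k3)) - a * c * Y2 * Y3)"
      using V3 unfolding k by (simp add: algebra_simps)
    then have "V3 = Y0 * Y1 + 4 * (a * b * (k2 - k3)) - a * c * Y2 * Y3" by simp
    then have "even V3 \<longleftrightarrow> even Y0" using c Y01 by simp
    moreover have "even U3 \<longleftrightarrow> odd Y0"
    proof (cases "even Y0")
      case True
      then obtain i j where ij: "Y0 = 2 * i" "Y1 = 2 * j" using Y01 by (auto elim!: evenE)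
      have "2 * U3 = 2 * (2 * i\<^sup>2 + 2 * d * j\<^sup>2 - a * d * (4 * k2 + 4 * k3 + 1))"
        using U3 unfolding ij k by (simp add: algebra_simps)
      then have "U3 = 2 * i\<^sup>2 + 2 * d * j\<^sup>2 - a * d * (4 * k2 + 4 * k3 + 1)" by simp
      then show ?thesis using True odd_a d by simp
    next
      case False
      then have odd: "odd Y0" "odd Y1" using Y01 by auto
      obtain k0 k1 where k': "Y0\<^sup>2 = 8 * k0 + 1" "Y1\<^sup>2 = 8 * k1 + 1"
        using odd_square[OF odd(1)] odd_square[OF odd(2)] by metis
      have "2 * U3 = 1 + d + 2 * (4 * k0 + 4 * d * k1 - a * d * (4 * k2 + 4 * k3 + 1))"
        using U3 unfolding k k' by (simp add: algebra_simps)
      also have "1 + d = 2 * (2 * m + 1)" unfolding m by simp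
      finally have "2 * U3 = 2 * (2 * m + 1 + (4 * k0 + 4 * d * k1 - a * d
          * (4 * k2 + 4 * k3 + 1)))"
        by (simp add: algebra_simps)
      then have "U3 = 2 * m + 1 + (4 * k0 + 4 * d * k1 - a * d * (4 * k2 + 4 * k3 + 1))" by simp
      then show ?thesis using False odd_a d by simp
    qed
    ultimately show False using UV3 by simp
  qed
  with Y01 Y23 show ?thesis by simp
qed

text \<open>
  The difference \<open>2 U3 - 2 V3\<close> is divisible by 4; completing squares in \<open>Y0 - Y1\<close> and
  \<open>Y2 - Y3\<close>, which are odd, reduces it to \<open>1 - a - b\<close> modulo 4.
\<close>

lemma half_coords_b_even:
  assumes d: "odd d" and b: "even b"
    and U3: "2 * U3 = Y0\<^sup>2 + d * Y1\<^sup>2 - a * d * (Y2\<^sup>2 + Y3\<^sup>2)"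
    and V3: "2 * V3 = 2 * Y0 * Y1 + a * b * (Y2\<^sup>2 - Y3\<^sup>2) - 2 * a * c * Y2 * Y3"
    and UV3: "even U3 \<longleftrightarrow> even V3"
  shows "even (Y0 + Y1 + Y2 + Y3) \<and> (odd (Y0 - Y1) \<longrightarrow> [a + b = 1] (mod 4))"
proof -
  have c: "odd c" using d b d_odd_iff by (auto simp: d_eq)
  obtain m where m: "d = 4 * m + 1" using d_mod4_odd[OF d] .
  obtain n where n: "b = 2 * n" using b by (auto elim: evenE)
  obtain kc where kc: "c = 2 * kc + 1" using c by (auto elim: oddE)
  have "even (Y0\<^sup>2 + d * Y1\<^sup>2 - a * d * (Y2\<^sup>2 + Y3\<^sup>2))" unfolding U3[symmetric] by simp
  then have par: "even (Y0 + Y1 + Y2 + Y3)" using odd_a d by auto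
  moreover have "[a + b = 1] (mod 4)" if Y01: "odd (Y0 - Y1)"
  proof -
    have Y23: "odd (Y2 - Y3)" "odd (Y2 + Y3)" using Y01 par by auto
    obtain k l where kl: "(Y0 - Y1)\<^sup>2 = 8 * k + 1" "(Y2 - Y3)\<^sup>2 = 8 * l + 1"
      using odd_square[OF Y01] odd_square[OF Y23(1)] by metis
    have "odd (a * (Y2 - Y3) * (Y2 + Y3))" using odd_a Y23 by simp
    then obtain t where t: "a * (Y2 - Y3) * (Y2 + Y3) = 2 * t + 1" by (rule oddE)
    have "even (U3 - V3)" using UV3 by simp
    then obtain e where e: "U3 - V3 = 2 * e" by (rule evenE)
    have "4 * e = 2 * U3 - 2 * V3" using e by simp
    also have "\<dots> = (Y0 - Y1)\<^sup>2 - a * (Y2 - Y3)\<^sup>2 - 2 * (n * (a * (Y2 - Y3) * (Y2 + Y3)))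
        + 4 * (m * Y1\<^sup>2 - a * m * (Y2\<^sup>2 + Y3\<^sup>2) + a * kc * Y2 * Y3)"
      unfolding U3 V3 m n kc by (simp add: power2_eq_square algebra_simps)
    also have "\<dots> = 1 - a - 2 * n
        + 4 * (2 * k - 2 * a * l - n * t + (m * Y1\<^sup>2 - a * m * (Y2\<^sup>2 + Y3\<^sup>2) + a * kc * Y2 * Y3))"
      unfolding kl t by (simp add: algebra_simps)
    finally have "4 dvd 1 - a - 2 * n" by presburger
    then have "4 dvd a + b - 1" unfolding n by presburger
    then show ?thesis by (simp add: cong_iff_dvd_diff)
  qed
  ultimately show ?thesis by blast
qed

lemma integral_coords_if_algebraic_int:
  assumes "algebraic_int (elt A)"
  obtains X0 X1 X2 X3 where "A = (of_int X0 / 4, of_int X1 / 4, of_int X2 / 4, of_int X3 / 4)"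
    "integral_coords a b c X0 X1 X2 X3"
proof -
  obtain X0 X1 X2 X3 U2 V2 V' U3 V3 where
    A: "A = (of_int X0 / 4, of_int X1 / 4, of_int X2 / 4, of_int X3 / 4)"
    and X01: "4 dvd X0\<^sup>2 - d * X1\<^sup>2"
    and U2: "2 * U2 = a * d * (X2\<^sup>2 + X3\<^sup>2)"
        and V2: "2 * V2 = a * (2 * c * X2 * X3 - b * (X2\<^sup>2 - X3\<^sup>2))"
    and UV2: "4 dvd U2\<^sup>2 - d * V2\<^sup>2"
    and V': "2 * V' = a * (c * (X2\<^sup>2 - X3\<^sup>2) + 2 * b * X2 * X3)" and dV': "4 dvd d * V'\<^sup>2"
    and U3: "8 * U3 = X0\<^sup>2 + d * X1\<^sup>2 - a * d * (X2\<^sup>2 + X3\<^sup>2)"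
    and V3: "8 * V3 = 2 * X0 * X1 + a * b * (X2\<^sup>2 - X3\<^sup>2) - 2 * a * c * X2 * X3"
    and UV3: "4 dvd U3\<^sup>2 - d * V3\<^sup>2"
    by (rule integral_coordinates[OF assms])
  have "integral_coords a b c X0 X1 X2 X3"
  proof (cases "odd d")
    case False
    then have d: "even d" by simp
    then show ?thesis
      using integral_coords_even[OF d X01 U2 V2 UV2 U3 V3 UV3] d_odd_iff
      by (simp add: integral_coords_def)
  next
    case d: True
    have "even (a * d * (X2\<^sup>2 + X3\<^sup>2))" unfolding U2[symmetric] by simp
    then have X23: "even X2 \<longleftrightarrow> even X3" using odd_a d by simp
    show ?thesis
    proof (cases "even X2")
      case False
      then have odd: "odd X2" "odd X3" using X23 by auto
      show ?thesis
        using both_odd_coords[OF d odd X01 V' dV' U3 V3] odd by (simp add: integral_coords_def)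
    next
      case True
      then have even: "even X2" "even X3" using X23 by auto
      obtain Y0 Y1 Y2 Y3 where Y: "X0 = 2 * Y0" "X1 = 2 * Y1" "X2 = 2 * Y2" "X3 = 2 * Y3"
        and U: "2 * U3 = Y0\<^sup>2 + d * Y1\<^sup>2 - a * d * (Y2\<^sup>2 + Y3\<^sup>2)"
        and V: "2 * V3 = 2 * Y0 * Y1 + a * b * (Y2\<^sup>2 - Y3\<^sup>2) - 2 * a * c * Y2 * Y3"
        and par: "even U3 \<longleftrightarrow> even V3"
        by (rule half_integral_coords[OF d X01 even U3 V3 UV3])
      have four: "4 dvd 2 * x \<longleftrightarrow> even x" for x :: int by presburger
      show ?thesis
      proof (cases "odd b")
        case True
        have "even (Y0 - Y1) \<and> even Y2 \<and> even Y3" by (rule half_coords_b_odd[OF d True U V par])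
        moreover have "X0 - X1 = 2 * (Y0 - Y1)" by (simp add: Y)
        ultimately have "4 dvd X0 - X1" "4 dvd X2" "4 dvd X3" by (simp_all only: four Y)
        then show ?thesis using True d_odd_iff d by (simp add: integral_coords_def Y)
      next
        case False
        then have b: "even b" by simp
        have Ypar: "even (Y0 + Y1 + Y2 + Y3)" "odd (Y0 - Y1) \<longrightarrow> [a + b = 1] (mod 4)"
          using half_coords_b_even[OF d b U V par] by auto
        show ?thesis
        proof (cases "[a + b = 1] (mod 4)")
          case True
          have "odd c" using d b d_odd_iff by (auto simp: d_eq)
          then have "odd (a * c)" using odd_a by simp
          have "X0 - X1 - X2 + a * c * X3 = 2 * (Y0 - Y1 - Y2 + a * c * Y3)"
            by (simp add: Y algebra_simps)
          moreover have "even (Y0 - Y1 - Y2 + a * c * Y3)"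
            using Ypar(1) \<open>odd (a * c)\<close> by simp
          ultimately have "4 dvd X0 - X1 - X2 + a * c * X3" by (simp only: four)
          then show ?thesis using True b by (simp add: integral_coords_def Y)
        next
          case False
          then have 1: "even (Y0 - Y1)" using Ypar(2) by blast
          then have 2: "even (Y2 - Y3)" using Ypar(1) by simp
          have "X0 - X1 = 2 * (Y0 - Y1)" "X2 - X3 = 2 * (Y2 - Y3)" by (simp_all add: Y)
          then have "4 dvd X0 - X1" "4 dvd X2 - X3" using 1 2 by (simp_all only: four)
          then show ?thesis using False b by (simp add: integral_coords_def Y)
        qed
      qed
    qed
  qed
  with A show ?thesis by (rule that)
qed

lemma algebraic_int_rt: "algebraic_int rt"
  by (rule algebraic_int_monic_quadratic[of 0 "of_int (- d)"])
    (simp_all only: algebraic_int_0 algebraic_int_of_int power2_eq_square rt_square, simp)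

lemma algebraic_int_quadratic_half:
  assumes "odd d" "even (U - V)"
  shows "algebraic_int (elt (of_int U / 2, of_int V / 2, 0, 0))"
proof -
  obtain m where m: "d = 4 * m + 1" using d_mod4_odd[OF assms(1)] .
  define h where "h = elt (1 / 2, 1 / 2, 0, 0)"
  have h2: "2 * h = 1 + rt" by (simp add: h_def of_rat_divide)
  have "4 * h\<^sup>2 = (2 * h) * (2 * h)" by (simp add: power2_eq_square)
  also have "\<dots> = 1 + 2 * rt + of_int d" unfolding h2 by (simp add: algebra_simps rt_square)
  also have "\<dots> = 2 * (2 * h) + 4 * of_int m" unfolding h2 m by simp
  finally have "4 * h\<^sup>2 = 4 * (1 * h - of_int (- m))" by simp
  then have h_eq: "h\<^sup>2 = 1 * h - of_int (- m)" by (simp only: mult_cancel_left) simp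
  have h: "algebraic_int h"
    by (rule algebraic_int_monic_quadratic[OF algebraic_int_1 algebraic_int_of_int h_eq])
  obtain k where "U - V = 2 * k" using assms(2) by (rule evenE)
  then have k: "U = V + 2 * k" by simp
  have "elt (of_int U / 2, of_int V / 2, 0, 0) = of_int k + of_int V * h"
    unfolding h_def k by (simp add: of_rat_divide of_rat_add of_rat_mult add_divide_distrib
      algebra_simps)
  then show ?thesis
    by (simp only: algebraic_int_add algebraic_int_mult algebraic_int_of_int h)
qed

text \<open>
  Together with the integers of \<open>\<rat>(rt)\<close>, this turns the integrality of explicit
  generators into a computation of their relative norm.
\<close>

lemma algebraic_int_if_relative_trace_norm:
  assumes "algebraic_int (elt (2 * w, 2 * x, 0, 0))"
    and "algebraic_int (elt (relnorm0 (w, x, y, z), relnorm1 (w, x, y, z), 0, 0))"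
  shows "algebraic_int (elt (w, x, y, z))"
proof (rule algebraic_int_monic_quadratic[OF assms])
  let ?A = "(w, x, y, z)"
  have t: "?A + conjq (conjq ?A) = (2 * w, 2 * x, 0, 0)" by simp
  show "(elt ?A)\<^sup>2 = elt (2 * w, 2 * x, 0, 0) * elt ?A - elt (relnorm0 ?A, relnorm1 ?A, 0, 0)"
    unfolding t[symmetric] mulq_conj2[symmetric] elt_add elt_mulq
    by (simp add: power2_eq_square algebra_simps del: elt.simps conjq.simps)
qed

lemma algebraic_int_\<beta>_\<gamma>: "algebraic_int (elt (0, 0, of_int y, of_int z))"
proof (rule algebraic_int_if_relative_trace_norm)
  have int: "algebraic_int (elt (of_int u, of_int v, 0, 0))" for u v
    by (simp add: algebraic_int_add algebraic_int_mult algebraic_int_rt)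
  show "algebraic_int (elt (2 * 0, 2 * 0, 0, 0))" by simp
  show "algebraic_int (elt (relnorm0 (0, 0, of_int y, of_int z), relnorm1 (0, 0, of_int y, of_int z), 0, 0))"
    using int[of "- (a * d * (y\<^sup>2 + z\<^sup>2))" "a * b * (y\<^sup>2 - z\<^sup>2) - 2 * a * c * y * z"]
    by (simp add: mult.assoc del: elt.simps)
qed

lemma algebraic_int_half_\<beta>_\<gamma>:
  assumes "even b" "odd d" "e = 1 \<or> e = - 1"
  shows "algebraic_int (elt (0, 0, 1 / 2, of_int e / 2))"
proof (rule algebraic_int_if_relative_trace_norm)
  have "odd c" using assms d_odd_iff by (auto simp: d_eq)
  then have "even (- (a * d) - - (a * c * e))" using assms odd_a by auto
  from algebraic_int_quadratic_half[OF assms(2) this]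
  show "algebraic_int (elt (relnorm0 (0, 0, 1 / 2, of_int e / 2), relnorm1 (0, 0, 1 / 2, of_int e / 2), 0, 0))"
    using assms(3) by (auto simp: power2_eq_square simp del: elt.simps)
  show "algebraic_int (elt (2 * 0, 2 * 0, 0, 0))" by simp
qed

text \<open>
  The extra generators in the third branch of \<open>integral_coords\<close>, where \<open>e\<close> is the sign
  congruent to \<open>a c\<close> modulo 4.  The relative norm has coordinates
  \<open>(1 + d - 2 a d) / 16\<close> and \<open>f (1 - a c e) / 8\<close>; the assumption on \<open>a + b\<close> makes
  these halves of integers of equal parity.
\<close>

lemma algebraic_int_quarter:
  assumes b: "even b" and d: "odd d" and ab: "[a + b = 1] (mod 4)"
    and e: "e = 1 \<or> e = - 1" and ac: "4 dvd a * c - e" and f: "f = 1 \<or> f = - 1"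
  shows "algebraic_int (elt (1 / 4, of_int f / 4, 1 / 4, of_int (e * f) / 4))"
proof (rule algebraic_int_if_relative_trace_norm)
  \<comment> \<open>the sign is absorbed into \<open>c\<close>, which occurs in \<open>d\<close> only through its square;
    then \<open>a\<close> and \<open>C\<close> agree modulo 4\<close>
  define C where "C = e * c"
  have C2: "c * c = C * C" "e * C = c" using e by (auto simp: C_def)
  have c: "odd c" using b d d_odd_iff by (auto simp: d_eq)
  obtain n where n: "b = 2 * n" using b by (rule evenE)
  obtain t where t: "a * c - e = 4 * t" using ac by (rule dvdE)
  obtain kc where kc: "c\<^sup>2 = 8 * kc + 1" using odd_square[OF c] .
  have "a * c\<^sup>2 = (a * c - e) * c + C" by (simp add: C_def power2_eq_square algebra_simps)
  then have "a - C = 4 * (t * c - 2 * a * kc)" unfolding t kc by (simp add: algebra_simps)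
  then have "a = C + 4 * (t * c - 2 * a * kc)" by simp
  then obtain k where k: "a = C + 4 * k" by (rule that)
  have "4 dvd a + b - 1" using ab by (simp add: cong_iff_dvd_diff)
  then obtain m' where "a + b - 1 = 4 * m'" by (rule dvdE)
  define m where "m = m' - k"
  have C: "C = 1 - 2 * n + 4 * m"
    using \<open>a + b - 1 = 4 * m'\<close> unfolding k n m_def by simp
  have d': "d = 4 * n\<^sup>2 + C * C" unfolding d_eq n power2_eq_square[of c] C2 by simp
  \<comment> \<open>now everything is a polynomial in \<open>m\<close>, \<open>r\<close> and \<open>k\<close>; expanding it,
    \<open>V\<close> is the quotient of \<open>1 - a c e\<close> by 4 and \<open>W\<close> that of
    \<open>1 + d - 2 a d - 8 V\<close> by 16\<close>
  define r where "r = 2 * m - n"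
  have Cr: "C = 1 + 2 * r" and nr: "n = 2 * m - r" using C by (simp_all add: r_def)
  define V where "V = - (r * (r + 1) + k * C)"
  define W where "W = (m\<^sup>2 - m * r) * (1 - 2 * C) - r\<^sup>2 * C - r * k * C - 2 * k * n\<^sup>2"
  have V: "1 - a * c * e = 4 * V"
  proof -
    have "1 - a * c * e = 1 - a * C" by (simp add: C_def)
    also have "\<dots> = 4 * V" unfolding V_def k Cr by (simp add: algebra_simps)
    finally show ?thesis .
  qed
  have U: "1 + d - 2 * a * d = 8 * (V + 2 * W)"
    unfolding d' V_def W_def k nr Cr by (simp add: power2_eq_square algebra_simps)
  have relnorm0: "relnorm0 (1 / 4, of_int f / 4, 1 / 4, of_int (e * f) / 4)
      = of_int (V + 2 * W) / 2"
  proof -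
    have "relnorm0 (1 / 4, of_int f / 4, 1 / 4, of_int (e * f) / 4)
        = of_int (1 + d - 2 * a * d) / 16"
      using e f by (auto simp: power2_eq_square field_simps)
    then show ?thesis unfolding U by simp
  qed
  have relnorm1: "relnorm1 (1 / 4, of_int f / 4, 1 / 4, of_int (e * f) / 4) = of_int (f * V) / 2"
  proof -
    have "relnorm1 (1 / 4, of_int f / 4, 1 / 4, of_int (e * f) / 4)
        = of_int (f * (1 - a * c * e)) / 8"
      using e f by (auto simp: power2_eq_square field_simps)
    then show ?thesis unfolding V by simp
  qed
  show "algebraic_int (elt (2 * (1 / 4), 2 * (of_int f / 4), 0, 0))"
    using algebraic_int_quadratic_half[OF d, of 1 f] f by auto
  show "algebraic_int (elt (relnorm0 (1 / 4, of_int f / 4, 1 / 4, of_int (e * f) / 4),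
      relnorm1 (1 / 4, of_int f / 4, 1 / 4, of_int (e * f) / 4), 0, 0))"
    unfolding relnorm0 relnorm1 using f by (intro algebraic_int_quadratic_half[OF d]) auto
qed

text \<open>
  In each branch the element is an integral combination of integers of \<open>\<rat>(rt)\<close>, of
  \<open>\<beta>, \<gamma>\<close>, of \<open>(\<beta> \<plusminus> \<gamma>) / 2\<close> and of the generators in
  \<open>algebraic_int_quarter\<close>.
\<close>

lemma algebraic_int_if_integral_coords:
  assumes "integral_coords a b c X0 X1 X2 X3"
  shows "algebraic_int (elt (of_int X0 / 4, of_int X1 / 4, of_int X2 / 4, of_int X3 / 4))"
    (is "algebraic_int (elt ?A)")
proof -
  have add: "algebraic_int (elt C)" if "algebraic_int (elt A)" "algebraic_int (elt B)" "C = A + B"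
      for A B C
    using algebraic_int_add[OF that(1,2)] that(3) by (simp only: elt_add)
  have scale: "algebraic_int (elt (k * w, k * x, k * y, k * z))"
    if "algebraic_int (elt (w, x, y, z))" "k = of_int n" for k w x y z n
  proof -
    have "elt (k * w, k * x, k * y, k * z) = of_int n * elt (w, x, y, z)"
      by (simp add: that(2) of_rat_mult algebra_simps)
    then show ?thesis using algebraic_int_mult[OF algebraic_int_of_int that(1)] by metis
  qed
  consider (dyadic) "odd b" "odd c" "4 dvd X0" "4 dvd X1" "4 dvd X2" "4 dvd X3"
    | (b_odd) "odd b" "even c" "even X0" "4 dvd X0 - X1" "4 dvd X2" "4 dvd X3"
    | (quarter) "even b" "[a + b = 1] (mod 4)" "even (X0 - X1)" "even (X0 - X2)" "even (X0 - X3)"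
        "4 dvd X0 - X1 - X2 + a * c * X3"
    | (half) "even b" "even X0" "4 dvd X0 - X1" "even X2" "4 dvd X2 - X3"
    using assms unfolding integral_coords_def by (auto split: if_splits)
  then show ?thesis
  proof cases
    case dyadic
    then obtain k0 k1 k2 k3 where k: "X0 = 4 * k0" "X1 = 4 * k1" "X2 = 4 * k2" "X3 = 4 * k3"
      by (auto elim!: dvdE)
    have "algebraic_int (elt (of_int k0, of_int k1, 0, 0))"
      by (simp add: algebraic_int_add algebraic_int_mult algebraic_int_rt)
    from add[OF this algebraic_int_\<beta>_\<gamma>[of k2 k3]] show ?thesis unfolding k by (simp del: elt.simps)
  next
    case b_odd
    then have d: "odd d" using d_odd_iff by auto
    obtain k0 k1 k2 k3 where k: "X0 = 2 * k0" "X0 - X1 = 4 * k1" "X2 = 4 * k2" "X3 = 4 * k3"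
      using b_odd by (auto elim!: dvdE)
    then have X1: "X1 = 2 * (k0 - 2 * k1)" by simp
    have "algebraic_int (elt (of_int k0 / 2, of_int (k0 - 2 * k1) / 2, 0, 0))"
      by (rule algebraic_int_quadratic_half[OF d]) simp
    then show ?thesis
      by (rule add[OF _ algebraic_int_\<beta>_\<gamma>[of k2 k3]])
        (simp add: X1 k(1,3,4) add_divide_distrib diff_divide_distrib)
  next
    case quarter
    then have c: "odd c" and d: "odd d" using d_odd_iff by (auto simp: d_eq)
    have "odd (a * c)" using odd_a c by simp
    moreover have "odd n \<Longrightarrow> 4 dvd n - 1 \<or> 4 dvd n - (- 1)" for n :: int by presburger
    ultimately have "4 dvd a * c - 1 \<or> 4 dvd a * c - (- 1)" by blast
    then obtain e where e: "e = 1 \<or> e = - 1" "4 dvd a * c - e" by blast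
    have "even (X2 + e * X3)" "even (X2 - e * X3)" using quarter e(1) by auto
    then obtain m3 m4 where m: "X2 + e * X3 = 2 * m3" "X2 - e * X3 = 2 * m4" by (meson evenE)
    have X23: "X2 = m3 + m4" "e * X3 = m3 - m4" using m by simp_all
    have X3: "X3 = e * m3 - e * m4" using e(1) X23(2) by auto
    have "even (X0 - X2)" "even (X1 - e * X3)" using quarter e(1) by auto
    then obtain U V where UV: "X0 - X2 = 2 * U" "X1 - e * X3 = 2 * V" by (meson evenE)
    have "4 dvd (X0 - X1 - X2 + a * c * X3) - (a * c - e) * X3"
      using quarter e(2) by (intro dvd_diff) auto
    also have "\<dots> = 2 * (U - V)" using UV by (simp add: algebra_simps)
    finally have "even (U - V)" by presburger
    from algebraic_int_quadratic_half[OF d this]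
    have 1: "algebraic_int (elt (of_int U / 2, of_int V / 2, 0, 0))" .
    have g: "algebraic_int (elt (1 / 4, of_int f / 4, 1 / 4, of_int (e * f) / 4))"
      if "f = 1 \<or> f = - 1" for f
      by (rule algebraic_int_quarter[OF quarter(1) d quarter(2) e that])
    have X01: "X0 = 2 * U + m3 + m4" "X1 = 2 * V + m3 - m4" using UV X23 by simp_all
    show ?thesis
      by (rule add[OF 1 add[OF scale[OF g[of 1], of "of_int m3" m3]
        scale[OF g[of "- 1"], of "of_int m4" m4] refl]])
        (simp_all add: X01 X23(1) X3 add_divide_distrib diff_divide_distrib
          right_diff_distrib mult.commute)
  next
    case half
    then have d: "odd d" using d_odd_iff by auto
    obtain k0 k1 k2 k3 where k: "X0 = 2 * k0" "X0 - X1 = 4 * k1" "X2 = 2 * k2" "X2 - X3 = 4 * k3"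
      using half by (auto elim!: dvdE)
    then have X: "X1 = 2 * (k0 - 2 * k1)" "X3 = 2 * (k2 - 2 * k3)" by simp_all
    have 1: "algebraic_int (elt (of_int k0 / 2, of_int (k0 - 2 * k1) / 2, 0, 0))"
      by (rule algebraic_int_quadratic_half[OF d]) simp
    have 2: "algebraic_int (elt (0, 0, 1 / 2, of_int e / 2))" if "e = 1 \<or> e = - 1" for e
      by (rule algebraic_int_half_\<beta>_\<gamma>[OF half(1) d that])
    show ?thesis
      by (rule add[OF 1 add[OF scale[OF 2[of 1], of "of_int (k2 - k3)" "k2 - k3"]
            scale[OF 2[of "- 1"], of "of_int k3" k3] refl]])
        (simp_all add: k(1,3) X add_divide_distrib diff_divide_distrib)
  qed
qed

lemma algebraic_int_iff_integral_coords:
  "algebraic_int (elt (of_int X0 / 4, of_int X1 / 4, of_int X2 / 4, of_int X3 / 4))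
    \<longleftrightarrow> integral_coords a b c X0 X1 X2 X3"
proof
  assume "algebraic_int (elt (of_int X0 / 4, of_int X1 / 4, of_int X2 / 4, of_int X3 / 4))"
  then show "integral_coords a b c X0 X1 X2 X3"
    by (rule integral_coords_if_algebraic_int) simp
qed (rule algebraic_int_if_integral_coords)

end

section \<open>Index, torsion and comaximal products of ideals\<close>

lemma card_image_same_kernel:
  assumes "\<And>x y. x \<in> A \<Longrightarrow> y \<in> A \<Longrightarrow> f x = f y \<longleftrightarrow> g x = g y"
  shows "card (f ` A) = card (g ` A)"
proof -
  have "inj_on (\<lambda>c. g (inv_into A f c)) (f ` A)"
  proof (rule inj_onI)
    fix c c' assume c: "c \<in> f ` A" "c' \<in> f ` A" and eq: "g (inv_into A f c) = g (inv_into A f c')"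
    then have "f (inv_into A f c) = f (inv_into A f c')"
      using assms[of "inv_into A f c" "inv_into A f c'"] by (simp add: inv_into_into)
    then show "c = c'" using c by (simp add: f_inv_into_f)
  qed
  moreover have "(\<lambda>c. g (inv_into A f c)) ` (f ` A) = g ` A"
  proof -
    have "g (inv_into A f (f x)) = g x" if "x \<in> A" for x
      using assms[of "inv_into A f (f x)" x] that by (simp add: inv_into_into f_inv_into_f)
    then show ?thesis by (auto simp: image_image)
  qed
  ultimately show ?thesis by (metis card_image)
qed

context ring
begin

lemma carrier_Quot: "carrier (R Quot I) = (+>) I ` carrier R"
  by (auto simp: FactRing_def A_RCOSETS_def')

lemma card_Quot:
  assumes "ideal I R" "\<And>x y. x \<in> carrier R \<Longrightarrow> y \<in> carrier R \<Longrightarrow> f x = f y \<longleftrightarrow> x \<ominus> y \<in> I"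
  shows "card (carrier (R Quot I)) = card (f ` carrier R)"
  unfolding carrier_Quot
  by (rule card_image_same_kernel) (simp add: assms quotient_eq_iff_same_a_r_cos[OF assms(1)])

text \<open>
  The canonical surjection \<open>R/I \<rightarrow> R/J\<close> between finite sets of the same size is injective.
\<close>

lemma ideal_eq_if_same_index:
  assumes I: "ideal I R" and J: "ideal J R" and sub: "I \<subseteq> J"
    and card: "card (carrier (R Quot I)) = card (carrier (R Quot J))"
        "card (carrier (R Quot J)) \<noteq> 0"
  shows "I = J"
proof (rule antisym[OF sub], rule subsetI)
  fix x assume x: "x \<in> J"
  let ?f = "(+>) I" and ?g = "(+>) J"
  define h where "h C = ?g (inv_into (carrier R) ?f C)" for C
  have h: "h (?f y) = ?g y" if y: "y \<in> carrier R" for y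
  proof -
    let ?z = "inv_into (carrier R) ?f (?f y)"
    have z: "?z \<in> carrier R" "?f ?z = ?f y"
      using y by (simp_all only: inv_into_into f_inv_into_f imageI)
    then have "?z \<ominus> y \<in> J" using quotient_eq_iff_same_a_r_cos[OF I z(1) y] sub by blast
    then show ?thesis using quotient_eq_iff_same_a_r_cos[OF J z(1) y] by (simp add: h_def)
  qed
  have "h ` carrier (R Quot I) = carrier (R Quot J)"
    unfolding carrier_Quot using h by (simp add: image_image)
  moreover have "finite (carrier (R Quot I))" using card by (metis card.infinite)
  ultimately have inj: "inj_on h (carrier (R Quot I))"
    using card by (metis eq_card_imp_inj_on)
  have xR: "x \<in> carrier R" using x J by (meson ideal.Icarr)
  have "?g x = ?g \<zero>"
    using quotient_eq_iff_same_a_r_cos[OF J xR zero_closed] x xR by (simp add: minus_eq)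
  then have "h (?f x) = h (?f \<zero>)" using h xR by simp
  then have "?f x = ?f \<zero>" using inj xR by (auto simp: inj_on_def carrier_Quot)
  then show "x \<in> I" using quotient_eq_iff_same_a_r_cos[OF I xR zero_closed] xR
      by (simp add: minus_eq)
qed

text \<open>
  Cauchy's theorem for the additive group of the quotient, as the case of exponent one of Sylow's
  theorem.
\<close>

lemma quotient_has_torsion:
  assumes I: "ideal I R" and r: "prime r" "r dvd card (carrier (R Quot I))"
    and card: "card (carrier (R Quot I)) \<noteq> 0"
  obtains x where "x \<in> carrier R" "x \<notin> I" "[r] \<cdot> x \<in> I"
proof -
  interpret Q: ring "R Quot I" by (rule ideal.quotient_is_ring[OF I])
  let ?G = "add_monoid (R Quot I)"
  obtain m where m: "card (carrier (R Quot I)) = r * m" using r(2) by (rule dvdE)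
  have "\<exists>H. subgroup H ?G \<and> card H = r ^ 1"
  proof (rule sylow_thm[of r ?G 1 m])
    show "finite (carrier ?G)" using card by (metis card.infinite partial_object.select_convs(1))
  qed (use r(1) m Q.a_group in \<open>simp_all add: Coset.order_def\<close>)
  then obtain H where H: "subgroup H ?G" "card H = r" unfolding power_one_right by blast
  have "\<not> H \<subseteq> {\<zero>\<^bsub>R Quot I\<^esub>}"
  proof
    assume "H \<subseteq> {\<zero>\<^bsub>R Quot I\<^esub>}"
    then have "card H \<le> card {\<zero>\<^bsub>R Quot I\<^esub>}" by (intro card_mono) auto
    then show False using prime_gt_1_nat[OF r(1)] H(2) by simp
  qed
  then obtain h where h: "h \<in> H" "h \<noteq> \<zero>\<^bsub>R Quot I\<^esub>" by blast
  have "group (?G\<lparr>carrier := H\<rparr>)" by (rule subgroup.subgroup_is_group[OF H(1) Q.a_group])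
  from group.pow_order_eq_1[OF this, of h] have "h [^]\<^bsub>?G\<lparr>carrier := H\<rparr>\<^esub> r = \<zero>\<^bsub>R Quot I\<^esub>"
    using h(1) H(2) by (simp add: Coset.order_def)
  moreover have "h [^]\<^bsub>?G\<lparr>carrier := H\<rparr>\<^esub> r = h [^]\<^bsub>?G\<^esub> r"
    by (simp add: nat_pow_def)
  ultimately have pow: "h [^]\<^bsub>?G\<^esub> r = \<zero>\<^bsub>R Quot I\<^esub>" by simp
  have "h \<in> carrier (R Quot I)" using subgroup.subset[OF H(1)] h(1) by auto
  then obtain x where x: "x \<in> carrier R" "h = I +> x" by (auto simp: carrier_Quot)
  have hom: "(+>) I \<in> hom (add_monoid R) ?G"
    using ideal.rcos_ring_hom[OF I] by (simp add: Ring.ring_hom_def hom_def)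
  have "I +> ([r] \<cdot> x) = h [^]\<^bsub>?G\<^esub> r"
    unfolding add_pow_def x(2) using hom_nat_pow[OF hom _ a_group Q.a_group] x(1) by simp
  then have rx: "I +> ([r] \<cdot> x) = I" using pow by (simp add: FactRing_def)
  have zero: "\<zero>\<^bsub>R Quot I\<^esub> = I" by (simp add: FactRing_def)
  have sub: "subgroup I (add_monoid R)"
    using I by (simp add: additive_subgroup.a_subgroup ideal.axioms(1))
  show ?thesis
  proof (rule that[OF x(1)])
    show "x \<notin> I" using h(2) x a_coset_join2[OF x(1) sub] unfolding zero by blast
    show "[r] \<cdot> x \<in> I" using a_coset_join1[OF rx _ sub] x(1) by simp
  qed
qed

end

text \<open>
  If \<open>i + j = 1\<close>, then \<open>x = i x + x j\<close> shows that the intersection is contained in the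
  product.
\<close>

lemma ideal_prod_comaximal:
  fixes R (structure)
  assumes R: "cring R" and I: "ideal I R" and J: "ideal J R"
    and ij: "i \<in> I" "j \<in> J" "i \<oplus> j = \<one>"
  shows "I \<cdot> J = I \<inter> J"
proof
  interpret cring R by (rule R)
  show "I \<cdot> J \<subseteq> I \<inter> J" by (rule ideal_prod_inter[OF I J])
  show "I \<inter> J \<subseteq> I \<cdot> J"
  proof
    fix x assume x: "x \<in> I \<inter> J"
    have carr: "x \<in> carrier R" "i \<in> carrier R" "j \<in> carrier R"
      using x ij I J by (auto intro: ideal.Icarr)
    have "i \<otimes> x \<oplus> x \<otimes> j \<in> I \<cdot> J"
      using x ij by (intro ideal_prod.sum ideal_prod.prod) auto
    also have "i \<otimes> x \<oplus> x \<otimes> j = (i \<oplus> j) \<otimes> x"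
      using carr by (simp only: l_distr m_comm[of x j])
    also have "\<dots> = x" using carr by (simp add: ij(3))
    finally show "x \<in> I \<cdot> J" .
  qed
qed

text \<open>
  If \<open>p = gcd p n * g\<close>, a prime dividing \<open>g\<close> would also divide \<open>gcd p n\<close>, so its
  square would divide \<open>p\<close>.
\<close>

lemma squarefree_dvd_if_primes_dvd:
  fixes p n :: int
  assumes p: "squarefree p" and primes: "\<And>r. prime r \<Longrightarrow> r dvd p \<Longrightarrow> r dvd n"
  shows "p dvd n"
proof -
  define h where "h = gcd p n"
  have "h dvd p" by (simp add: h_def)
  then obtain g where g: "p = h * g" by (rule dvdE)
  have "p \<noteq> 0" using p not_squarefree_0 by blast
  then have "g \<noteq> 0" using g by auto
  have "is_unit g"
  proof (rule ccontr)
    assume "\<not> is_unit g"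
    then obtain r where r: "r dvd g" "prime r" using prime_divisor_exists[OF \<open>g \<noteq> 0\<close>] by blast
    then have "r dvd p" unfolding g by (simp only: dvd_mult)
    moreover from this have "r dvd n" by (rule primes[OF r(2)])
    ultimately have "r dvd h" unfolding h_def by (rule gcd_greatest)
    then have "r\<^sup>2 dvd p" unfolding g power2_eq_square using r(1) by (rule mult_dvd_mono)
    then have "is_unit r" using p unfolding squarefree_def by blast
    then show False using r(2) not_prime_unit by blast
  qed
  then have "p dvd h" unfolding g by (simp only: mult_unit_dvd_iff dvd_refl)
  then show ?thesis unfolding h_def by simp
qed

context cyclic_quartic_data
begin

section \<open>The ideals dividing the ramified and inert primes\<close>

abbreviation OF :: "complex ring" where "OF \<equiv> ring_of_integers F"

lemma OF_simps [simp]: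
  "x \<otimes>\<^bsub>OF\<^esub> y = x * y" "x \<oplus>\<^bsub>OF\<^esub> y = x + y" "\<one>\<^bsub>OF\<^esub> = 1" "\<zero>\<^bsub>OF\<^esub> = 0"
  by (simp_all add: ring_of_integers_def)

lemma OF_carrier: "carrier OF = {x \<in> F. algebraic_int x}"
  by (simp add: ring_of_integers_def)

lemma OF_closed:
  "x \<in> carrier OF \<Longrightarrow> y \<in> carrier OF \<Longrightarrow> x + y \<in> carrier OF"
  "x \<in> carrier OF \<Longrightarrow> y \<in> carrier OF \<Longrightarrow> x * y \<in> carrier OF"
  "x \<in> carrier OF \<Longrightarrow> - x \<in> carrier OF"
  "x \<in> carrier OF \<Longrightarrow> y \<in> carrier OF \<Longrightarrow> x - y \<in> carrier OF"
  "of_int n \<in> carrier OF"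
proof -
  show "of_int n \<in> carrier OF" using F_of_rat[of "of_int n"] by (simp add: OF_carrier)
  show add: "x + y \<in> carrier OF" if "x \<in> carrier OF" "y \<in> carrier OF" for x y
    using that by (simp add: OF_carrier F_closed algebraic_int_add)
  show "x * y \<in> carrier OF" if "x \<in> carrier OF" "y \<in> carrier OF"
    using that by (simp add: OF_carrier F_closed algebraic_int_mult)
  show minus: "- x \<in> carrier OF" if "x \<in> carrier OF" for x
    using that by (simp add: OF_carrier F_closed)
  show "x - y \<in> carrier OF" if "x \<in> carrier OF" "y \<in> carrier OF"
    using add[OF that(1) minus[OF that(2)]] by simp
qed

lemma cring_OF: "cring OF"
proof (rule cringI)
  show "abelian_group OF"
  proof (rule abelian_groupI)
    show "\<exists>y\<in>carrier OF. y \<oplus>\<^bsub>OF\<^esub> x = \<zero>\<^bsub>OF\<^esub>" if "x \<in> carrier OF" for x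
      using that by (intro bexI[of _ "- x"]) (simp_all add: OF_closed)
  qed (use OF_closed(5)[of 0] in \<open>simp_all add: OF_closed add_ac\<close>)
  show "Group.comm_monoid OF"
    by (rule comm_monoidI) (use OF_closed(5)[of 1] in \<open>simp_all add: OF_closed mult_ac\<close>)
qed (simp add: algebra_simps)

sublocale O: cring OF by (rule cring_OF)

lemma OF_a_inv: "x \<in> carrier OF \<Longrightarrow> \<ominus>\<^bsub>OF\<^esub> x = - x"
  by (rule O.minus_equality) (simp_all add: OF_closed)

lemma OF_minus: "x \<in> carrier OF \<Longrightarrow> y \<in> carrier OF \<Longrightarrow> x \<ominus>\<^bsub>OF\<^esub> y = x - y"
  by (simp add: a_minus_def OF_a_inv)

lemma OF_add_pow: "x \<in> carrier OF \<Longrightarrow> [(n::nat)] \<cdot>\<^bsub>OF\<^esub> x = of_nat n * x"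
  by (induction n) (simp_all add: algebra_simps)

text \<open>
  A common denominator of the coordinates of integers.  It is 1 rather than 4 for even \<open>d\<close>, so
  that it is coprime to all divisors of \<open>d\<close> and of \<open>a\<close>.
\<close>

definition den :: int where "den = (if odd d then 4 else 1)"

definition ielt :: "int \<Rightarrow> int \<Rightarrow> int \<Rightarrow> int \<Rightarrow> complex" where
  "ielt X0 X1 X2 X3 = elt (of_int X0 / of_int den, of_int X1 / of_int den,
     of_int X2 / of_int den, of_int X3 / of_int den)"

text \<open>
  On integers of \<open>F\<close> the numbers under the floor are integers already.
\<close>

definition c0 :: "complex \<Rightarrow> int" where "c0 x = \<lfloor>of_int den * fst (the_inv elt x)\<rfloor>"
definition c1 :: "complex \<Rightarrow> int" where "c1 x = \<lfloor>of_int den * fst (snd (the_inv elt x))\<rfloor>"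

lemma den_nonzero: "den \<noteq> 0" by (simp add: den_def)

lemma the_inv_elt: "the_inv elt (elt A) = A"
  using elt_inject by (simp add: inj_def the_inv_f_f)

lemma c0_ielt: "c0 (ielt X0 X1 X2 X3) = X0" and c1_ielt: "c1 (ielt X0 X1 X2 X3) = X1"
  using den_nonzero by (simp_all add: c0_def c1_def ielt_def the_inv_elt del: elt.simps)

lemma OF_ielt:
  assumes "x \<in> carrier OF"
  obtains X0 X1 X2 X3 where "x = ielt X0 X1 X2 X3"
proof -
  have "x \<in> F" using assms by (simp add: OF_carrier)
  then obtain A where A: "x = elt A" by (rule F_cases)
  then have "algebraic_int (elt A)" using assms by (simp add: OF_carrier)
  then obtain X0 X1 X2 X3 where X: "A = (of_int X0 / 4, of_int X1 / 4, of_int X2 / 4, of_int X3 / 4)"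
      "integral_coords a b c X0 X1 X2 X3"
    by (rule integral_coords_if_algebraic_int)
  show ?thesis
  proof (cases "odd d")
    case True
    then have "x = ielt X0 X1 X2 X3" by (simp add: A X ielt_def den_def)
    then show ?thesis by (rule that)
  next
    case False
    then have "4 dvd X0" "4 dvd X1" "4 dvd X2" "4 dvd X3"
      using X(2) d_odd_iff by (auto simp: integral_coords_def)
    then obtain Y0 Y1 Y2 Y3 where Y: "X0 = 4 * Y0" "X1 = 4 * Y1" "X2 = 4 * Y2" "X3 = 4 * Y3"
      by (auto elim!: dvdE)
    have "x = ielt Y0 Y1 Y2 Y3" using False unfolding A X(1) Y ielt_def den_def by simp
    then show ?thesis by (rule that)
  qed
qed

lemma ielt_diff: "ielt X0 X1 X2 X3 - ielt Y0 Y1 Y2 Y3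
  = ielt (X0 - Y0) (X1 - Y1) (X2 - Y2) (X3 - Y3)"
  by (simp add: ielt_def diff_divide_distrib del: elt.simps flip: elt_diff)

lemma c_diff:
  assumes "x \<in> carrier OF" "y \<in> carrier OF"
  shows "c0 (x - y) = c0 x - c0 y" "c1 (x - y) = c1 x - c1 y"
proof -
  obtain X0 X1 X2 X3 where X: "x = ielt X0 X1 X2 X3" using OF_ielt[OF assms(1)] .
  obtain Y0 Y1 Y2 Y3 where Y: "y = ielt Y0 Y1 Y2 Y3" using OF_ielt[OF assms(2)] .
  show "c0 (x - y) = c0 x - c0 y" "c1 (x - y) = c1 x - c1 y"
    by (simp_all add: X Y ielt_diff c0_ielt c1_ielt)
qed

lemma elt_of_int: "elt (of_int X0, of_int X1, of_int X2, of_int X3)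
  = ielt (den * X0) (den * X1) (den * X2) (den * X3)"
  using den_nonzero by (simp add: ielt_def)

lemma elt_of_int_carrier: "elt (of_int X0, of_int X1, of_int X2, of_int X3) \<in> carrier OF"
proof -
  have "algebraic_int (elt (of_int X0, of_int X1, 0, 0))"
    by (simp add: algebraic_int_add algebraic_int_mult algebraic_int_rt)
  from algebraic_int_add[OF this algebraic_int_\<beta>_\<gamma>[of X2 X3]]
  have "algebraic_int (elt (of_int X0, of_int X1, of_int X2, of_int X3))"
    by (simp only: flip: elt_add) simp
  then show ?thesis by (simp add: OF_carrier elt_in_F del: elt.simps)
qed

text \<open>
  Only the first two coordinates of a product matter for membership in \<open>idl p q\<close>.
\<close>

lemma ielt_mult:
  assumes "ielt X0 X1 X2 X3 * ielt Y0 Y1 Y2 Y3 = ielt Z0 Z1 Z2 Z3"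
  shows "den * Z0 = X0 * Y0 + d * X1 * Y1 + a * d * (X2 * Y2 + X3 * Y3)"
    "den * Z1 = X0 * Y1 + X1 * Y0 - a * (b * (X2 * Y2 - X3 * Y3) - c * (X2 * Y3 + X3 * Y2))"
proof -
  let ?D = "of_int den :: rat"
  have D: "?D \<noteq> 0" using den_nonzero by simp
  let ?X = "(of_int X0 / ?D, of_int X1 / ?D, of_int X2 / ?D, of_int X3 / ?D)"
  let ?Y = "(of_int Y0 / ?D, of_int Y1 / ?D, of_int Y2 / ?D, of_int Y3 / ?D)"
  let ?Z = "(of_int Z0 / ?D, of_int Z1 / ?D, of_int Z2 / ?D, of_int Z3 / ?D)"
  have Z: "mulq ?X ?Y = ?Z" using assms unfolding ielt_def by (simp only: elt_inject flip: elt_mulq)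
  have "?D * of_int Z0 = ?D * ?D * fst ?Z" using D by simp
  also have "\<dots> = of_int (X0 * Y0 + d * X1 * Y1 + a * d * (X2 * Y2 + X3 * Y3))"
    unfolding Z[symmetric] using D by (simp add: field_simps)
  finally show "den * Z0 = X0 * Y0 + d * X1 * Y1 + a * d * (X2 * Y2 + X3 * Y3)"
    by (simp only: flip: of_int_mult of_int_eq_iff)
  have "?D * of_int Z1 = ?D * ?D * fst (snd ?Z)" using D by simp
  also have "\<dots> = of_int (X0 * Y1 + X1 * Y0 - a
      * (b * (X2 * Y2 - X3 * Y3) - c * (X2 * Y3 + X3 * Y2)))"
    unfolding Z[symmetric] using D by (simp add: field_simps)
  finally show "den * Z1 = X0 * Y1 + X1 * Y0 - a
      * (b * (X2 * Y2 - X3 * Y3) - c * (X2 * Y3 + X3 * Y2))"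
    by (simp only: flip: of_int_mult of_int_eq_iff)
qed

text \<open>
  The ideal \<open>P\<^sub>I Q\<^sub>J\<close> of the theorem for \<open>p = p\<^sub>I\<close> and \<open>q = q\<^sub>J\<close>; the
  two factors are \<open>idl p 1\<close> and \<open>idl 1 q\<close>.
\<close>

definition idl :: "int \<Rightarrow> int \<Rightarrow> complex set" where
  "idl p q = {x \<in> carrier OF. p * q dvd c0 x \<and> q dvd c1 x}"

lemma den_coprime: "p dvd d \<Longrightarrow> q dvd a \<Longrightarrow> coprime den (p * q)"
proof -
  assume "p dvd d" "q dvd a"
  then have "odd d \<Longrightarrow> odd (p * q)" using odd_a by (auto dest: dvd_trans)
  moreover have "coprime 4 n" if "odd n" for n :: int
    using that coprime_power_left_iff[of 2 2 n] by simp
  ultimately show ?thesis by (simp add: den_def)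
qed

lemma ideal_idl:
  assumes p: "p dvd d" and q: "q dvd a"
  shows "ideal (idl p q) OF"
proof -
  have mult: "x * y \<in> idl p q" if x: "x \<in> idl p q" and y: "y \<in> carrier OF" for x y
  proof -
    have xO: "x \<in> carrier OF" and x': "p * q dvd c0 x" "q dvd c1 x" using x by (auto simp: idl_def)
    have xy: "x * y \<in> carrier OF" using xO y by (rule OF_closed)
    obtain X0 X1 X2 X3 where X: "x = ielt X0 X1 X2 X3" using OF_ielt[OF xO] .
    obtain Y0 Y1 Y2 Y3 where Y: "y = ielt Y0 Y1 Y2 Y3" using OF_ielt[OF y] .
    obtain Z0 Z1 Z2 Z3 where Z: "x * y = ielt Z0 Z1 Z2 Z3" using OF_ielt[OF xy] .
    note m = ielt_mult[OF Z[unfolded X Y]]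
    have X01: "p * q dvd X0" "q dvd X1" using x' by (simp_all add: X c0_ielt c1_ielt)
    have "p * q dvd d * X1" "p * q dvd a * d"
      using p q X01(2) by (simp_all add: mult_dvd_mono mult.commute[of a])
    then have "p * q dvd den * Z0" unfolding m using X01(1) by (simp add: dvd_mult2)
    then have "p * q dvd Z0" using den_coprime[OF p q]
        by (simp add: coprime_commute coprime_dvd_mult_right_iff)
    moreover have "q dvd den * Z1" unfolding m
      using q X01(2) dvd_mult_right[OF X01(1)] by (intro dvd_diff dvd_add) (simp_all add: dvd_mult2)
    moreover have "coprime den q" using den_coprime[OF p q] by simp
    ultimately have "p * q dvd Z0" "q dvd Z1"
        by (simp_all add: coprime_commute coprime_dvd_mult_right_iff)
    then show ?thesis using xy by (simp add: idl_def Z c0_ielt c1_ielt)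
  qed
  show ?thesis
  proof (rule idealI)
    show "ring OF" by (rule O.ring_axioms)
    show "subgroup (idl p q) (add_monoid OF)"
    proof (rule O.add.subgroupI)
      show "idl p q \<subseteq> carrier OF" by (auto simp: idl_def)
      have "ielt 0 0 0 0 = 0" by (simp add: ielt_def)
      then have "0 \<in> idl p q" using OF_closed(5)[of 0] c0_ielt[of 0 0 0 0] c1_ielt[of 0 0 0 0]
        by (simp add: idl_def)
      then show "idl p q \<noteq> {}" by blast
      show "\<ominus>\<^bsub>OF\<^esub> x \<in> idl p q" if "x \<in> idl p q" for x
        using mult[OF that OF_closed(5)[of "- 1"]] that by (simp add: OF_a_inv idl_def)
      show "x \<oplus>\<^bsub>OF\<^esub> y \<in> idl p q" if x: "x \<in> idl p q" and y: "y \<in> idl p q" for x y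
      proof -
        have y': "- y \<in> idl p q" using mult[OF y OF_closed(5)[of "- 1"]] by simp
        then have "x - (- y) \<in> idl p q" using x
            by (simp add: idl_def c_diff OF_closed del: diff_minus_eq_add)
        then show ?thesis by simp
      qed
    qed
  next
    fix x y assume "x \<in> idl p q" "y \<in> carrier OF"
    then show "y \<otimes>\<^bsub>OF\<^esub> x \<in> idl p q" "x \<otimes>\<^bsub>OF\<^esub> y \<in> idl p q"
      using mult[of x y] by (simp_all add: mult.commute)
  qed
qed

lemma of_int_ielt: "of_int n = ielt (den * n) 0 0 0"
  using den_nonzero by (simp add: ielt_def)

lemma of_int_mem_idl: "p * q dvd n \<Longrightarrow> of_int n \<in> idl p q"
  using OF_closed(5)[of n] by (simp add: idl_def c0_ielt c1_ielt of_int_ielt[of n])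

lemma idl_nonzero:
  assumes "p \<ge> 1" "q \<ge> 1"
  shows "idl p q \<noteq> {0}"
proof -
  have "of_int (p * q) \<in> idl p q" by (rule of_int_mem_idl) simp
  moreover have "of_int (p * q) \<noteq> (0 :: complex)" using assms by simp
  ultimately show ?thesis by blast
qed

text \<open>
  The residue classes of \<open>c0\<close> modulo \<open>p q\<close> and of \<open>c1\<close> modulo \<open>q\<close>
  separate the cosets.  All pairs occur already on \<open>\<int>[rt]\<close>, since \<open>den\<close> is invertible
  modulo \<open>p q\<close>.
\<close>

lemma ideal_norm_idl:
  assumes p: "p dvd d" "p \<ge> 1" and q: "q dvd a" "q \<ge> 1"
  shows "int (ideal_norm F (idl p q)) = p * q\<^sup>2"
proof -
  define f where "f x = (c0 x mod (p * q), c1 x mod q)" for x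
  have "f x = f y \<longleftrightarrow> x \<ominus>\<^bsub>OF\<^esub> y \<in> idl p q" if "x \<in> carrier OF" "y \<in> carrier OF" for x y
    using that by (simp add: f_def idl_def OF_minus c_diff OF_closed mod_eq_dvd_iff)
  then have "ideal_norm F (idl p q) = card (f ` carrier OF)"
    unfolding ideal_norm_def by (rule O.card_Quot[OF ideal_idl[OF p(1) q(1)]])
  also have "f ` carrier OF = {0..<p * q} \<times> {0..<q}"
  proof
    show "f ` carrier OF \<subseteq> {0..<p * q} \<times> {0..<q}" using p q by (auto simp: f_def)
    show "{0..<p * q} \<times> {0..<q} \<subseteq> f ` carrier OF"
    proof
      fix z assume "z \<in> {0..<p * q} \<times> {0..<q}"
      then obtain i j where ij: "z = (i, j)" "0 \<le> i" "i < p * q" "0 \<le> j" "j < q" by auto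
      have "coprime den (p * q)" "coprime den q" using den_coprime[OF p(1) q(1)] by simp_all
      then obtain u v where uv: "[den * u = 1] (mod p * q)" "[den * v = 1] (mod q)"
        by (meson cong_solve_coprime_int)
      have "[den * (u * i) = i] (mod p * q)" "[den * (v * j) = j] (mod q)"
        using cong_scalar_right[OF uv(1), of i] cong_scalar_right[OF uv(2), of j]
          by (simp_all add: mult.assoc)
      then have "den * (u * i) mod (p * q) = i mod (p * q)" "den * (v * j) mod q = j mod q"
        by (simp_all only: unique_euclidean_semiring_class.cong_def)
      then have m: "den * (u * i) mod (p * q) = i" "den * (v * j) mod q = j"
        using ij by (simp_all only: mod_pos_pos_trivial)
      have "f (elt (of_int (u * i), of_int (v * j), of_int 0, of_int 0)) = z"
        unfolding elt_of_int f_def c0_ielt c1_ielt ij(1) m ..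
      then show "z \<in> f ` carrier OF" using elt_of_int_carrier by blast
    qed
  qed
  finally show ?thesis using p q by (simp add: card_cartesian_product power2_eq_square)
qed

text \<open>
  The integer is \<open>den\<^sup>4\<close> times the field norm; the cofactor of the element is a multiple of its
  other three conjugates and is an integer of \<open>F\<close>.
\<close>

lemma norm_mem_ideal:
  assumes I: "ideal I OF" and x: "ielt X0 X1 X2 X3 \<in> I"
  shows "of_int ((X0\<^sup>2 + d * X1\<^sup>2 - a * d * (X2\<^sup>2 + X3\<^sup>2))\<^sup>2
    - d * (2 * X0 * X1 + a * b * (X2\<^sup>2 - X3\<^sup>2) - 2 * a * c * X2 * X3)\<^sup>2) \<in> I"
    (is "of_int (?U\<^sup>2 - d * ?V\<^sup>2) \<in> I")
proof -
  let ?A = "(of_int X0, of_int X1, of_int X2, of_int X3) :: quad"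
  let ?w = "of_int den * (elt (of_int X0, of_int X1, of_int (- X2), of_int (- X3))
      * elt (of_int ?U, of_int (- ?V), of_int 0, of_int 0))"
  have w: "?w \<in> carrier OF"
    by (intro OF_closed(2) OF_closed(5) elt_of_int_carrier)
  have U: "relnorm0 ?A = of_int ?U" and V: "relnorm1 ?A = of_int ?V" by simp_all
  have A: "elt ?A = of_int den * ielt X0 X1 X2 X3"
    using den_nonzero by (simp add: ielt_def of_rat_divide field_simps)
  have "ielt X0 X1 X2 X3 * ?w = elt ?A * elt (conjq (conjq ?A))
      * elt (of_int ?U, - of_int ?V, 0, 0)"
    unfolding A by simp
  also have "\<dots> = elt (of_int ?U, of_int ?V, 0, 0) * elt (of_int ?U, - of_int ?V, 0, 0)"
    by (simp only: mulq_conj2 U V flip: elt_mulq)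
  also have "\<dots> = of_int (?U\<^sup>2 - d * ?V\<^sup>2)"
    unfolding elt_mulq[symmetric] mulq_conj1
    by (simp only: elt_rat of_rat_of_int_eq flip: of_int_mult of_int_diff of_int_power)
  finally show ?thesis using ideal.I_r_closed[OF I x w] by simp
qed

text \<open>
  The quotient by \<open>I\<close> has \<open>r\<close>-torsion.  An integer of \<open>I\<close> coprime to \<open>r\<close>
  would annihilate the quotient and hence kill that torsion.
\<close>

lemma int_mem_ideal_dvd:
  assumes I: "ideal I OF" and r: "prime (r :: int)" "r dvd int (ideal_norm F I)"
      "ideal_norm F I \<noteq> 0"
    and N: "of_int N \<in> I"
  shows "r dvd N"
proof (rule ccontr)
  assume ndvd: "\<not> r dvd N"
  have r': "prime (nat r)" "r = int (nat r)"
    using iffD1[OF prime_int_nat_transfer r(1)] by (simp_all only: nat_0_le)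
  have "nat r dvd ideal_norm F I" using r(2) r'(2) by (metis int_dvd_int_iff)
  then obtain x where x: "x \<in> carrier OF" "x \<notin> I" "[nat r] \<cdot>\<^bsub>OF\<^esub> x \<in> I"
    using O.quotient_has_torsion[OF I r'(1)] r(3) unfolding ideal_norm_def by blast
  have "of_nat (nat r) = (of_int r :: complex)" using r'(2) by (metis of_int_of_nat_eq)
  then have rx: "of_int r * x \<in> I" using x by (simp add: OF_add_pow)
  have Nx: "of_int N * x \<in> I" using ideal.I_r_closed[OF I N x(1)] by simp
  have "coprime r N" using ndvd r(1) by (simp add: prime_imp_coprime)
  then obtain u v where uv: "u * r + v * N = 1" by (metis bezout_int coprime_iff_gcd_eq_1)
  have "of_int u * (of_int r * x) + of_int v * (of_int N * x) \<in> I"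
    using additive_subgroup.a_closed[OF ideal.axioms(1)[OF I]]
      ideal.I_l_closed[OF I rx OF_closed(5)[of u]] ideal.I_l_closed[OF I Nx OF_closed(5)[of v]]
          by simp
  also have "of_int u * (of_int r * x) + of_int v * (of_int N * x) = of_int (u * r + v * N) * x"
    by (simp add: algebra_simps)
  finally show False using x(2) uv by simp
qed

lemma idl_unique_if_subset:
  assumes I: "ideal I OF" and p: "p dvd d" "p \<ge> 1" and q: "q dvd a" "q \<ge> 1"
    and norm: "int (ideal_norm F I) = p * q\<^sup>2" and sub: "I \<subseteq> idl p q"
  shows "I = idl p q"
proof -
  have "0 < p * q\<^sup>2" using p q by simp
  have "ideal_norm F I = ideal_norm F (idl p q)" "ideal_norm F (idl p q) \<noteq> 0"
    using norm ideal_norm_idl[OF p q] \<open>0 < p * q\<^sup>2\<close> by linarith+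
  then show ?thesis
    using O.ideal_eq_if_same_index[OF I ideal_idl[OF p(1) q(1)] sub] by (simp add: ideal_norm_def)
qed

text \<open>
  Modulo a prime divisor of \<open>d\<close> the norm in \<open>norm_mem_ideal\<close> is \<open>X0\<^sup>4\<close>.
\<close>

lemma idl_unique_ramified:
  assumes I: "ideal I OF" and p: "p dvd d" "p \<ge> 1" and norm: "int (ideal_norm F I) = p"
  shows "I = idl p 1"
proof (rule idl_unique_if_subset[OF I p])
  show "I \<subseteq> idl p 1"
  proof
    fix x assume x: "x \<in> I"
    then have xO: "x \<in> carrier OF" using ideal.Icarr[OF I] by blast
    then obtain X0 X1 X2 X3 where X: "x = ielt X0 X1 X2 X3" by (rule OF_ielt)
    have "p dvd X0"
    proof (rule squarefree_dvd_if_primes_dvd)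
      show "squarefree p" using p(1) squarefree_d by (rule squarefree_mono)
      fix r :: int assume r: "prime r" "r dvd p"
      then have rd: "r dvd d" using p(1) by (meson dvd_trans)
      let ?S = "X1\<^sup>2 - a * (X2\<^sup>2 + X3\<^sup>2)"
      let ?V = "2 * X0 * X1 + a * b * (X2\<^sup>2 - X3\<^sup>2) - 2 * a * c * X2 * X3"
      have "r dvd (X0\<^sup>2 + d * X1\<^sup>2 - a * d * (X2\<^sup>2 + X3\<^sup>2))\<^sup>2 - d * ?V\<^sup>2"
        using int_mem_ideal_dvd[OF I r(1) _ _ norm_mem_ideal[OF I x[unfolded X]]] norm r(2) p(2)
          by simp
      also have "(X0\<^sup>2 + d * X1\<^sup>2 - a * d * (X2\<^sup>2 + X3\<^sup>2))\<^sup>2 - d * ?V\<^sup>2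
          = X0 ^ 4 + d * (2 * X0\<^sup>2 * ?S + d * ?S\<^sup>2 - ?V\<^sup>2)"
        by (simp add: power2_eq_square power4_eq_xxxx algebra_simps)
      finally have "r dvd X0 ^ 4" using rd by (simp add: dvd_add_left_iff)
      then show "r dvd X0" using r(1) by (simp add: prime_dvd_power_iff)
    qed
    then show "x \<in> idl p 1" using xO by (simp add: idl_def X c0_ielt)
  qed
qed (use norm in simp_all)

text \<open>
  Modulo a prime divisor \<open>r\<close> of \<open>a\<close> the norm in \<open>norm_mem_ideal\<close> is
  \<open>(X0\<^sup>2 - d X1\<^sup>2)\<^sup>2\<close>; as \<open>d\<close> is a non-residue, \<open>r\<close> divides both
  \<open>X0\<close> and \<open>X1\<close>.
\<close>

lemma idl_unique_inert:
  assumes I: "ideal I OF" and q: "q dvd a" "q \<ge> 1"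
    and nonres: "\<And>r. prime r \<Longrightarrow> r dvd q \<Longrightarrow> \<not> QuadRes r d"
    and norm: "int (ideal_norm F I) = q\<^sup>2"
  shows "I = idl 1 q"
proof (rule idl_unique_if_subset[of I 1, OF I _ _ q])
  show "I \<subseteq> idl 1 q"
  proof
    fix x assume x: "x \<in> I"
    then have xO: "x \<in> carrier OF" using ideal.Icarr[OF I] by blast
    then obtain X0 X1 X2 X3 where X: "x = ielt X0 X1 X2 X3" by (rule OF_ielt)
    have primes: "r dvd X0 \<and> r dvd X1" if r: "prime r" "r dvd q" for r
    proof -
      have ra: "r dvd a" using r q(1) by (meson dvd_trans)
      let ?S = "d * (X2\<^sup>2 + X3\<^sup>2)"
      let ?T = "b * (X2\<^sup>2 - X3\<^sup>2) - 2 * c * X2 * X3"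
      have "r dvd (X0\<^sup>2 + d * X1\<^sup>2 - a * d * (X2\<^sup>2 + X3\<^sup>2))\<^sup>2
          - d * (2 * X0 * X1 + a * b * (X2\<^sup>2 - X3\<^sup>2) - 2 * a * c * X2 * X3)\<^sup>2"
      proof (rule int_mem_ideal_dvd[OF I r(1) _ _ norm_mem_ideal[OF I x[unfolded X]]])
        show "r dvd int (ideal_norm F I)" unfolding norm power2_eq_square using r(2)
            by (rule dvd_mult2)
        have "0 < int (ideal_norm F I)" unfolding norm using q(2) by simp
        then show "ideal_norm F I \<noteq> 0" by simp
      qed
      also have "(X0\<^sup>2 + d * X1\<^sup>2 - a * d * (X2\<^sup>2 + X3\<^sup>2))\<^sup>2
          - d * (2 * X0 * X1 + a * b * (X2\<^sup>2 - X3\<^sup>2) - 2 * a * c * X2 * X3)\<^sup>2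
          = (X0\<^sup>2 - d * X1\<^sup>2)\<^sup>2 + a * (a * ?S\<^sup>2 - 2 * (X0\<^sup>2 + d * X1\<^sup>2) * ?S
             - d * (4 * X0 * X1 * ?T + a * ?T\<^sup>2))"
        by (simp add: power2_eq_square algebra_simps)
      finally have "r dvd (X0\<^sup>2 - d * X1\<^sup>2)\<^sup>2" using ra by (simp add: dvd_add_left_iff)
      then have dvd: "r dvd X0\<^sup>2 - d * X1\<^sup>2" using r(1) by (simp add: prime_dvd_power_iff)
      have X1: "r dvd X1"
      proof (rule ccontr)
        assume "\<not> r dvd X1"
        then have "coprime X1 r" using prime_imp_coprime[OF r(1)] coprime_commute by blast
        then obtain y where y: "[X1 * y = 1] (mod r)" by (meson cong_solve_coprime_int)
        have "[X0\<^sup>2 * y\<^sup>2 = d * X1\<^sup>2 * y\<^sup>2] (mod r)"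
          using dvd by (intro cong_scalar_right) (simp add: cong_iff_dvd_diff)
        also have "d * X1\<^sup>2 * y\<^sup>2 = d * (X1 * y)\<^sup>2" by (simp add: power_mult_distrib)
        also have "[d * (X1 * y)\<^sup>2 = d * 1\<^sup>2] (mod r)"
          using y by (intro cong_scalar_left cong_pow)
        finally have "[(X0 * y)\<^sup>2 = d] (mod r)" by (simp add: power_mult_distrib)
        then show False using nonres[OF r] by (auto simp: QuadRes_def)
      qed
      then have "r dvd X0\<^sup>2" using dvd by (simp add: dvd_diff_left_iff power2_eq_square)
      then show ?thesis using X1 r(1) by (simp add: prime_dvd_power_iff)
    qed
    have "squarefree q" using q(1) squarefree_a by (rule squarefree_mono)
    then have "q dvd X0" "q dvd X1" using primes by (auto intro: squarefree_dvd_if_primes_dvd)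
    then show "x \<in> idl 1 q" using xO by (simp add: idl_def X c0_ielt c1_ielt)
  qed
qed (use norm in simp_all)

text \<open>
  As \<open>p\<close> and \<open>q\<close> are coprime, the two ideals are comaximal and their product is their
  intersection.
\<close>

lemma idl_prod:
  assumes p: "p dvd d" and q: "q dvd a"
  shows "idl p 1 \<cdot>\<^bsub>OF\<^esub> idl 1 q = idl p q"
proof -
  have "coprime d a" using gcd_ad by (simp add: coprime_iff_gcd_eq_1 gcd.commute)
  then have pq: "coprime p q" using p q coprime_divisors by blast
  then obtain u v where uv: "u * p + v * q = 1" by (metis bezout_int coprime_iff_gcd_eq_1)
  have "idl p 1 \<cdot>\<^bsub>OF\<^esub> idl 1 q = idl p 1 \<inter> idl 1 q"
  proof (rule ideal_prod_comaximal[OF cring_OF])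
    show "of_int (u * p) \<in> idl p 1" "of_int (v * q) \<in> idl 1 q" by (rule of_int_mem_idl; simp)+
    show "of_int (u * p) \<oplus>\<^bsub>OF\<^esub> of_int (v * q) = \<one>\<^bsub>OF\<^esub>"
      using uv by (simp only: OF_simps flip: of_int_add) simp
  qed (use p q in \<open>simp_all add: ideal_idl\<close>)
  also have "\<dots> = idl p q"
    using pq by (auto simp: idl_def intro: divides_mult dest: dvd_mult_left dvd_mult_right)
  finally show ?thesis .
qed

end

section \<open>The four embeddings and the trace form\<close>

lemma complex_of_rat_eq: "complex_of_rat r = complex_of_real (of_rat r)"
  by (cases r) (simp add: of_rat_rat)

context cyclic_quartic_data
begin

text \<open>
  Restricted to \<open>F\<close> because embeddings are extensional functions; all embeddings of \<open>F\<close>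
  have their image in \<open>F\<close> and are powers of the Galois generator.
\<close>

definition emb :: "nat \<Rightarrow> complex \<Rightarrow> complex" where
  "emb k = restrict (\<lambda>x. elt ((conjq ^^ k) (the_inv elt x))) F"

lemma emb_elt: "emb k (elt A) = elt ((conjq ^^ k) A)"
  by (simp add: emb_def elt_in_F the_inv_elt)

lemma conjq_pow_hom:
  "(conjq ^^ k) (A + B) = (conjq ^^ k) A + (conjq ^^ k) B"
  "(conjq ^^ k) (mulq A B) = mulq ((conjq ^^ k) A) ((conjq ^^ k) B)"
  "(conjq ^^ k) (1, 0, 0, 0) = (1, 0, 0, 0)"
  by (induction k) (simp_all add: conjq_add conjq_mulq del: mulq.simps)

lemma emb_in_embeddings: "emb k \<in> embeddings F"
proof -
  have "emb k \<in> Ring.ring_hom (complex_ring\<lparr>carrier := F\<rparr>) complex_ring"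
  proof (rule ring_hom_memI)
    fix x y assume "x \<in> carrier (complex_ring\<lparr>carrier := F\<rparr>)"
        "y \<in> carrier (complex_ring\<lparr>carrier := F\<rparr>)"
    then have "x \<in> F" "y \<in> F" by simp_all
    then obtain A B where AB: "x = elt A" "y = elt B" by (metis F_cases)
    show "emb k (x \<otimes>\<^bsub>complex_ring\<lparr>carrier := F\<rparr>\<^esub> y) = emb k x \<otimes>\<^bsub>complex_ring\<^esub> emb k y"
      by (simp add: AB emb_elt conjq_pow_hom flip: elt_mulq)
    show "emb k (x \<oplus>\<^bsub>complex_ring\<lparr>carrier := F\<rparr>\<^esub> y) = emb k x \<oplus>\<^bsub>complex_ring\<^esub> emb k y"
      by (simp add: AB emb_elt conjq_pow_hom flip: elt_add)
  next
    have "emb k (elt (1, 0, 0, 0)) = elt (1, 0, 0, 0)" by (simp only: emb_elt conjq_pow_hom)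
    then show "emb k \<one>\<^bsub>complex_ring\<lparr>carrier := F\<rparr>\<^esub> = \<one>\<^bsub>complex_ring\<^esub>" by simp
  qed simp
  then show ?thesis by (simp add: embeddings_def emb_def)
qed

lemma gens_in_F: "rt \<in> F" "\<beta> \<in> F" "\<gamma> \<in> F"
  using elt_in_F[of "(0, 1, 0, 0)"] elt_in_F[of "(0, 0, 1, 0)"] elt_in_F[of "(0, 0, 0, 1)"]
    by simp_all

lemma embedding_hom:
  assumes "h \<in> embeddings F"
  shows "h 1 = 1" "x \<in> F \<Longrightarrow> y \<in> F \<Longrightarrow> h (x + y) = h x + h y"
    "x \<in> F \<Longrightarrow> y \<in> F \<Longrightarrow> h (x * y) = h x * h y"
proof -
  have h: "h \<in> Ring.ring_hom (complex_ring\<lparr>carrier := F\<rparr>) complex_ring"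
    using assms by (simp add: embeddings_def)
  show "h 1 = 1" "x \<in> F \<Longrightarrow> y \<in> F \<Longrightarrow> h (x + y) = h x + h y"
    "x \<in> F \<Longrightarrow> y \<in> F \<Longrightarrow> h (x * y) = h x * h y"
    using ring_hom_one[OF h] ring_hom_add[OF h, of x y] ring_hom_mult[OF h, of x y] by simp_all
qed

lemma embedding_of_rat:
  assumes h: "h \<in> embeddings F"
  shows "h (of_rat r) = of_rat r"
proof -
  have inF: "of_int n \<in> F" "of_nat m \<in> F" for n m
    using F_of_rat[of "of_int n"] F_of_rat[of "of_nat m"] by simp_all
  have "h (0 + 0) = h 0 + h 0" using inF(2)[of 0] by (intro embedding_hom(2)[OF h]) simp_all
  then have h0: "h 0 = 0" by simp
  have nat: "h (of_nat m) = of_nat m" for m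
    by (induction m) (use inF F_closed(1) in \<open>simp_all add: h0 embedding_hom[OF h]\<close>)
  have int: "h (of_int n) = of_int n" for n
  proof (cases n rule: int_cases2)
    case (nonneg m)
    then show ?thesis by (simp add: nat)
  next
    case (nonpos m)
    have "h (of_nat m + of_int n) = h (of_nat m) + h (of_int n)"
        by (intro embedding_hom(2)[OF h] inF)
    then show ?thesis using nonpos by (simp add: nat h0 add_eq_0_iff)
  qed
  obtain n k where nk: "quotient_of r = (n, k)" by (cases "quotient_of r") auto
  have k: "k > 0" using quotient_of_denom_pos[OF nk] .
  have "r * of_int k = of_int n" using quotient_of_div[OF nk] k by simp
  then have rk: "of_rat r * of_int k = (of_int n :: complex)"
      by (metis of_rat_mult of_rat_of_int_eq)
  have "h (of_rat r) * of_int k = h (of_rat r * of_int k)"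
    using embedding_hom(3)[OF h F_of_rat inF(1)] by (simp add: int)
  also have "\<dots> = of_rat r * of_int k" unfolding rk int ..
  finally show ?thesis using k by simp
qed

lemma embedding_elt:
  assumes h: "h \<in> embeddings F"
  shows "h (elt (w, x, y, z)) = of_rat w * h 1 + of_rat x * h rt + of_rat y * h \<beta> + of_rat z * h \<gamma>"
proof -
  note hom = embedding_hom[OF h] embedding_of_rat[OF h]
  have "h (of_rat w + of_rat x * rt + of_rat y * \<beta> + of_rat z * \<gamma>)
      = h (of_rat w) + h (of_rat x * rt) + h (of_rat y * \<beta>) + h (of_rat z * \<gamma>)"
    by (subst embedding_hom(2)[OF h], (intro F_closed F_of_rat gens_in_F)+)+ rule
  also have "\<dots> = of_rat w + of_rat x * h rt + of_rat y * h \<beta> + of_rat z * h \<gamma>"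
    by (simp only: hom F_of_rat gens_in_F)
  finally show ?thesis by (simp add: hom)
qed

text \<open>
  An embedding sends \<open>rt\<close> to \<open>\<plusminus> rt\<close>; then \<open>\<beta>\<close> goes to a square root of
  \<open>a (d - b rt)\<close> or of \<open>a (d + b rt)\<close>, that is to \<open>\<plusminus> \<beta>\<close> or
  \<open>\<plusminus> \<gamma>\<close>, and \<open>\<beta> \<gamma> = a c rt\<close> determines the image of \<open>\<gamma>\<close>.
\<close>

lemma embedding_is_emb:
  assumes h: "h \<in> embeddings F"
  shows "h \<in> emb ` {..<4}"
proof -
  note hom = embedding_hom[OF h] embedding_of_rat[OF h]
  have int: "h (of_int n) = of_int n" for n using hom(4)[of "of_int n"] by simp
  have inF: "of_int n \<in> F" for n using F_of_rat[of "of_int n"] by simp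
  have "h rt * h rt = rt * rt"
    using hom(3)[OF gens_in_F(1) gens_in_F(1)] by (simp add: rt_square int)
  then have rt: "h rt = rt \<or> h rt = - rt" by (simp add: square_eq_iff)
  have "\<beta> * \<beta> = of_int (a * d) + of_int (- (a * b)) * rt" by (simp add: \<beta>_square algebra_simps)
  then have "h \<beta> * h \<beta> = h (of_int (a * d) + of_int (- (a * b)) * rt)"
    using hom(3)[OF gens_in_F(2) gens_in_F(2)] by simp
  also have "\<dots> = of_int (a * d) + of_int (- (a * b)) * h rt"
    by (simp only: hom(2,3) int inF gens_in_F F_closed(3))
  finally have \<beta>: "h \<beta> * h \<beta> = of_int a * (of_int d - of_int b * h rt)" by (simp add: algebra_simps)
  have \<gamma>: "h \<beta> * h \<gamma> = of_int (a * c) * h rt"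
    using hom(3)[OF gens_in_F(2,3)] hom(3)[OF inF gens_in_F(1), of "a * c"] int[of "a * c"]
    by (simp add: \<beta>\<gamma> del: of_int_mult)
  have eq: "h = emb k" if "\<And>w x y z. of_rat w + of_rat x * h rt + of_rat y * h \<beta> + of_rat z * h \<gamma>
      = elt ((conjq ^^ k) (w, x, y, z))" for k
  proof (rule extensionalityI[where A = F])
    show "h \<in> extensional F" "emb k \<in> extensional F"
      using h emb_in_embeddings[of k] by (simp_all add: embeddings_def)
    fix u assume "u \<in> F"
    then obtain w x y z where "u = elt (w, x, y, z)" by (metis F_cases prod_cases4)
    then show "h u = emb k u"
      using that[of w x y z] by (simp add: embedding_elt[OF h] hom(1) emb_elt del: elt.simps)
  qed
  have \<gamma>_nonzero: "\<gamma> \<noteq> 0"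
    using elt_eq_0[of "(0, 0, 0, 1)"] by (auto simp: zero_prod_def)
  from rt show ?thesis
  proof
    assume rt: "h rt = rt"
    have "h \<beta> * h \<beta> = \<beta> * \<beta>" unfolding \<beta> rt \<beta>_square ..
    then consider "h \<beta> = \<beta>" | "h \<beta> = - \<beta>" by (auto simp: square_eq_iff)
    then show ?thesis
    proof cases
      case 1
      then have "\<beta> * h \<gamma> = \<beta> * \<gamma>" using \<gamma> rt \<beta>\<gamma> by simp
      then have "h \<gamma> = \<gamma>" by (rule cancel_\<beta>)
      then have "h = emb 0" by (intro eq) (simp add: 1 rt)
      then show ?thesis by auto
    next
      case 2
      then have "\<beta> * h \<gamma> = \<beta> * (- \<gamma>)" using \<gamma> rt \<beta>\<gamma> by (simp add: minus_equation_iff)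
      then have "h \<gamma> = - \<gamma>" by (rule cancel_\<beta>)
      then have "h = emb 2" by (intro eq) (simp add: 2 rt numeral_2_eq_2 of_rat_minus)
      then show ?thesis by auto
    qed
  next
    assume rt: "h rt = - rt"
    have "h \<beta> * h \<beta> = \<gamma> * \<gamma>" unfolding \<beta> rt \<gamma>_square by simp
    then consider "h \<beta> = \<gamma>" | "h \<beta> = - \<gamma>" by (auto simp: square_eq_iff)
    then show ?thesis
    proof cases
      case 1
      then have "\<gamma> * h \<gamma> = \<gamma> * (- \<beta>)" using \<gamma> rt \<beta>\<gamma> by (simp add: mult.commute)
      then have "h \<gamma> = - \<beta>" using mult_left_cancel[OF \<gamma>_nonzero] by blast
      then have "h = emb 1" by (intro eq) (simp add: 1 rt of_rat_minus)
      then show ?thesis by auto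
    next
      case 2
      have "\<gamma> * h \<gamma> = - (h \<beta> * h \<gamma>)" by (simp add: 2)
      also have "\<dots> = \<gamma> * \<beta>" unfolding \<gamma> rt using \<beta>\<gamma> by (simp add: mult.commute)
      finally have "\<gamma> * h \<gamma> = \<gamma> * \<beta>" .
      then have "h \<gamma> = \<beta>" using mult_left_cancel[OF \<gamma>_nonzero] by blast
      then have "h = emb 3" by (intro eq) (simp add: 2 rt numeral_3_eq_3 of_rat_minus)
      then show ?thesis by auto
    qed
  qed
qed

lemma embeddings_eq: "embeddings F = emb ` {..<4}"
  using embedding_is_emb emb_in_embeddings by blast

lemma emb_inj: "inj_on emb {..<4}"
proof (rule inj_onI)
  fix i j :: nat assume ij: "i \<in> {..<4}" "j \<in> {..<4}" and "emb i = emb j"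
  then have "emb i (elt (0, 0, 1, 0)) = emb j (elt (0, 0, 1, 0))" by simp
  then have "(conjq ^^ i) (0, 0, 1, 0) = (conjq ^^ j) (0, 0, 1, 0)"
      by (simp only: emb_elt elt_inject)
  moreover have "i \<in> {0, 1, 2, 3}" "j \<in> {0, 1, 2, 3}" using ij by auto
  ultimately show "i = j" by (auto simp: numeral_2_eq_2 numeral_3_eq_3)
qed

lemma sum_embeddings: "(\<Sum>h\<in>embeddings F. g h) = g (emb 0) + g (emb 1) + g (emb 2) + g (emb 3)"
proof -
  have "(\<Sum>h\<in>embeddings F. g h) = (\<Sum>k<4. g (emb k))"
    unfolding embeddings_eq using emb_inj by (simp add: sum.reindex)
  then show ?thesis by (simp add: eval_nat_numeral)
qed

lemma trace_elt: "elt A + elt (conjq A) + elt (conjq (conjq A)) + elt (conjq (conjq (conjq A)))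
  = of_rat (4 * fst A)"
  by (cases A) (simp add: of_rat_mult of_rat_minus)

text \<open>
  Complex conjugation: \<open>\<beta>\<close> and \<open>\<gamma>\<close> are real for positive \<open>a\<close> and purely
  imaginary for negative \<open>a\<close>.
\<close>

fun cnj_quad :: "quad \<Rightarrow> quad" where
  "cnj_quad (w, x, y, z) = (w, x, of_int (sgn a) * y, of_int (sgn a) * z)"

lemma cnj_\<beta>: "cnj \<beta> = of_int (sgn a) * \<beta>"
proof -
  let ?r = "real_of_int a * (of_int d - of_int b * sqrt (of_int d))"
  have \<beta>: "\<beta> = csqrt (of_real ?r)" by (simp add: \<beta>_def cyclic_quartic_beta_def)
  show ?thesis
  proof (cases "a > 0")
    case True
    then have "?r \<ge> 0" using radicand_pos by simp
    then have "\<beta> = of_real (sqrt ?r)" unfolding \<beta> by (simp only: of_real_sqrt)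
    then show ?thesis using True by simp
  next
    case False
    then have a: "a < 0" using a_nonzero by simp
    then have "?r \<le> 0" using radicand_pos by (simp add: mult_nonpos_nonneg)
    then have "\<beta> = \<i> * of_real (sqrt \<bar>?r\<bar>)"
      unfolding \<beta> using csqrt_of_real_nonpos[of "of_real ?r"]
        by (simp only: Im_complex_of_real Re_complex_of_real)
    then show ?thesis using a by simp
  qed
qed

lemma cnj_rt: "cnj rt = rt" by (simp add: rt_def)

lemma cnj_\<gamma>: "cnj \<gamma> = of_int (sgn a) * \<gamma>"
proof -
  have "sgn a = 1 \<or> sgn a = - 1" using a_nonzero by (simp add: sgn_if)
  then show ?thesis by (auto simp: \<gamma>_def cnj_\<beta> cnj_rt)
qed

lemma cnj_elt: "cnj (elt A) = elt (cnj_quad A)"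
proof -
  have "cnj (of_rat r) = of_rat r" for r by (simp add: complex_of_rat_eq)
  then show ?thesis
    by (cases A) (simp add: cnj_\<beta> cnj_\<gamma> cnj_rt of_rat_mult mult_ac)
qed

lemma cnjq_conjq: "cnj_quad (conjq A) = conjq (cnj_quad A)"
  by (cases A) simp

fun trace_form :: "quad \<Rightarrow> quad \<Rightarrow> rat" where
  "trace_form (w, x, y, z) (w', x', y', z')
      = w * w' + of_int d * (x * x') + of_int (\<bar>a\<bar> * d) * (y * y' + z * z')"

lemma fst_mulq_cnjq: "fst (mulq A (cnj_quad B)) = trace_form A B"
proof -
  have abs: "(of_int \<bar>a\<bar> :: rat) = of_int a * of_int (sgn a)" by (simp add: sgn_if)
  obtain w x y z w' x' y' z' where AB: "A = (w, x, y, z)" "B = (w', x', y', z')"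
    by (cases A; cases B) blast
  show ?thesis
    unfolding AB cnj_quad.simps mulq.simps trace_form.simps fst_conv of_int_mult abs
    by (simp only: algebra_simps)
qed

text \<open>
  Complex conjugation commutes with the embeddings, so the left side is the trace of \<open>A\<close> times
  the conjugate of \<open>B\<close>.
\<close>

lemma sum_embeddings_inner:
  "(\<Sum>h\<in>embeddings F. inner (h (elt A)) (h (elt B))) = of_rat (4 * trace_form A B)"
proof -
  have inner: "inner u v = Re (u * cnj v)" for u v :: complex by (simp add: inner_complex_def)
  let ?M = "mulq A (cnj_quad B)"
  have "(\<Sum>h\<in>embeddings F. inner (h (elt A)) (h (elt B)))
    = Re (elt ?M + elt (conjq ?M) + elt (conjq (conjq ?M)) + elt (conjq (conjq (conjq ?M))))"
    unfolding sum_embeddings inner emb_elt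
    by (simp add: cnj_elt cnjq_conjq conjq_mulq elt_mulq numeral_2_eq_2 numeral_3_eq_3 del:
      elt.simps mulq.simps cnj_quad.simps conjq.simps)
  also have "\<dots> = Re (of_rat (4 * trace_form A B))" unfolding trace_elt fst_mulq_cnjq ..
  also have "\<dots> = of_rat (4 * trace_form A B)" by (simp only: complex_of_rat_eq Re_complex_of_real)
  finally show ?thesis .
qed

section \<open>Well-rounded ideals\<close>

text \<open>
  Four directions that are orthogonal for \<open>trace_form\<close>.
\<close>

definition basis4 :: "quad set" where
  "basis4 = {(1, 0, 0, 0), (0, 1, 0, 0), (0, 0, 1, 0), (0, 0, 0, 1)}"

lemma trace_form_pos: "A \<noteq> 0 \<Longrightarrow> trace_form A A > 0"
proof -
  assume A: "A \<noteq> 0"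
  obtain w x y z where wxyz: "A = (w, x, y, z)" by (cases A) auto
  have d: "(of_int d :: rat) > 0" "(of_int \<bar>a\<bar> :: rat) > 0" using d_ge_2 a_nonzero by simp_all
  have "w\<^sup>2 > 0 \<or> of_int d * x\<^sup>2 > 0 \<or> of_int \<bar>a\<bar> * of_int d * y\<^sup>2 > 0
      \<or> of_int \<bar>a\<bar> * of_int d * z\<^sup>2 > 0"
    using A d by (auto simp: wxyz zero_prod_def)
  moreover have "w\<^sup>2 \<ge> 0" "of_int d * x\<^sup>2 \<ge> 0" "of_int \<bar>a\<bar> * of_int d * y\<^sup>2 \<ge> 0"
      "of_int \<bar>a\<bar> * of_int d * z\<^sup>2 \<ge> 0"
    using d by simp_all
  moreover have "trace_form A A = w\<^sup>2 + of_int d * x\<^sup>2 + of_int \<bar>a\<bar> * of_int d * y\<^sup>2 + of_int \<bar>a\<bar>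
      * of_int d * z\<^sup>2"
    unfolding wxyz trace_form.simps of_int_mult power2_eq_square by (simp only: algebra_simps)
  ultimately show ?thesis by linarith
qed

lemma trace_form_zero: "trace_form 0 A = 0" "trace_form A 0 = 0"
  by (cases A; simp add: zero_prod_def)+

context
  fixes \<tau> :: "4 \<Rightarrow> complex \<Rightarrow> complex"
  assumes bij: "bij_betw \<tau> UNIV (embeddings F)"
begin

abbreviation mk :: "quad \<Rightarrow> complex ^ 4" where "mk A \<equiv> minkowski \<tau> (elt A)"

lemma inner_mk: "inner (mk A) (mk B) = of_rat (4 * trace_form A B)"
proof -
  have "inner (mk A) (mk B) = (\<Sum>i\<in>UNIV. inner (\<tau> i (elt A)) (\<tau> i (elt B)))"
    by (simp add: inner_vec_def minkowski_def del: elt.simps)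
  also have "\<dots> = (\<Sum>h\<in>embeddings F. inner (h (elt A)) (h (elt B)))"
    by (rule sum.reindex_bij_betw[OF bij])
  finally show ?thesis by (simp only: sum_embeddings_inner)
qed

lemma mk_linear:
  "mk (w, x, y, z) = of_rat w *\<^sub>R mk (1, 0, 0, 0) + of_rat x *\<^sub>R mk (0, 1, 0, 0)
     + of_rat y *\<^sub>R mk (0, 0, 1, 0) + of_rat z *\<^sub>R mk (0, 0, 0, 1)"
proof -
  have h: "\<tau> i \<in> embeddings F" for i using bij by (auto simp: bij_betw_def)
  have nth: "mk A $ i = \<tau> i (elt A)" for A i by (simp add: minkowski_def del: elt.simps)
  show ?thesis
    unfolding Finite_Cartesian_Product.vec_eq_iff
  proof
    fix i
    show "mk (w, x, y, z) $ i = (of_rat w *\<^sub>R mk (1, 0, 0, 0) + of_rat x *\<^sub>R mk (0, 1, 0, 0)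
        + of_rat y *\<^sub>R mk (0, 0, 1, 0) + of_rat z *\<^sub>R mk (0, 0, 0, 1)) $ i"
      unfolding vector_add_component vector_scaleR_component nth embedding_elt[OF h]
      by (simp add: scaleR_conv_of_real flip: complex_of_rat_eq)
  qed
qed

lemma mk_diff: "mk (A - B) = mk A - mk B"
proof -
  obtain w x y z w' x' y' z' where AB: "A = (w, x, y, z)" "B = (w', x', y', z')"
    by (cases A; cases B) blast
  define e0 e1 e2 e3 where e: "e0 = mk (1, 0, 0, 0)" "e1 = mk (0, 1, 0, 0)"
    "e2 = mk (0, 0, 1, 0)" "e3 = mk (0, 0, 0, 1)"
  have lin: "mk (w, x, y, z) = of_rat w *\<^sub>R e0 + of_rat x *\<^sub>R e1 + of_rat y *\<^sub>R e2 + of_rat z *\<^sub>R e3"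
    for w x y z
    unfolding e by (rule mk_linear)
  show ?thesis
    unfolding AB diff_Pair lin of_rat_diff scaleR_diff_left by (simp only: algebra_simps)
qed

lemma mk_eq_0_iff: "mk A = 0 \<longleftrightarrow> A = 0"
proof -
  have "mk A = 0 \<longleftrightarrow> inner (mk A) (mk A) = 0" by (rule inner_eq_zero_iff[symmetric])
  also have "\<dots> \<longleftrightarrow> (of_rat (4 * trace_form A A) :: real) = 0" unfolding inner_mk ..
  also have "\<dots> \<longleftrightarrow> trace_form A A = 0" by simp
  also have "\<dots> \<longleftrightarrow> A = 0" using trace_form_pos[of A] trace_form_zero(1)[of A]
      by (cases "A = 0") simp_all
  finally show ?thesis .
qed

lemma mk_norm_le: "norm (mk A) \<le> norm (mk B) \<longleftrightarrow> trace_form A A \<le> trace_form B B"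
  by (simp only: norm_le inner_mk of_rat_less_eq) simp

lemma basis4_orthogonal: "u \<in> basis4 \<Longrightarrow> v \<in> basis4 \<Longrightarrow> u \<noteq> v \<Longrightarrow> trace_form u v = 0"
  by (auto simp: basis4_def)

lemma basis4_nonzero: "u \<in> basis4 \<Longrightarrow> u \<noteq> 0"
  by (auto simp: basis4_def zero_prod_def)

lemma mk_inj_basis4: "inj_on mk basis4"
proof (rule inj_onI, rule ccontr)
  fix u v assume uv: "u \<in> basis4" "v \<in> basis4" "mk u = mk v" "u \<noteq> v"
  have "inner (mk u) (mk u) = inner (mk u) (mk v)" by (simp only: uv(3))
  then have "trace_form u u = 0" using basis4_orthogonal[OF uv(1,2,4)] by (simp add: inner_mk)
  then show False using trace_form_pos[OF basis4_nonzero[OF uv(1)]] by simp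
qed

lemma span_F: "span (minkowski \<tau> ` F) = span (mk ` basis4)"
proof
  have "mk A \<in> span (mk ` basis4)" for A
  proof -
    obtain w x y z where A: "A = (w, x, y, z)" by (cases A) auto
    show ?thesis unfolding A mk_linear[of w x y z]
      by (intro span_add span_scale span_base imageI) (simp_all add: basis4_def)
  qed
  then show "span (minkowski \<tau> ` F) \<subseteq> span (mk ` basis4)"
    by (intro span_minimal) (auto simp: F_eq simp del: elt.simps)
  show "span (mk ` basis4) \<subseteq> span (minkowski \<tau> ` F)"
    by (intro span_mono) (auto simp: elt_in_F simp del: elt.simps)
qed

lemma dim_F: "dim (span (minkowski \<tau> ` F)) = 4"
proof -
  have "pairwise real_inner_class.orthogonal (mk ` basis4)"
  proof (rule pairwiseI)
    fix s t assume "s \<in> mk ` basis4" "t \<in> mk ` basis4" "s \<noteq> t"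
    then obtain u v where "s = mk u" "t = mk v" "u \<in> basis4" "v \<in> basis4" "u \<noteq> v" by blast
    then show "real_inner_class.orthogonal s t"
        by (simp add: real_inner_class.orthogonal_def inner_mk basis4_orthogonal)
  qed
  moreover have "0 \<notin> mk ` basis4"
  proof
    assume "0 \<in> mk ` basis4"
    then obtain u where u: "0 = mk u" "u \<in> basis4" by (rule imageE)
    have "u = 0" using u(1)[symmetric] unfolding mk_eq_0_iff .
    then show False using basis4_nonzero[OF u(2)] by simp
  qed
  ultimately have "independent (mk ` basis4)" by (rule pairwise_orthogonal_independent)
  then have "dim (span (mk ` basis4)) = card (mk ` basis4)" by (rule dim_span_eq_card_independent)
  also have "\<dots> = card basis4" by (rule card_image[OF mk_inj_basis4])
  also have "\<dots> = 4" by (simp add: basis4_def)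
  finally show ?thesis by (simp only: span_F)
qed

lemma minimal_vectors_mk:
  assumes "I \<subseteq> F"
  shows "v \<in> minimal_vectors (minkowski \<tau> ` I) \<longleftrightarrow>
    (\<exists>A. v = mk A \<and> elt A \<in> I \<and> A \<noteq> 0 \<and> (\<forall>B. elt B \<in> I \<longrightarrow> B \<noteq> 0 \<longrightarrow> trace_form A A \<le> trace_form B B))"
proof -
  have mem: "w \<in> minkowski \<tau> ` I - {0} \<longleftrightarrow> (\<exists>A. w = mk A \<and> elt A \<in> I \<and> A \<noteq> 0)" for w
  proof
    assume "w \<in> minkowski \<tau> ` I - {0}"
    then obtain x where x: "x \<in> I" "w = minkowski \<tau> x" "w \<noteq> 0" by blast
    obtain A where A: "x = elt A" using x(1) assms F_cases by blast
    have "A \<noteq> 0" using x(3) mk_eq_0_iff[of A] unfolding x(2) A by simp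
    then show "\<exists>A. w = mk A \<and> elt A \<in> I \<and> A \<noteq> 0" using x A by blast
  next
    assume "\<exists>A. w = mk A \<and> elt A \<in> I \<and> A \<noteq> 0"
    then obtain A where A: "w = mk A" "elt A \<in> I" "A \<noteq> 0" by blast
    have "w \<noteq> 0" unfolding A(1) mk_eq_0_iff by (rule A(3))
    moreover have "w \<in> minkowski \<tau> ` I" unfolding A(1) using A(2) by (rule imageI)
    ultimately show "w \<in> minkowski \<tau> ` I - {0}" by simp
  qed
  show ?thesis
  proof
    assume v: "v \<in> minimal_vectors (minkowski \<tau> ` I)"
    then have "v \<in> minkowski \<tau> ` I - {0}" unfolding minimal_vectors_def by simp
    then obtain A where A: "v = mk A" "elt A \<in> I" "A \<noteq> 0" unfolding mem by blast
    have "trace_form A A \<le> trace_form B B" if B: "elt B \<in> I" "B \<noteq> 0" for B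
    proof -
      have "mk B \<in> minkowski \<tau> ` I - {0}" unfolding mem using B by blast
      then have "norm v \<le> norm (mk B)" using v unfolding minimal_vectors_def by simp
      then show ?thesis unfolding A(1) mk_norm_le .
    qed
    with A show "\<exists>A. v = mk A \<and> elt A \<in> I \<and> A \<noteq> 0
        \<and> (\<forall>B. elt B \<in> I \<longrightarrow> B \<noteq> 0 \<longrightarrow> trace_form A A \<le> trace_form B B)" by blast
  next
    assume "\<exists>A. v = mk A \<and> elt A \<in> I \<and> A \<noteq> 0
        \<and> (\<forall>B. elt B \<in> I \<longrightarrow> B \<noteq> 0 \<longrightarrow> trace_form A A \<le> trace_form B B)"
    then obtain A where A: "v = mk A" "elt A \<in> I" "A \<noteq> 0"
      and le: "\<And>B. elt B \<in> I \<Longrightarrow> B \<noteq> 0 \<Longrightarrow> trace_form A A \<le> trace_form B B" by blast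
    have "v \<in> minkowski \<tau> ` I - {0}" unfolding mem using A by blast
    moreover have "norm v \<le> norm w" if w: "w \<in> minkowski \<tau> ` I - {0}" for w
    proof -
      obtain B where B: "w = mk B" "elt B \<in> I" "B \<noteq> 0" using w unfolding mem by blast
      show ?thesis unfolding A(1) B(1) mk_norm_le using B(2,3) by (rule le)
    qed
    ultimately show "v \<in> minimal_vectors (minkowski \<tau> ` I)" unfolding minimal_vectors_def by simp
  qed
qed

text \<open>
  Otherwise every minimal vector, and hence the span of the minimal vectors, would be orthogonal to
  \<open>u\<close>.
\<close>

lemma well_rounded_coordinate:
  assumes I: "I \<subseteq> F" and wr: "well_rounded (span (minkowski \<tau> ` F)) (minkowski \<tau> ` I)"
    and u: "u \<in> basis4"
  shows "\<exists>A. elt A \<in> I \<and> A \<noteq> 0 \<and> trace_form u A \<noteq> 0 \<and>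
    (\<forall>B. elt B \<in> I \<longrightarrow> B \<noteq> 0 \<longrightarrow> trace_form A A \<le> trace_form B B)"
proof (rule ccontr)
  assume neg: "\<not> ?thesis"
  let ?V = "span (minkowski \<tau> ` F)"
  obtain S where S: "S \<subseteq> minimal_vectors (minkowski \<tau> ` I)" "independent S" "card S = dim ?V"
    using wr unfolding well_rounded_def by blast
  have "minimal_vectors (minkowski \<tau> ` I) \<subseteq> minkowski \<tau> ` I"
    unfolding minimal_vectors_def by blast
  also have "\<dots> \<subseteq> minkowski \<tau> ` F" using I by (rule image_mono)
  also have "\<dots> \<subseteq> ?V" by (rule span_superset)
  finally have SV: "S \<subseteq> ?V" using S(1) by (rule subset_trans[rotated])
  have "?V \<subseteq> span S" by (rule card_ge_dim_independent[OF SV S(2)]) (simp only: S(3))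
  moreover have "mk u \<in> ?V" unfolding span_F using u by (intro span_base imageI)
  ultimately have "mk u \<in> span S" by (rule subsetD)
  have "real_inner_class.orthogonal (mk u) s" if "s \<in> S" for s
  proof -
    have "s \<in> minimal_vectors (minkowski \<tau> ` I)" using that S(1) by blast
    then obtain A where "s = mk A" "trace_form u A = 0" using neg unfolding minimal_vectors_mk[OF I]
        by blast
    then show ?thesis by (simp add: real_inner_class.orthogonal_def inner_mk)
  qed
  then have "real_inner_class.orthogonal (mk u) (mk u)"
    by (rule orthogonal_to_span[OF \<open>mk u \<in> span S\<close>])
  then show False using mk_eq_0_iff basis4_nonzero[OF u]
      by (simp add: real_inner_class.orthogonal_def)
qed

text \<open>
  The positive lower bound \<open>\<epsilon>\<close> for the form makes the image of \<open>I\<close> discrete; four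
  vectors spanning a space of dimension four are independent.
\<close>

lemma well_roundedI:
  assumes I: "I \<subseteq> F" "0 \<in> I" "\<And>x y. x \<in> I \<Longrightarrow> y \<in> I \<Longrightarrow> x - y \<in> I"
    and gap: "\<epsilon> > 0" "\<And>A. elt A \<in> I \<Longrightarrow> A \<noteq> 0 \<Longrightarrow> trace_form A A \<ge> \<epsilon>"
    and W: "finite W" "card W \<le> 4"
    and min: "\<And>A. A \<in> W \<Longrightarrow> elt A \<in> I \<and> A \<noteq> 0
        \<and> (\<forall>B. elt B \<in> I \<longrightarrow> B \<noteq> 0 \<longrightarrow> trace_form A A \<le> trace_form B B)"
    and gen: "mk ` basis4 \<subseteq> span (mk ` W)"
  shows "well_rounded (span (minkowski \<tau> ` F)) (minkowski \<tau> ` I)"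
proof -
  let ?V = "span (minkowski \<tau> ` F)" and ?L = "minkowski \<tau> ` I"
  have mk0: "mk 0 = 0" by (simp only: mk_eq_0_iff)
  have WL: "mk ` W \<subseteq> ?L" using min by blast
  have LV: "?L \<subseteq> ?V" using image_mono[OF I(1)] span_superset by (rule order_trans)
  have WV: "span (mk ` W) = ?V"
  proof
    show "span (mk ` W) \<subseteq> ?V" using WL LV by (intro span_minimal) auto
    show "?V \<subseteq> span (mk ` W)" unfolding span_F using gen by (intro span_minimal) auto
  qed
  have span: "span ?L = ?V"
  proof
    show "span ?L \<subseteq> ?V" using LV by (intro span_minimal) auto
    show "?V \<subseteq> span ?L" unfolding WV[symmetric] using WL by (rule span_mono)
  qed
  have diff: "s - t \<in> ?L" if st: "s \<in> ?L" "t \<in> ?L" for s t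
  proof -
    obtain x y where xy: "s = minkowski \<tau> x" "t = minkowski \<tau> y" "x \<in> I" "y \<in> I"
      using st by blast
    obtain A where A: "x = elt A" using xy(3) I(1) F_cases by blast
    obtain B where B: "y = elt B" using xy(4) I(1) F_cases by blast
    have AB: "s = mk A" "t = mk B" "elt A \<in> I" "elt B \<in> I" using xy by (simp_all only: A B)
    then have "elt (A - B) \<in> I" unfolding elt_diff using I(3) by blast
    then show ?thesis unfolding AB(1,2) mk_diff[symmetric] by (rule imageI)
  qed
  have "uniform_discrete ?L"
  proof (rule uniformI1)
    show "sqrt (of_rat (4 * \<epsilon>)) > 0" using gap(1) by simp
    fix s t assume st: "s \<in> ?L" "t \<in> ?L" "dist s t < sqrt (of_rat (4 * \<epsilon>))"
    obtain x where x: "x \<in> I" "s - t = minkowski \<tau> x" using diff[OF st(1,2)] by blast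
    then obtain A where A: "s - t = mk A" "elt A \<in> I" using I(1) F_cases by blast
    have "A = 0"
    proof (rule ccontr)
      assume "A \<noteq> 0"
      then have "trace_form A A \<ge> \<epsilon>" using gap(2) A(2) by blast
      then have "(of_rat (4 * \<epsilon>) :: real) \<le> of_rat (4 * trace_form A A)"
          by (simp only: of_rat_less_eq)
      then have "sqrt (of_rat (4 * \<epsilon>)) \<le> sqrt (inner (mk A) (mk A))"
          by (simp only: inner_mk real_sqrt_le_iff)
      also have "\<dots> = dist s t" by (simp only: dist_norm A(1) norm_eq_sqrt_inner)
      finally show False using st(3) by simp
    qed
    then have "s - t = 0" unfolding A(1) using mk0 by simp
    then show "s = t" by simp
  qed
  then have disc: "discrete ?L" by (rule uniform_discrete_imp_discrete)
  have "mk 0 \<in> ?L" unfolding elt_zero using I(2) by (rule imageI)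
  then have "0 \<in> ?L" unfolding mk0 .
  then have full: "full_rank_lattice ?V ?L"
    unfolding full_rank_lattice_def using diff disc span by blast
  have card: "card (mk ` W) \<le> dim ?V" unfolding dim_F using W card_image_le[OF W(1), of mk]
      by linarith
  have ind: "independent (mk ` W)"
  proof (rule card_le_dim_spanning[OF _ _ _ card])
    show "mk ` W \<subseteq> ?V" using WL LV by (rule subset_trans)
    show "?V \<subseteq> span (mk ` W)" unfolding WV ..
    show "finite (mk ` W)" using W(1) by (rule finite_imageI)
  qed
  have "dim ?V = card (mk ` W)" unfolding WV[symmetric]
      by (rule dim_span_eq_card_independent[OF ind])
  moreover have "mk ` W \<subseteq> minimal_vectors ?L" using min minimal_vectors_mk[OF I(1)] by blast
  ultimately show ?thesis unfolding well_rounded_def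
    using full ind by (intro conjI exI[of _ "mk ` W"]) simp_all
qed

end

lemma ex_bij_embeddings: "\<exists>\<tau> :: 4 \<Rightarrow> complex \<Rightarrow> complex. bij_betw \<tau> UNIV (embeddings F)"
proof -
  have "card (embeddings F) = 4" unfolding embeddings_eq using card_image[OF emb_inj] by simp
  moreover from this have "finite (embeddings F)" by (intro card_ge_0_finite) simp
  ultimately show ?thesis by (intro finite_same_card_bij) simp_all
qed

end

section \<open>Necessary conditions outside the quarter lattice\<close>

lemma one_le_square: "(z :: int) \<noteq> 0 \<Longrightarrow> 1 \<le> z\<^sup>2"
  by (simp add: int_one_le_iff_zero_less)

lemma four_le_square: "(z :: int) \<noteq> 0 \<Longrightarrow> even z \<Longrightarrow> 4 \<le> z\<^sup>2"
proof -
  assume "z \<noteq> 0" "even z"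
  then obtain k where k: "z = 2 * k" "k \<noteq> 0" by (auto elim!: evenE)
  then show ?thesis using one_le_square[of k] by (simp add: power_mult_distrib)
qed

lemma weighted_square_le: "B \<ge> 0 \<Longrightarrow> n \<le> z\<^sup>2 \<Longrightarrow> n * B \<le> B * z\<^sup>2" for B n z :: int
  by (simp add: mult_left_mono mult.commute)

text \<open>
  In the checkerboard lattice of vectors with even coordinate sum, a vector with \<open>z0 \<noteq> 0\<close>
  either has a second nonzero coordinate or \<open>\<bar>z0\<bar> \<ge> 2\<close>.
\<close>

lemma checkerboard_lower_bound:
  fixes B0 B1 B2 B3 z0 z1 z2 z3 :: int
  assumes B: "B0 \<ge> 0" "B1 \<ge> 0" "B2 \<ge> 0" "B3 \<ge> 0" and even: "even (z0 + z1 + z2 + z3)"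
      and z0: "z0 \<noteq> 0"
  shows "let Q = B0 * z0\<^sup>2 + B1 * z1\<^sup>2 + B2 * z2\<^sup>2 + B3 * z3\<^sup>2
    in B0 + B1 \<le> Q \<or> B0 + B2 \<le> Q \<or> B0 + B3 \<le> Q \<or> 4 * B0 \<le> Q"
proof -
  have nonneg: "0 \<le> B1 * z1\<^sup>2" "0 \<le> B2 * z2\<^sup>2" "0 \<le> B3 * z3\<^sup>2" using B by simp_all
  have 0: "B0 \<le> B0 * z0\<^sup>2" using weighted_square_le[OF B(1) one_le_square[OF z0]] by simp
  consider "z1 \<noteq> 0" | "z2 \<noteq> 0" | "z3 \<noteq> 0" | "z1 = 0" "z2 = 0" "z3 = 0" by blast
  then show ?thesis
  proof cases
    case 1
    then have "B1 \<le> B1 * z1\<^sup>2" using weighted_square_le[OF B(2) one_le_square] by fastforce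
    then show ?thesis using nonneg 0 by (simp add: Let_def)
  next
    case 2
    then have "B2 \<le> B2 * z2\<^sup>2" using weighted_square_le[OF B(3) one_le_square] by fastforce
    then show ?thesis using nonneg 0 by (simp add: Let_def)
  next
    case 3
    then have "B3 \<le> B3 * z3\<^sup>2" using weighted_square_le[OF B(4) one_le_square] by fastforce
    then show ?thesis using nonneg 0 by (simp add: Let_def)
  next
    case 4
    then have "even z0" using even by simp
    then have "4 * B0 \<le> B0 * z0\<^sup>2" using weighted_square_le[OF B(1) four_le_square[OF z0]] by simp
    then show ?thesis using nonneg 0 by (simp add: Let_def)
  qed
qed

context cyclic_quartic_data
begin

text \<open>
  The trace form on \<open>iquad X0 X1 X2 X3\<close>, multiplied by \<open>den\<^sup>2\<close>.
\<close>

definition norm_form :: "int \<Rightarrow> int \<Rightarrow> int \<Rightarrow> int \<Rightarrow> int" where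
  "norm_form X0 X1 X2 X3 = X0\<^sup>2 + d * X1\<^sup>2 + \<bar>a\<bar> * d * (X2\<^sup>2 + X3\<^sup>2)"

definition iquad :: "int \<Rightarrow> int \<Rightarrow> int \<Rightarrow> int \<Rightarrow> quad" where
  "iquad X0 X1 X2 X3 = (of_int X0 / of_int den, of_int X1 / of_int den,
     of_int X2 / of_int den, of_int X3 / of_int den)"

lemma elt_iquad: "elt (iquad X0 X1 X2 X3) = ielt X0 X1 X2 X3"
  by (simp only: ielt_def iquad_def)

lemma form_iquad: "trace_form (iquad X0 X1 X2 X3) (iquad X0 X1 X2 X3)
  = of_int (norm_form X0 X1 X2 X3) / (of_int den)\<^sup>2"
  unfolding iquad_def trace_form.simps norm_form_def
    by (simp add: power2_eq_square add_divide_distrib distrib_left)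

lemma form_iquad_le:
  "trace_form (iquad X0 X1 X2 X3) (iquad X0 X1 X2 X3)
      \<le> trace_form (iquad Y0 Y1 Y2 Y3) (iquad Y0 Y1 Y2 Y3)
    \<longleftrightarrow> norm_form X0 X1 X2 X3 \<le> norm_form Y0 Y1 Y2 Y3"
proof -
  have "(0 :: rat) < (of_int den)\<^sup>2" using den_nonzero by simp
  then show ?thesis unfolding form_iquad by (simp add: divide_le_cancel)
qed

lemma iquad_eq_0: "iquad X0 X1 X2 X3 = 0 \<longleftrightarrow> X0 = 0 \<and> X1 = 0 \<and> X2 = 0 \<and> X3 = 0"
  using den_nonzero by (simp add: iquad_def zero_prod_def)

definition mem_idl :: "int \<Rightarrow> int \<Rightarrow> int \<Rightarrow> int \<Rightarrow> int \<Rightarrow> int \<Rightarrow> bool" where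
  "mem_idl p q X0 X1 X2 X3 \<longleftrightarrow> elt (iquad X0 X1 X2 X3) \<in> idl p q"

lemma mem_idl_odd:
  assumes "odd d"
  shows "mem_idl p q X0 X1 X2 X3 \<longleftrightarrow> integral_coords a b c X0 X1 X2 X3 \<and> p * q dvd X0 \<and> q dvd X1"
proof -
  have "algebraic_int (ielt X0 X1 X2 X3) \<longleftrightarrow> integral_coords a b c X0 X1 X2 X3"
    using algebraic_int_iff_integral_coords[of X0 X1 X2 X3] assms
    by (simp add: ielt_def den_def del: elt.simps)
  moreover have "ielt X0 X1 X2 X3 \<in> F" unfolding elt_iquad[symmetric] by (rule elt_in_F)
  ultimately show ?thesis
    unfolding mem_idl_def elt_iquad idl_def by (simp add: OF_carrier c0_ielt c1_ielt)
qed

lemma mem_idl_even: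
  assumes "even d"
  shows "mem_idl p q X0 X1 X2 X3 \<longleftrightarrow> p * q dvd X0 \<and> q dvd X1"
proof -
  have "ielt X0 X1 X2 X3 = elt (of_int X0, of_int X1, of_int X2, of_int X3)"
    using assms by (simp add: ielt_def den_def)
  then have "ielt X0 X1 X2 X3 \<in> carrier OF" using elt_of_int_carrier by simp
  then show ?thesis unfolding mem_idl_def elt_iquad idl_def by (simp add: c0_ielt c1_ielt)
qed

lemma idl_subset_F: "idl p q \<subseteq> F"
  by (auto simp: idl_def OF_carrier)

lemma idl_iquad:
  assumes "elt A \<in> idl p q"
  obtains X0 X1 X2 X3 where "A = iquad X0 X1 X2 X3" "mem_idl p q X0 X1 X2 X3"
proof -
  have "elt A \<in> carrier OF" using assms by (simp add: idl_def del: elt.simps)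
  then obtain X0 X1 X2 X3 where "elt A = ielt X0 X1 X2 X3" by (rule OF_ielt)
  then have A: "A = iquad X0 X1 X2 X3" unfolding elt_iquad[symmetric] elt_inject .
  have "mem_idl p q X0 X1 X2 X3" unfolding mem_idl_def using assms unfolding A .
  with A show ?thesis by (rule that)
qed

definition lower_bound :: "int \<Rightarrow> int \<Rightarrow> int \<Rightarrow> bool" where
  "lower_bound p q \<mu> \<longleftrightarrow> (\<forall>Y0 Y1 Y2 Y3. mem_idl p q Y0 Y1 Y2 Y3 \<longrightarrow>
     \<not> (Y0 = 0 \<and> Y1 = 0 \<and> Y2 = 0 \<and> Y3 = 0) \<longrightarrow> \<mu> \<le> norm_form Y0 Y1 Y2 Y3)"

text \<open>
  Minimal vectors in different directions share the value \<open>\<mu>\<close> of the form.  The third and the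
  fourth coordinate have the same weight, so three directions capture all weights.
\<close>

lemma well_rounded_minimal_vectors:
  assumes "well_rounded_quartic_ideal F (idl p q)"
  shows "\<exists>\<mu>. lower_bound p q \<mu>
    \<and> (\<exists>X0 X1 X2 X3. mem_idl p q X0 X1 X2 X3 \<and> norm_form X0 X1 X2 X3 = \<mu> \<and> X0 \<noteq> 0)
    \<and> (\<exists>X0 X1 X2 X3. mem_idl p q X0 X1 X2 X3 \<and> norm_form X0 X1 X2 X3 = \<mu> \<and> X1 \<noteq> 0)
    \<and> (\<exists>X0 X1 X2 X3. mem_idl p q X0 X1 X2 X3 \<and> norm_form X0 X1 X2 X3 = \<mu> \<and> X2 \<noteq> 0)"
proof -
  obtain \<tau> :: "4 \<Rightarrow> complex \<Rightarrow> complex" where bij: "bij_betw \<tau> UNIV (embeddings F)"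
    and wr: "well_rounded (span (minkowski \<tau> ` F)) (minkowski \<tau> ` idl p q)"
    using assms unfolding well_rounded_quartic_ideal_def by blast
  have ex: "\<exists>X0 X1 X2 X3. mem_idl p q X0 X1 X2 X3 \<and> trace_form u (iquad X0 X1 X2 X3) \<noteq> 0 \<and>
      \<not> (X0 = 0 \<and> X1 = 0 \<and> X2 = 0 \<and> X3 = 0) \<and>
      (\<forall>Y0 Y1 Y2 Y3. mem_idl p q Y0 Y1 Y2 Y3 \<longrightarrow> \<not> (Y0 = 0 \<and> Y1 = 0 \<and> Y2 = 0 \<and> Y3 = 0)
        \<longrightarrow> norm_form X0 X1 X2 X3 \<le> norm_form Y0 Y1 Y2 Y3)" if u: "u \<in> basis4" for u
  proof -
    obtain A where A: "elt A \<in> idl p q" "A \<noteq> 0" "trace_form u A \<noteq> 0"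
      and min: "\<forall>B. elt B \<in> idl p q \<longrightarrow> B \<noteq> 0 \<longrightarrow> trace_form A A \<le> trace_form B B"
      using well_rounded_coordinate[OF bij idl_subset_F wr u] by blast
    obtain X0 X1 X2 X3 where iqA: "A = iquad X0 X1 X2 X3" and mem_idl: "mem_idl p q X0 X1 X2 X3"
      using A(1) by (rule idl_iquad)
    have "norm_form X0 X1 X2 X3 \<le> norm_form Y0 Y1 Y2 Y3"
      if "mem_idl p q Y0 Y1 Y2 Y3" "\<not> (Y0 = 0 \<and> Y1 = 0 \<and> Y2 = 0 \<and> Y3 = 0)" for Y0 Y1 Y2 Y3
      using min[rule_format, of "iquad Y0 Y1 Y2 Y3"] that
        unfolding iqA mem_idl_def iquad_eq_0 form_iquad_le by blast
    then show ?thesis using mem_idl A(2,3) unfolding iqA iquad_eq_0 by blast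
  qed
  have coord: "X0 = 0 \<Longrightarrow> trace_form (1, 0, 0, 0) (iquad X0 X1 X2 X3) = 0"
    "X1 = 0 \<Longrightarrow> trace_form (0, 1, 0, 0) (iquad X0 X1 X2 X3) = 0"
    "X2 = 0 \<Longrightarrow> trace_form (0, 0, 1, 0) (iquad X0 X1 X2 X3) = 0" for X0 X1 X2 X3
    by (simp_all add: iquad_def)
  have u: "(1, 0, 0, 0) \<in> basis4" "(0, 1, 0, 0) \<in> basis4" "(0, 0, 1, 0) \<in> basis4"
    by (simp_all add: basis4_def)
  obtain V0 V1 V2 V3 where V: "mem_idl p q V0 V1 V2 V3" "V0 \<noteq> 0"
    "\<And>Y0 Y1 Y2 Y3. mem_idl p q Y0 Y1 Y2 Y3 \<Longrightarrow> \<not> (Y0 = 0 \<and> Y1 = 0 \<and> Y2 = 0 \<and> Y3 = 0)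
      \<Longrightarrow> norm_form V0 V1 V2 V3 \<le> norm_form Y0 Y1 Y2 Y3"
    using ex[OF u(1)] coord(1) by blast
  obtain W0 W1 W2 W3 where W: "mem_idl p q W0 W1 W2 W3" "W1 \<noteq> 0"
    "\<And>Y0 Y1 Y2 Y3. mem_idl p q Y0 Y1 Y2 Y3 \<Longrightarrow> \<not> (Y0 = 0 \<and> Y1 = 0 \<and> Y2 = 0 \<and> Y3 = 0)
      \<Longrightarrow> norm_form W0 W1 W2 W3 \<le> norm_form Y0 Y1 Y2 Y3"
    using ex[OF u(2)] coord(2) by blast
  obtain Z0 Z1 Z2 Z3 where Z: "mem_idl p q Z0 Z1 Z2 Z3" "Z2 \<noteq> 0"
    "\<And>Y0 Y1 Y2 Y3. mem_idl p q Y0 Y1 Y2 Y3 \<Longrightarrow> \<not> (Y0 = 0 \<and> Y1 = 0 \<and> Y2 = 0 \<and> Y3 = 0)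
      \<Longrightarrow> norm_form Z0 Z1 Z2 Z3 \<le> norm_form Y0 Y1 Y2 Y3"
    using ex[OF u(3)] coord(3) by blast
  have "norm_form W0 W1 W2 W3 = norm_form V0 V1 V2 V3"
      "norm_form Z0 Z1 Z2 Z3 = norm_form V0 V1 V2 V3"
    using V(3)[OF W(1)] V(3)[OF Z(1)] W(3)[OF V(1)] Z(3)[OF V(1)] V(2) W(2) Z(2) by linarith+
  moreover have "lower_bound p q (norm_form V0 V1 V2 V3)" unfolding lower_bound_def using V(3)
      by blast
  ultimately show ?thesis using V(1,2) W(1,2) Z(1,2) by blast
qed

lemma square_ne_d: "p\<^sup>2 \<noteq> d"
proof
  assume "p\<^sup>2 = d"
  then have "p\<^sup>2 dvd d" by simp
  then have "p dvd 1" by (rule squarefreeD[OF squarefree_d])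
  then have "\<bar>p\<bar> = 1" by simp
  then have "p\<^sup>2 = 1" using power2_abs[of p] by simp
  then show False using \<open>p\<^sup>2 = d\<close> d_ge_2 by simp
qed

text \<open>
  Here the coordinates of \<open>idl p q\<close> range independently over multiples of \<open>p q\<close>,
  multiples of \<open>q\<close>, \<open>\<int>\<close> and \<open>\<int>\<close>.  Minimal vectors with nonzero first and
  second coordinates give \<open>p\<^sup>2 q\<^sup>2 = d q\<^sup>2\<close>, but \<open>d\<close> is not a square.
\<close>

lemma not_well_rounded_d_even:
  assumes d: "even d" and pq: "p \<ge> 1" "q \<ge> 1"
  shows "\<not> well_rounded_quartic_ideal F (idl p q)"
proof
  assume "well_rounded_quartic_ideal F (idl p q)"
  then obtain \<mu> where low: "lower_bound p q \<mu>"
    and e0: "\<exists>X0 X1 X2 X3. mem_idl p q X0 X1 X2 X3 \<and> norm_form X0 X1 X2 X3 = \<mu> \<and> X0 \<noteq> 0"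
    and e1: "\<exists>X0 X1 X2 X3. mem_idl p q X0 X1 X2 X3 \<and> norm_form X0 X1 X2 X3 = \<mu> \<and> X1 \<noteq> 0"
    using well_rounded_minimal_vectors by blast
  have nonneg: "0 \<le> \<bar>a\<bar> * d * (x\<^sup>2 + y\<^sup>2)" "0 \<le> d * x\<^sup>2" for x y using d_ge_2 by simp_all
  have "\<mu> \<le> norm_form (p * q) 0 0 0" "\<mu> \<le> norm_form 0 q 0 0"
    using pq by (intro low[unfolded lower_bound_def, rule_format]; simp add: mem_idl_even[OF d])+
  then have up: "\<mu> \<le> (p * q)\<^sup>2" "\<mu> \<le> d * q\<^sup>2" by (simp_all add: norm_form_def)
  obtain X0 X1 X2 X3 where X: "mem_idl p q X0 X1 X2 X3" "norm_form X0 X1 X2 X3 = \<mu>" "X0 \<noteq> 0"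
      using e0 by blast
  obtain k where k: "X0 = p * q * k" using X(1) unfolding mem_idl_even[OF d] by (auto elim: dvdE)
  have "(p * q)\<^sup>2 * 1 \<le> (p * q)\<^sup>2 * k\<^sup>2"
    using X(3) k by (intro mult_left_mono one_le_square) auto
  then have 1: "(p * q)\<^sup>2 \<le> \<mu>"
    using X(2) nonneg(1)[of X2 X3] nonneg(2)[of X1] unfolding norm_form_def k power_mult_distrib
      by linarith
  obtain Y0 Y1 Y2 Y3 where Y: "mem_idl p q Y0 Y1 Y2 Y3" "norm_form Y0 Y1 Y2 Y3 = \<mu>" "Y1 \<noteq> 0"
      using e1 by blast
  obtain l where l: "Y1 = q * l" using Y(1) unfolding mem_idl_even[OF d] by (auto elim: dvdE)
  have "d * q\<^sup>2 * 1 \<le> d * q\<^sup>2 * l\<^sup>2"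
    using Y(3) l d_ge_2 by (intro mult_left_mono one_le_square) auto
  then have 2: "d * q\<^sup>2 \<le> \<mu>"
    using Y(2) nonneg(1)[of Y2 Y3] zero_le_power2[of Y0]
      unfolding norm_form_def l power_mult_distrib by linarith
  have "p\<^sup>2 * q\<^sup>2 = d * q\<^sup>2"
    using up 1 2 unfolding power_mult_distrib by linarith
  moreover have "q\<^sup>2 \<noteq> 0" using pq(2) by simp
  ultimately have "p\<^sup>2 = d" using mult_right_cancel by blast
  then show False using square_ne_d by blast
qed

text \<open>
  For \<open>d = p e\<close> the equation shows that \<open>e\<close> divides \<open>q\<^sup>2 (p + e)\<close>, hence
  \<open>p\<close>, so \<open>e = 1\<close> because \<open>d\<close> is squarefree.  Then \<open>d\<^sup>2 \<le> 3 d\<close>, while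
  \<open>d\<close>, being 1 modulo 4, is at least 5.
\<close>

lemma weights_not_proportional:
  assumes p: "p dvd d" "p \<ge> 1" and q: "q dvd a" "q \<ge> 1"
    and eq: "q\<^sup>2 * (p\<^sup>2 + d) = k * \<bar>a\<bar> * d" and le: "p\<^sup>2 \<le> 3 * d" and d: "odd d"
  shows False
proof -
  obtain e where e: "d = p * e" using p(1) by (rule dvdE)
  have "p * (q\<^sup>2 * (p + e)) = p * (k * \<bar>a\<bar> * e)"
    using eq unfolding e by (simp add: power2_eq_square algebra_simps)
  then have "q\<^sup>2 * (p + e) = k * \<bar>a\<bar> * e" using p(2) by simp
  then have dvd: "e dvd q\<^sup>2 * (p + e)" by simp
  have "coprime d a" using gcd_ad by (simp add: coprime_iff_gcd_eq_1 gcd.commute)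
  then have "coprime e q" using q(1) unfolding e by (meson coprime_divisors dvd_triv_right)
  then have "e dvd p + e" using dvd by (simp add: coprime_dvd_mult_right_iff)
  then have "e dvd p" by simp
  then have "e\<^sup>2 dvd d" unfolding e power2_eq_square by (simp add: mult_dvd_mono)
  then have "e dvd 1" by (rule squarefreeD[OF squarefree_d])
  have "0 < p * e" "0 < p" using e d_ge_2 p(2) by linarith+
  then have "e > 0" by (rule zero_less_mult_pos)
  with \<open>e dvd 1\<close> have "e = 1" by simp
  then have dp: "d = p" using e by simp
  then have "d * d \<le> 3 * d" using le by (simp add: power2_eq_square)
  then have "d \<le> 3" using d_ge_2 by simp
  moreover obtain m where "d = 4 * m + 1" using d_mod4_odd[OF d] .
  ultimately show False using d_ge_2 by presburger
qed

lemma lower_boundD: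
  "lower_bound p q \<mu> \<Longrightarrow> mem_idl p q Y0 Y1 Y2 Y3 \<Longrightarrow> \<not> (Y0 = 0 \<and> Y1 = 0 \<and> Y2 = 0 \<and> Y3 = 0)
    \<Longrightarrow> \<mu> \<le> norm_form Y0 Y1 Y2 Y3"
  unfolding lower_bound_def by blast

lemma odd_pq: "odd d \<Longrightarrow> p dvd d \<Longrightarrow> q dvd a \<Longrightarrow> odd p \<and> odd q"
  using odd_a by (meson dvd_trans)

lemma norm_form_scaled:
  "norm_form (2 * (p * q * z0)) (2 * (q * z1)) (2 * z2) (2 * z3)
    = 4 * (p\<^sup>2 * q\<^sup>2 * z0\<^sup>2 + q\<^sup>2 * d * z1\<^sup>2 + \<bar>a\<bar> * d * z2\<^sup>2 + \<bar>a\<bar> * d * z3\<^sup>2)"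
  by (simp add: norm_form_def power2_eq_square algebra_simps)

lemma two_mult_dvd: "odd n \<Longrightarrow> even x \<Longrightarrow> n dvd x \<Longrightarrow> \<exists>k. x = 2 * (n * k)" for n x :: int
proof -
  assume n: "odd n" and x: "even x" "n dvd x"
  obtain j where j: "x = n * j" using x(2) by (rule dvdE)
  then have "even j" using n x(1) by simp
  then obtain k where "j = 2 * k" by (rule evenE)
  then show ?thesis using j by (intro exI[of _ k]) simp
qed

text \<open>
  In doubled coordinates the lattice is the orthogonal sum of the plane checkerboard lattice with
  weights \<open>A0, A1\<close> and of a plane lattice with weights \<open>A2, A2\<close>.  Because \<open>A0\<close> and
  \<open>A1\<close> differ, the first summand contributes minimal vectors in both of its directions only if the
  minimum is \<open>A0 + A1\<close>; the second summand has minimum \<open>\<kappa> A2\<close>.  Equality of the two is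
  excluded by \<open>weights_not_proportional\<close>.
\<close>

lemma not_well_rounded_half:
  assumes d: "odd d" and p: "p dvd d" "p \<ge> 1" and q: "q dvd a" "q \<ge> 1"
    and not4: "\<not> (even b \<and> [a + b = 1] (mod 4))"
  shows "\<not> well_rounded_quartic_ideal F (idl p q)"
proof
  assume "well_rounded_quartic_ideal F (idl p q)"
  then obtain \<mu> where low: "lower_bound p q \<mu>"
    and e0: "\<exists>X0 X1 X2 X3. mem_idl p q X0 X1 X2 X3 \<and> norm_form X0 X1 X2 X3 = \<mu> \<and> X0 \<noteq> 0"
    and e1: "\<exists>X0 X1 X2 X3. mem_idl p q X0 X1 X2 X3 \<and> norm_form X0 X1 X2 X3 = \<mu> \<and> X1 \<noteq> 0"
    and e2: "\<exists>X0 X1 X2 X3. mem_idl p q X0 X1 X2 X3 \<and> norm_form X0 X1 X2 X3 = \<mu> \<and> X2 \<noteq> 0"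
    using well_rounded_minimal_vectors by blast
  have pq_odd: "odd p" "odd q" using odd_pq[OF d p(1) q(1)] by auto
  define A0 where "A0 = p\<^sup>2 * q\<^sup>2"
  define A1 where "A1 = q\<^sup>2 * d"
  define A2 where "A2 = \<bar>a\<bar> * d"
  note A = A0_def A1_def A2_def
  have pos: "A0 > 0" "A1 > 0" "A2 > 0" using p q d_ge_2 a_nonzero by (simp_all add: A)
  have A01: "A0 \<noteq> A1"
  proof
    assume "A0 = A1"
    then have "q\<^sup>2 * p\<^sup>2 = q\<^sup>2 * d" by (simp add: A mult.commute)
    moreover have "q\<^sup>2 \<noteq> 0" using q(2) by simp
    ultimately show False using mult_left_cancel square_ne_d by blast
  qed
  define \<kappa> :: int where "\<kappa> = (if odd b then 4 else 2)"
  have norm_form: "norm_form (2 * (p * q * z0)) (2 * (q * z1)) (2 * z2) (2 * z3)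
      = 4 * (A0 * z0\<^sup>2 + A1 * z1\<^sup>2 + A2 * z2\<^sup>2 + A2 * z3\<^sup>2)" for z0 z1 z2 z3
    by (simp add: norm_form_scaled A)
  have mem_idl: "mem_idl p q X0 X1 X2 X3 \<longleftrightarrow> p * q dvd X0 \<and> q dvd X1 \<and> even X0 \<and> 4 dvd X0 - X1
      \<and> (if odd b then 4 dvd X2 \<and> 4 dvd X3 else even X2 \<and> 4 dvd X2 - X3)" for X0 X1 X2 X3
    unfolding mem_idl_odd[OF d] integral_coords_def using d d_odd_iff not4 by auto
  have four: "4 dvd 2 * x \<longleftrightarrow> even x" for x :: int by presburger
  have even4: "4 dvd x \<Longrightarrow> even x" for x :: int by presburger
  have scaled: "mem_idl p q (2 * (p * q * z0)) (2 * (q * z1)) (2 * z2) (2 * z3)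
      \<longleftrightarrow> even (z0 + z1) \<and> even (z2 + z3) \<and> (odd b \<longrightarrow> even z2)" for z0 z1 z2 z3
  proof -
    have "2 * (p * q * z0) - 2 * (q * z1) = 2 * (p * q * z0 - q * z1)" by simp
    then have 1: "4 dvd 2 * (p * q * z0) - 2 * (q * z1) \<longleftrightarrow> even (p * q * z0 - q * z1)"
        by (simp only: four)
    have "2 * z2 - 2 * z3 = 2 * (z2 - z3)" by simp
    then have 2: "4 dvd 2 * z2 - 2 * z3 \<longleftrightarrow> even (z2 - z3)" by (simp only: four)
    have 3: "p * q dvd 2 * (p * q * z0)" "q dvd 2 * (q * z1)" "even (2 * (p * q * z0))"
        "even (2 * z2)"
      by (simp_all add: dvd_mult)
    show ?thesis unfolding mem_idl 1 2 four using 3 pq_odd by auto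
  qed
  have struct: "\<exists>z0 z1 z2 z3. X0 = 2 * (p * q * z0) \<and> X1 = 2 * (q * z1) \<and> X2 = 2 * z2 \<and> X3 = 2 * z3
      \<and> even (z0 + z1) \<and> even (z2 + z3) \<and> (odd b \<longrightarrow> even z2)"
    if L: "mem_idl p q X0 X1 X2 X3" for X0 X1 X2 X3
  proof -
    have L': "p * q dvd X0" "q dvd X1" "even X0" "4 dvd X0 - X1" "even X2" "even (X2 - X3)"
      using L unfolding mem_idl by (auto split: if_splits dest: even4)
    have "odd (p * q)" using pq_odd by simp
    then obtain z0 where z0: "X0 = 2 * (p * q * z0)" using two_mult_dvd L'(1,3) by blast
    have "even X1" using even4[OF L'(4)] L'(3) by simp
    then obtain z1 where z1: "X1 = 2 * (q * z1)" using two_mult_dvd[OF pq_odd(2)] L'(2) by blast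
    have "even X3" using L'(5,6) by simp
    then obtain z2 z3 where z23: "X2 = 2 * z2" "X3 = 2 * z3" using L'(5) by (auto elim!: evenE)
    show ?thesis using L z0 z1 z23 scaled[of z0 z1 z2 z3] by blast
  qed
  have minimal: "\<exists>z0 z1 z2 z3. \<mu> = 4 * (A0 * z0\<^sup>2 + A1 * z1\<^sup>2 + A2 * z2\<^sup>2 + A2 * z3\<^sup>2)
      \<and> even (z0 + z1) \<and> even (z2 + z3) \<and> (odd b \<longrightarrow> even z2)
      \<and> (X0 \<noteq> 0 \<longrightarrow> z0 \<noteq> 0) \<and> (X1 \<noteq> 0 \<longrightarrow> z1 \<noteq> 0) \<and> (X2 \<noteq> 0 \<longrightarrow> z2 \<noteq> 0)"
    if L: "mem_idl p q X0 X1 X2 X3" "norm_form X0 X1 X2 X3 = \<mu>" for X0 X1 X2 X3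
  proof -
    obtain z0 z1 z2 z3 where z: "X0 = 2 * (p * q * z0)" "X1 = 2 * (q * z1)" "X2 = 2 * z2"
        "X3 = 2 * z3"
      "even (z0 + z1)" "even (z2 + z3) \<and> (odd b \<longrightarrow> even z2)"
      using struct[OF L(1)] by blast
    have "\<mu> = 4 * (A0 * z0\<^sup>2 + A1 * z1\<^sup>2 + A2 * z2\<^sup>2 + A2 * z3\<^sup>2)" using L(2) unfolding z(1-4) norm_form
        by simp
    moreover have "(X0 \<noteq> 0 \<longrightarrow> z0 \<noteq> 0) \<and> (X1 \<noteq> 0 \<longrightarrow> z1 \<noteq> 0) \<and> (X2 \<noteq> 0 \<longrightarrow> z2 \<noteq> 0)"
      unfolding z(1-4) by simp
    ultimately show ?thesis using z(5,6) by blast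
  qed
  obtain \<nu> where \<nu>: "\<mu> = 4 * \<nu>" using e0 minimal by blast
  have \<mu>_le: "\<nu> \<le> A0 * z0\<^sup>2 + A1 * z1\<^sup>2 + A2 * z2\<^sup>2 + A2 * z3\<^sup>2"
    if z: "even (z0 + z1)" "even (z2 + z3) \<and> (odd b \<longrightarrow> even z2)"
      "\<not> (z0 = 0 \<and> z1 = 0 \<and> z2 = 0 \<and> z3 = 0)" for z0 z1 z2 z3
  proof -
    have "mem_idl p q (2 * (p * q * z0)) (2 * (q * z1)) (2 * z2) (2 * z3)" unfolding scaled using z
        by auto
    moreover have "\<not> (2 * (p * q * z0) = 0 \<and> 2 * (q * z1) = 0 \<and> 2 * z2 = 0 \<and> 2 * z3 = 0)"
      using z(3) p(2) q(2) by auto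
    ultimately have "\<mu> \<le> norm_form (2 * (p * q * z0)) (2 * (q * z1)) (2 * z2) (2 * z3)"
        by (rule lower_boundD[OF low])
    then show ?thesis unfolding \<nu> norm_form by simp
  qed
  have up1: "\<nu> \<le> A0 + A1" using \<mu>_le[of 1 1 0 0] by simp
  have up2: "\<nu> \<le> 4 * A0" using \<mu>_le[of 2 0 0 0] by simp
  have up3: "\<nu> \<le> 4 * A1" using \<mu>_le[of 0 2 0 0] by simp
  have up4: "\<nu> \<le> \<kappa> * A2" using \<mu>_le[of 0 0 2 0] \<mu>_le[of 0 0 1 1] by (simp add: \<kappa>_def)
  have four_times: "4 * B \<le> B * z\<^sup>2" if "B > 0" "z \<noteq> 0" "even z" for B z :: int
    using weighted_square_le[of B 4 z] four_le_square[OF that(2,3)] that(1) by simp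
  have one_times: "B \<le> B * z\<^sup>2" if "B > 0" "z \<noteq> 0" for B z :: int
    using weighted_square_le[of B 1 z] one_le_square[OF that(2)] that(1) by simp
  have nonneg: "0 \<le> A0 * z\<^sup>2" "0 \<le> A1 * z\<^sup>2" "0 \<le> A2 * z\<^sup>2" for z using pos by simp_all
  have c0: "A0 + A1 \<le> \<nu> \<or> 4 * A0 \<le> \<nu>"
  proof -
    obtain z0 z1 z2 z3 where z: "\<mu> = 4 * (A0 * z0\<^sup>2 + A1 * z1\<^sup>2 + A2 * z2\<^sup>2 + A2 * z3\<^sup>2)" "z0 \<noteq> 0"
        "even (z0 + z1)"
      using e0 minimal by blast
    show ?thesis
    proof (cases "z1 = 0")
      case True
      then show ?thesis
        using four_times[OF pos(1) z(2)] z(1,3) nonneg(2)[of z1] nonneg(3)[of z2] nonneg(3)[of z3]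
          unfolding \<nu> by simp
    next
      case False
      then show ?thesis
        using one_times[OF pos(1) z(2)] one_times[OF pos(2) False] z(1) nonneg(3)[of z2]
          nonneg(3)[of z3]
        unfolding \<nu> by simp
    qed
  qed
  have c1: "A0 + A1 \<le> \<nu> \<or> 4 * A1 \<le> \<nu>"
  proof -
    obtain z0 z1 z2 z3 where z: "\<mu> = 4 * (A0 * z0\<^sup>2 + A1 * z1\<^sup>2 + A2 * z2\<^sup>2 + A2 * z3\<^sup>2)" "z1 \<noteq> 0"
        "even (z0 + z1)"
      using e1 minimal by blast
    show ?thesis
    proof (cases "z0 = 0")
      case True
      then show ?thesis
        using four_times[OF pos(2) z(2)] z(1,3) nonneg(1)[of z0] nonneg(3)[of z2] nonneg(3)[of z3]
          unfolding \<nu> by simp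
    next
      case False
      then show ?thesis
        using one_times[OF pos(2) z(2)] one_times[OF pos(1) False] z(1) nonneg(3)[of z2]
          nonneg(3)[of z3]
        unfolding \<nu> by simp
    qed
  qed
  have c2: "\<kappa> * A2 \<le> \<nu>"
  proof -
    obtain z0 z1 z2 z3 where z: "\<mu> = 4 * (A0 * z0\<^sup>2 + A1 * z1\<^sup>2 + A2 * z2\<^sup>2 + A2 * z3\<^sup>2)" "z2 \<noteq> 0"
        "even (z2 + z3) \<and> (odd b \<longrightarrow> even z2)"
      using e2 minimal by blast
    have "\<kappa> * A2 \<le> A2 * z2\<^sup>2 + A2 * z3\<^sup>2"
    proof (cases "even z2")
      case True
      have "\<kappa> * A2 \<le> 4 * A2" using pos(3) by (intro mult_right_mono) (simp_all add: \<kappa>_def)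
      then show ?thesis using four_times[OF pos(3) z(2) True] nonneg(3)[of z3] by linarith
    next
      case False
      then have b: "even b" "z3 \<noteq> 0" using z(3) by auto
      then show ?thesis
        using one_times[OF pos(3) z(2)] one_times[OF pos(3) b(2)] by (simp add: \<kappa>_def)
    qed
    then show ?thesis using z(1) nonneg(1)[of z0] nonneg(2)[of z1] unfolding \<nu> by simp
  qed
  have "A0 + A1 = \<nu>" using c0 c1 up1 up2 up3 A01 by linarith
  then have "A0 + A1 = \<kappa> * A2" "A0 + A1 \<le> 4 * A1" using c2 up4 up3 by linarith+
  then have "q\<^sup>2 * (p\<^sup>2 + d) = \<kappa> * \<bar>a\<bar> * d" and le: "q\<^sup>2 * p\<^sup>2 \<le> q\<^sup>2 * (3 * d)"
    by (simp_all add: A algebra_simps)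
  moreover have "p\<^sup>2 \<le> 3 * d" using le q(2) by (simp add: mult_le_cancel_left_pos)
  ultimately show False using weights_not_proportional[OF p q] d by blast
qed

end

section \<open>The quarter lattice\<close>

text \<open>
  The numbers \<open>\<nu>\<close> bounded as here are the minima of the checkerboard lattice with weights
  \<open>A0, A1, A2, A2\<close>, attained by vectors with nonzero coordinates in all directions.  In the
  direction of the larger one of \<open>A0\<close> and \<open>A1\<close>, the bounds leave only
  \<open>\<nu> = A0 + A1\<close>; in the direction of \<open>A2\<close>, they then give \<open>2 A2 \<le> \<nu>\<close> or
  that \<open>A2\<close> is that larger weight.
\<close>

lemma quarter_minimum_inequality:
  fixes A0 A1 A2 \<nu> :: int
  assumes pos: "A0 > 0" "A1 > 0" "A2 > 0" and ne: "A0 \<noteq> A1"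
    and up: "\<nu> \<le> A0 + A1" "\<nu> \<le> A0 + A2" "\<nu> \<le> A1 + A2" "\<nu> \<le> 2 * A2" "\<nu> \<le> 4 * A0" "\<nu> \<le> 4 * A1"
    and c0: "A0 + A1 \<le> \<nu> \<or> A0 + A2 \<le> \<nu> \<or> 4 * A0 \<le> \<nu>"
    and c1: "A1 + A0 \<le> \<nu> \<or> A1 + A2 \<le> \<nu> \<or> 4 * A1 \<le> \<nu>"
    and c2: "A2 + A0 \<le> \<nu> \<or> A2 + A1 \<le> \<nu> \<or> 2 * A2 \<le> \<nu> \<or> 4 * A2 \<le> \<nu>"
  shows "A0 + A1 + 2 * A2 \<le> 4 * \<nu>"
proof (rule ccontr)
  assume "\<not> ?thesis"
  then have less: "4 * \<nu> < A0 + A1 + 2 * A2" by simp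
  have "A0 < A1 \<or> A1 < A0" using ne by linarith
  then show False using c0 c1 c2 by (elim disjE) (use pos up less in linarith)+
qed

text \<open>
  The four sign patterns are the rows of a Hadamard matrix, which is inverted by its transpose.
\<close>

lemma hadamard_combinations:
  fixes u0 u1 u2 u3 :: "'a :: ab_group_add"
  assumes "m1 = u0 + u1 + u2 + u3" "m2 = u0 + u1 - u2 - u3" "m3 = u0 - u1 + u2 - u3"
      "m4 = u0 - u1 - u2 + u3"
  shows "m1 + m2 + m3 + m4 = u0 + u0 + u0 + u0" "m1 + m2 - m3 - m4 = u1 + u1 + u1 + u1"
    "m1 - m2 + m3 - m4 = u2 + u2 + u2 + u2" "m1 - m2 - m3 + m4 = u3 + u3 + u3 + u3"
  unfolding assms by (simp_all add: algebra_simps)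

lemma in_span_of_quadruple:
  fixes e :: "'a :: real_vector"
  assumes "(r / 4) *\<^sub>R e + (r / 4) *\<^sub>R e + (r / 4) *\<^sub>R e + (r / 4) *\<^sub>R e \<in> span M" "r \<noteq> 0"
  shows "e \<in> span M"
proof -
  have "(r / 4) *\<^sub>R e + (r / 4) *\<^sub>R e + (r / 4) *\<^sub>R e + (r / 4) *\<^sub>R e
      = (r / 4 + r / 4 + r / 4 + r / 4) *\<^sub>R e"
    by (simp only: scaleR_add_left)
  also have "\<dots> = r *\<^sub>R e" by simp
  finally have "r *\<^sub>R e \<in> span M" using assms(1) by (simp only:)
  then have "(1 / r) *\<^sub>R (r *\<^sub>R e) \<in> span M" by (rule span_scale)
  then show ?thesis using assms(2) by simp
qed

lemma le_Min_six_iff: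
  "x \<le> Min {m1, m2, m3, m4, m5, m6 :: int} \<longleftrightarrow>
    x \<le> m1 \<and> x \<le> m2 \<and> x \<le> m3 \<and> x \<le> m4 \<and> x \<le> m5 \<and> x \<le> m6"
  by (subst Min_ge_iff) (simp_all only: finite_insert finite.emptyI insert_not_empty
    not_False_eq_True ball_simps simp_thms)

lemma four_dvd_add_unit_multiple:
  fixes n r :: int
  assumes "odd n" "odd r"
  shows "\<exists>\<eta>. (\<eta> = 1 \<or> \<eta> = - 1) \<and> 4 dvd r + n * \<eta>"
proof -
  have "4 dvd r + n \<or> 4 dvd r - n" using assms by presburger
  then show ?thesis
  proof
    assume "4 dvd r + n"
    then show ?thesis by (intro exI[of _ 1]) simp
  next
    assume "4 dvd r - n"
    then show ?thesis by (intro exI[of _ "- 1"]) simp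
  qed
qed

context cyclic_quartic_data
begin

context
  fixes p q :: int
  assumes d: "odd d" and b: "even b" and ab: "[a + b = 1] (mod 4)"
    and p: "p dvd d" "p \<ge> 1" and q: "q dvd a" "q \<ge> 1"
begin

lemma mem_idl_quarter: "mem_idl p q X0 X1 X2 X3 \<longleftrightarrow> p * q dvd X0 \<and> q dvd X1
    \<and> even (X0 - X1) \<and> even (X0 - X2) \<and> even (X0 - X3) \<and> 4 dvd X0 - X1 - X2 + a * c * X3"
  unfolding mem_idl_odd[OF d] integral_coords_def using b ab by auto

lemma odd_abc: "odd p" "odd q" "odd (a * c)"
  using odd_pq[OF d p(1) q(1)] odd_a d b d_odd_iff by (auto simp: d_eq)

lemma mem_idl_quarter_even:
  "mem_idl p q (2 * (p * q * z0)) (2 * (q * z1)) (2 * z2) (2 * z3) \<longleftrightarrow> even (z0 + z1 + z2 + z3)"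
proof -
  have four: "4 dvd 2 * x \<longleftrightarrow> even x" for x :: int by presburger
  have "2 * (p * q * z0) - 2 * (q * z1) - 2 * z2 + a * c * (2 * z3)
      = 2 * (p * q * z0 - q * z1 - z2 + a * c * z3)" by simp
  then have 1: "4 dvd 2 * (p * q * z0) - 2 * (q * z1) - 2 * z2 + a * c * (2 * z3)
      \<longleftrightarrow> even (p * q * z0 - q * z1 - z2 + a * c * z3)" by (simp only: four)
  have 2: "p * q dvd 2 * (p * q * z0)" "q dvd 2 * (q * z1)" by (simp_all add: dvd_mult)
  have 3: "even (p * q * z0 - q * z1 - z2 + a * c * z3) \<longleftrightarrow> even (z0 + z1 + z2 + z3)"
    using odd_abc by auto
  show ?thesis unfolding mem_idl_quarter 1 3 using 2 by simp
qed

text \<open>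
  All four coordinates have the same parity; if they are even, halving them and dividing by
  \<open>p q, q, 1, 1\<close> leaves a checkerboard vector.
\<close>

lemma mem_idl_quarter_cases:
  assumes L: "mem_idl p q X0 X1 X2 X3"
  shows "(odd X0 \<and> odd X1 \<and> odd X2 \<and> odd X3) \<or>
    (\<exists>z0 z1 z2 z3. X0 = 2 * (p * q * z0) \<and> X1 = 2 * (q * z1) \<and> X2 = 2 * z2 \<and> X3 = 2 * z3
      \<and> even (z0 + z1 + z2 + z3))"
proof (cases "even X0")
  case False
  then show ?thesis using L unfolding mem_idl_quarter by auto
next
  case True
  then have ev: "even X1" "even X2" "even X3" and dvd: "p * q dvd X0" "q dvd X1"
    using L unfolding mem_idl_quarter by auto
  have "odd (p * q)" using odd_abc by simp
  then obtain z0 where z0: "X0 = 2 * (p * q * z0)" using two_mult_dvd True dvd(1) by blast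
  obtain z1 where z1: "X1 = 2 * (q * z1)" using two_mult_dvd[OF odd_abc(2) ev(1) dvd(2)] by blast
  obtain z2 where z2: "X2 = 2 * z2" using ev(2) by (rule evenE)
  obtain z3 where z3: "X3 = 2 * z3" using ev(3) by (rule evenE)
  have "even (z0 + z1 + z2 + z3)" using L unfolding z0 z1 z2 z3 mem_idl_quarter_even .
  then show ?thesis using z0 z1 z2 z3 by blast
qed

lemma norm_squares_pos: "p\<^sup>2 * q\<^sup>2 > 0" "q\<^sup>2 * d > 0" "\<bar>a\<bar> * d > 0"
  using p q d_ge_2 a_nonzero by simp_all

lemma norm_squares_ne: "p\<^sup>2 * q\<^sup>2 \<noteq> q\<^sup>2 * d"
proof
  assume "p\<^sup>2 * q\<^sup>2 = q\<^sup>2 * d"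
  then have "q\<^sup>2 * p\<^sup>2 = q\<^sup>2 * d" by (simp only: mult.commute)
  moreover have "q\<^sup>2 \<noteq> 0" using q(2) by simp
  ultimately show False using mult_left_cancel square_ne_d by blast
qed

lemma norm_form_odd:
  assumes L: "mem_idl p q X0 X1 X2 X3" and odd: "odd X0" "odd X1" "odd X2" "odd X3"
  shows "p\<^sup>2 * q\<^sup>2 + q\<^sup>2 * d + 2 * (\<bar>a\<bar> * d) \<le> norm_form X0 X1 X2 X3"
proof -
  have dvd: "p * q dvd X0" "q dvd X1" using L unfolding mem_idl_quarter by auto
  obtain y0 where y0: "X0 = p * q * y0" using dvd(1) by (rule dvdE)
  obtain y1 where y1: "X1 = q * y1" using dvd(2) by (rule dvdE)
  have ne: "y0 \<noteq> 0" "y1 \<noteq> 0" "X2 \<noteq> 0" "X3 \<noteq> 0" using odd y0 y1 by auto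
  have one: "B \<le> B * z\<^sup>2" if "B > 0" "z \<noteq> 0" for B z :: int
    using weighted_square_le[of B 1 z] one_le_square[OF that(2)] that(1) by simp
  have "norm_form X0 X1 X2 X3 = p\<^sup>2 * q\<^sup>2 * y0\<^sup>2 + q\<^sup>2 * d * y1\<^sup>2 + \<bar>a\<bar> * d * X2\<^sup>2 + \<bar>a\<bar> * d * X3\<^sup>2"
    by (simp add: y0 y1 norm_form_def power2_eq_square algebra_simps)
  then show ?thesis
    using one[OF norm_squares_pos(1) ne(1)] one[OF norm_squares_pos(2) ne(2)]
      one[OF norm_squares_pos(3) ne(3)] one[OF norm_squares_pos(3) ne(4)]
    by linarith
qed

text \<open>
  Checkerboard vectors bound the minimum \<open>\<mu>\<close> by the right-hand sides, so the claim follows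
  from \<open>S \<le> \<mu>\<close>.  If \<open>\<mu>\<close> were smaller than \<open>S\<close>, no minimal vector would
  have odd coordinates, and \<open>quarter_minimum_inequality\<close> would apply to the checkerboard part.
\<close>

lemma well_rounded_quarter_imp:
  assumes "well_rounded_quartic_ideal F (idl p q)"
    and A: "A0 = p\<^sup>2 * q\<^sup>2" "A1 = q\<^sup>2 * d" "A2 = \<bar>a\<bar> * d" and S: "S = A0 + A1 + 2 * A2"
  shows "S \<le> 16 * A1 \<and> S \<le> 8 * A2 \<and> S \<le> 4 * A1 + 4 * A2
    \<and> S \<le> 16 * A0 \<and> S \<le> 4 * A0 + 4 * A2 \<and> S \<le> 4 * A0 + 4 * A1"
proof -
  note pos = norm_squares_pos[folded A]
  obtain \<mu> where low: "lower_bound p q \<mu>"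
    and e0: "\<exists>X0 X1 X2 X3. mem_idl p q X0 X1 X2 X3 \<and> norm_form X0 X1 X2 X3 = \<mu> \<and> X0 \<noteq> 0"
    and e1: "\<exists>X0 X1 X2 X3. mem_idl p q X0 X1 X2 X3 \<and> norm_form X0 X1 X2 X3 = \<mu> \<and> X1 \<noteq> 0"
    and e2: "\<exists>X0 X1 X2 X3. mem_idl p q X0 X1 X2 X3 \<and> norm_form X0 X1 X2 X3 = \<mu> \<and> X2 \<noteq> 0"
    using well_rounded_minimal_vectors[OF assms(1)] by blast
  have up: "\<mu> \<le> 4 * (A0 * z0\<^sup>2 + A1 * z1\<^sup>2 + A2 * z2\<^sup>2 + A2 * z3\<^sup>2)"
    if z: "even (z0 + z1 + z2 + z3)" "\<not> (z0 = 0 \<and> z1 = 0 \<and> z2 = 0 \<and> z3 = 0)" for z0 z1 z2 z3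
  proof -
    have "mem_idl p q (2 * (p * q * z0)) (2 * (q * z1)) (2 * z2) (2 * z3)"
        unfolding mem_idl_quarter_even by (rule z(1))
    moreover have "\<not> (2 * (p * q * z0) = 0 \<and> 2 * (q * z1) = 0 \<and> 2 * z2 = 0 \<and> 2 * z3 = 0)"
      using z(2) p(2) q(2) by auto
    ultimately have "\<mu> \<le> norm_form (2 * (p * q * z0)) (2 * (q * z1)) (2 * z2) (2 * z3)"
        by (rule lower_boundD[OF low])
    then show ?thesis unfolding norm_form_scaled A .
  qed
  have ups: "\<mu> \<le> 4 * (A0 + A1)" "\<mu> \<le> 4 * (A0 + A2)" "\<mu> \<le> 4 * (A1 + A2)" "\<mu> \<le> 4 * (2 * A2)"
      "\<mu> \<le> 4 * (4 * A0)" "\<mu> \<le> 4 * (4 * A1)"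
    using up[of 1 1 0 0] up[of 1 0 1 0] up[of 0 1 1 0] up[of 0 0 1 1] up[of 2 0 0 0] up[of 0 2 0 0]
    by simp_all
  have "S \<le> \<mu>"
  proof (rule ccontr)
    assume neg: "\<not> S \<le> \<mu>"
    have minimal: "\<exists>z0 z1 z2 z3. \<mu> = 4 * (A0 * z0\<^sup>2 + A1 * z1\<^sup>2 + A2 * z2\<^sup>2 + A2 * z3\<^sup>2)
        \<and> even (z0 + z1 + z2 + z3)
        \<and> (X0 \<noteq> 0 \<longrightarrow> z0 \<noteq> 0) \<and> (X1 \<noteq> 0 \<longrightarrow> z1 \<noteq> 0) \<and> (X2 \<noteq> 0 \<longrightarrow> z2 \<noteq> 0)"
      if L: "mem_idl p q X0 X1 X2 X3" "norm_form X0 X1 X2 X3 = \<mu>" for X0 X1 X2 X3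
    proof -
      have "\<not> (odd X0 \<and> odd X1 \<and> odd X2 \<and> odd X3)" using norm_form_odd[OF L(1)] neg
          unfolding L(2) S A by blast
      then obtain z0 z1 z2 z3 where z: "X0 = 2 * (p * q * z0)" "X1 = 2 * (q * z1)" "X2 = 2 * z2"
          "X3 = 2 * z3"
        "even (z0 + z1 + z2 + z3)"
        using mem_idl_quarter_cases[OF L(1)] by blast
      have "\<mu> = 4 * (A0 * z0\<^sup>2 + A1 * z1\<^sup>2 + A2 * z2\<^sup>2 + A2 * z3\<^sup>2)"
        using L(2) unfolding z(1-4) norm_form_scaled A by (rule sym)
      moreover have "(X0 \<noteq> 0 \<longrightarrow> z0 \<noteq> 0) \<and> (X1 \<noteq> 0 \<longrightarrow> z1 \<noteq> 0) \<and> (X2 \<noteq> 0 \<longrightarrow> z2 \<noteq> 0)"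
        unfolding z(1-4) by simp
      ultimately show ?thesis using z(5) by blast
    qed
    obtain \<nu> where \<nu>: "\<mu> = 4 * \<nu>" using e0 minimal by blast
    have nonneg: "A0 \<ge> 0" "A1 \<ge> 0" "A2 \<ge> 0" using pos by simp_all
    have c0: "A0 + A1 \<le> \<nu> \<or> A0 + A2 \<le> \<nu> \<or> 4 * A0 \<le> \<nu>"
    proof -
      obtain z0 z1 z2 z3 where z: "\<mu> = 4 * (A0 * z0\<^sup>2 + A1 * z1\<^sup>2 + A2 * z2\<^sup>2 + A2 * z3\<^sup>2)"
          "z0 \<noteq> 0" "even (z0 + z1 + z2 + z3)"
        using e0 minimal by blast
      have \<nu>_eq: "\<nu> = A0 * z0\<^sup>2 + A1 * z1\<^sup>2 + A2 * z2\<^sup>2 + A2 * z3\<^sup>2" using z(1) unfolding \<nu> by simp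
      show ?thesis
        using checkerboard_lower_bound[OF nonneg(1) nonneg(2) nonneg(3) nonneg(3) z(3) z(2)]
        unfolding Let_def \<nu>_eq[symmetric] by blast
    qed
    have c1: "A1 + A0 \<le> \<nu> \<or> A1 + A2 \<le> \<nu> \<or> 4 * A1 \<le> \<nu>"
    proof -
      obtain z0 z1 z2 z3 where z: "\<mu> = 4 * (A0 * z0\<^sup>2 + A1 * z1\<^sup>2 + A2 * z2\<^sup>2 + A2 * z3\<^sup>2)"
          "z1 \<noteq> 0" "even (z0 + z1 + z2 + z3)"
        using e1 minimal by blast
      have even: "even (z1 + z0 + z2 + z3)" using z(3) by (simp only: add_ac)
      have \<nu>_eq: "\<nu> = A1 * z1\<^sup>2 + A0 * z0\<^sup>2 + A2 * z2\<^sup>2 + A2 * z3\<^sup>2" using z(1) unfolding \<nu> by simp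
      show ?thesis
        using checkerboard_lower_bound[OF nonneg(2) nonneg(1) nonneg(3) nonneg(3) even z(2)]
        unfolding Let_def \<nu>_eq[symmetric] by blast
    qed
    have c2: "A2 + A0 \<le> \<nu> \<or> A2 + A1 \<le> \<nu> \<or> 2 * A2 \<le> \<nu> \<or> 4 * A2 \<le> \<nu>"
    proof -
      obtain z0 z1 z2 z3 where z: "\<mu> = 4 * (A0 * z0\<^sup>2 + A1 * z1\<^sup>2 + A2 * z2\<^sup>2 + A2 * z3\<^sup>2)"
          "z2 \<noteq> 0" "even (z0 + z1 + z2 + z3)"
        using e2 minimal by blast
      have even: "even (z2 + z0 + z1 + z3)" using z(3) by (simp only: add_ac)
      have \<nu>_eq: "\<nu> = A2 * z2\<^sup>2 + A0 * z0\<^sup>2 + A1 * z1\<^sup>2 + A2 * z3\<^sup>2" using z(1) unfolding \<nu> by simp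
      show ?thesis
        using checkerboard_lower_bound[OF nonneg(3) nonneg(1) nonneg(2) nonneg(3) even z(2)]
        unfolding Let_def \<nu>_eq[symmetric] mult_2 by blast
    qed
    have "S \<le> 4 * \<nu>" unfolding S
      by (rule quarter_minimum_inequality[OF pos norm_squares_ne[folded A] _ _ _ _ _ _ c0 c1 c2])
        (use ups in \<open>simp_all add: \<nu>\<close>)
    then show False using neg unfolding \<nu> by blast
  qed
  then show ?thesis using ups by simp
qed

lemma quarter_lower_bound:
  assumes A: "A0 = p\<^sup>2 * q\<^sup>2" "A1 = q\<^sup>2 * d" "A2 = \<bar>a\<bar> * d" and S: "S = A0 + A1 + 2 * A2"
    and le: "S \<le> 16 * A1 \<and> S \<le> 8 * A2 \<and> S \<le> 4 * A1 + 4 * A2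
      \<and> S \<le> 16 * A0 \<and> S \<le> 4 * A0 + 4 * A2 \<and> S \<le> 4 * A0 + 4 * A1"
  shows "lower_bound p q S"
  unfolding lower_bound_def
proof (intro allI impI)
  fix X0 X1 X2 X3 assume L: "mem_idl p q X0 X1 X2 X3"
      and ne: "\<not> (X0 = 0 \<and> X1 = 0 \<and> X2 = 0 \<and> X3 = 0)"
  have nonneg: "A0 \<ge> 0" "A1 \<ge> 0" "A2 \<ge> 0" using norm_squares_pos[folded A] by simp_all
  from mem_idl_quarter_cases[OF L] show "S \<le> norm_form X0 X1 X2 X3"
  proof
    assume "odd X0 \<and> odd X1 \<and> odd X2 \<and> odd X3"
    then show ?thesis using norm_form_odd[OF L] unfolding S A by blast
  next
    assume "\<exists>z0 z1 z2 z3. X0 = 2 * (p * q * z0) \<and> X1 = 2 * (q * z1) \<and> X2 = 2 * z2 \<and> X3 = 2 * z3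
      \<and> even (z0 + z1 + z2 + z3)"
    then obtain z0 z1 z2 z3 where z: "X0 = 2 * (p * q * z0)" "X1 = 2 * (q * z1)" "X2 = 2 * z2"
        "X3 = 2 * z3"
      "even (z0 + z1 + z2 + z3)" by blast
    define \<nu> where "\<nu> = A0 * z0\<^sup>2 + A1 * z1\<^sup>2 + A2 * z2\<^sup>2 + A2 * z3\<^sup>2"
    have "z0 \<noteq> 0 \<or> z1 \<noteq> 0 \<or> z2 \<noteq> 0 \<or> z3 \<noteq> 0" using ne unfolding z(1-4) by auto
    then have "S \<le> 4 * \<nu>"
    proof (elim disjE)
      assume ne: "z0 \<noteq> 0"
      from checkerboard_lower_bound[OF nonneg(1) nonneg(2) nonneg(3) nonneg(3) z(5) ne]
      have "A0 + A1 \<le> \<nu> \<or> A0 + A2 \<le> \<nu> \<or> A0 + A2 \<le> \<nu> \<or> 4 * A0 \<le> \<nu>"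
        unfolding Let_def \<nu>_def .
      then show ?thesis by (elim disjE) (use le nonneg in linarith)+
    next
      assume ne: "z1 \<noteq> 0"
      have even: "even (z1 + z0 + z2 + z3)" using z(5) by (simp only: add_ac)
      have \<nu>_eq: "\<nu> = A1 * z1\<^sup>2 + A0 * z0\<^sup>2 + A2 * z2\<^sup>2 + A2 * z3\<^sup>2" by (simp add: \<nu>_def)
      have "A1 + A0 \<le> \<nu> \<or> A1 + A2 \<le> \<nu> \<or> A1 + A2 \<le> \<nu> \<or> 4 * A1 \<le> \<nu>"
        using checkerboard_lower_bound[OF nonneg(2) nonneg(1) nonneg(3) nonneg(3) even ne]
        unfolding Let_def \<nu>_eq[symmetric] .
      then show ?thesis by (elim disjE) (use le nonneg in linarith)+
    next
      assume ne: "z2 \<noteq> 0"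
      have even: "even (z2 + z0 + z1 + z3)" using z(5) by (simp only: add_ac)
      have \<nu>_eq: "\<nu> = A2 * z2\<^sup>2 + A0 * z0\<^sup>2 + A1 * z1\<^sup>2 + A2 * z3\<^sup>2" by (simp add: \<nu>_def)
      have "A2 + A0 \<le> \<nu> \<or> A2 + A1 \<le> \<nu> \<or> A2 + A2 \<le> \<nu> \<or> 4 * A2 \<le> \<nu>"
        using checkerboard_lower_bound[OF nonneg(3) nonneg(1) nonneg(2) nonneg(3) even ne]
        unfolding Let_def \<nu>_eq[symmetric] .
      then show ?thesis by (elim disjE) (use le nonneg in linarith)+
    next
      assume ne: "z3 \<noteq> 0"
      have even: "even (z3 + z0 + z1 + z2)" using z(5) by (simp only: add_ac)
      have \<nu>_eq: "\<nu> = A2 * z3\<^sup>2 + A0 * z0\<^sup>2 + A1 * z1\<^sup>2 + A2 * z2\<^sup>2" by (simp add: \<nu>_def)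
      have "A2 + A0 \<le> \<nu> \<or> A2 + A1 \<le> \<nu> \<or> A2 + A2 \<le> \<nu> \<or> 4 * A2 \<le> \<nu>"
        using checkerboard_lower_bound[OF nonneg(3) nonneg(1) nonneg(2) nonneg(3) even ne]
        unfolding Let_def \<nu>_eq[symmetric] .
      then show ?thesis by (elim disjE) (use le nonneg in linarith)+
    qed
    then show ?thesis unfolding z(1-4) norm_form_scaled \<nu>_def A .
  qed
qed

text \<open>
  The sign \<open>\<eta>\<close> is chosen to satisfy the congruence modulo 4 for the first vector.  Changing
  two of the signs changes the left side of that congruence by a multiple of 4, since
  \<open>p q, q, 1, \<eta>\<close> and \<open>a c\<close> are odd.
\<close>

lemma quarter_vectors:
  obtains \<eta> where "\<eta> = 1 \<or> \<eta> = - 1" "mem_idl p q (p * q) q 1 \<eta>" "mem_idl p q (p * q) q (- 1) (- \<eta>)"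
    "mem_idl p q (p * q) (- q) 1 (- \<eta>)" "mem_idl p q (p * q) (- q) (- 1) \<eta>"
proof -
  have "odd (p * q - q - 1)" using odd_abc by simp
  then obtain \<eta> where \<eta>: "\<eta> = 1 \<or> \<eta> = - 1" "4 dvd (p * q - q - 1) + a * c * \<eta>"
    using four_dvd_add_unit_multiple[OF odd_abc(3)] by blast
  obtain n where n: "p * q - q - 1 + a * c * \<eta> = 4 * n" using \<eta>(2) by (rule dvdE)
  have odd\<eta>: "odd \<eta>" using \<eta>(1) by auto
  have "odd (a * c * \<eta>)" using odd_abc(3) odd\<eta> by simp
  then obtain m where m: "a * c * \<eta> = 2 * m + 1" by (rule oddE)
  obtain k where k: "q = 2 * k + 1" using odd_abc(2) by (rule oddE)
  have e: "x - q - (- 1) - y = 4 * (n - m)" "x - (- q) - 1 - y = 4 * (n + k - m)"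
    "x - (- q) - (- 1) + y = 4 * (n + k + 1)"
    if "x - q - 1 + y = 4 * n" "y = 2 * m + 1" "q = 2 * k + 1" for x y q :: int
    using that by simp_all
  have dvds: "4 dvd p * q - q - (- 1) + a * c * (- \<eta>)" "4 dvd p * q - (- q) - 1 + a * c * (- \<eta>)"
    "4 dvd p * q - (- q) - (- 1) + a * c * \<eta>"
    unfolding mult_minus_right add_uminus_conv_diff e[OF n m k] by (rule dvd_triv_left)+
  have par: "even (p * q - q)" "even (p * q - 1)" "even (p * q - \<eta>)" "even (p * q - (- q))"
    "even (p * q - (- 1))" "even (p * q - (- \<eta>))"
    unfolding even_diff even_minus even_mult_iff even_add using odd_abc odd\<eta> by simp_all
  have dvd1: "4 dvd p * q - q - 1 + a * c * \<eta>" using n by (rule dvdI)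
  show ?thesis
  proof (rule that[OF \<eta>(1)])
    show "mem_idl p q (p * q) q 1 \<eta>" unfolding mem_idl_quarter using par dvd1
        by (intro conjI) simp_all
    show "mem_idl p q (p * q) q (- 1) (- \<eta>)" unfolding mem_idl_quarter using par dvds
        by (intro conjI) simp_all
    show "mem_idl p q (p * q) (- q) 1 (- \<eta>)" unfolding mem_idl_quarter using par dvds
        by (intro conjI) simp_all
    show "mem_idl p q (p * q) (- q) (- 1) \<eta>" unfolding mem_idl_quarter using par dvds
        by (intro conjI) simp_all
  qed
qed

text \<open>
  The four vectors of \<open>quarter_vectors\<close> have the smallest possible form value, and by the
  Hadamard relations they span all basis directions.
\<close>

lemma well_rounded_quarter_if:
  assumes A: "A0 = p\<^sup>2 * q\<^sup>2" "A1 = q\<^sup>2 * d" "A2 = \<bar>a\<bar> * d" and S: "S = A0 + A1 + 2 * A2"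
    and low: "lower_bound p q S"
  shows "well_rounded_quartic_ideal F (idl p q)"
proof -
  obtain \<tau> :: "4 \<Rightarrow> complex \<Rightarrow> complex" where bij: "bij_betw \<tau> UNIV (embeddings F)"
    using ex_bij_embeddings by blast
  obtain \<eta> where \<eta>: "\<eta> = 1 \<or> \<eta> = - 1" and lats: "mem_idl p q (p * q) q 1 \<eta>"
      "mem_idl p q (p * q) q (- 1) (- \<eta>)"
    "mem_idl p q (p * q) (- q) 1 (- \<eta>)" "mem_idl p q (p * q) (- q) (- 1) \<eta>"
    by (rule quarter_vectors)
  let ?w1 = "iquad (p * q) q 1 \<eta>" and ?w2 = "iquad (p * q) q (- 1) (- \<eta>)"
    and ?w3 = "iquad (p * q) (- q) 1 (- \<eta>)" and ?w4 = "iquad (p * q) (- q) (- 1) \<eta>"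
  have \<eta>2: "\<eta>\<^sup>2 = 1" using \<eta> by auto
  have nfs: "norm_form (p * q) q 1 \<eta> = S" "norm_form (p * q) q (- 1) (- \<eta>) = S"
    "norm_form (p * q) (- q) 1 (- \<eta>) = S" "norm_form (p * q) (- q) (- 1) \<eta> = S"
    unfolding norm_form_def S A power2_minus \<eta>2 power_mult_distrib by simp_all
  have min: "elt (iquad X0 X1 X2 X3) \<in> idl p q \<and> iquad X0 X1 X2 X3 \<noteq> 0 \<and>
      (\<forall>B. elt B \<in> idl p q \<longrightarrow> B \<noteq> 0 \<longrightarrow> trace_form (iquad X0 X1 X2 X3) (iquad X0 X1 X2 X3) \<le> trace_form
          B B)"
    if L: "mem_idl p q X0 X1 X2 X3" "norm_form X0 X1 X2 X3 = S" "X2 \<noteq> 0" for X0 X1 X2 X3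
  proof (intro conjI allI impI)
    show "elt (iquad X0 X1 X2 X3) \<in> idl p q" using L(1) unfolding mem_idl_def .
    show "iquad X0 X1 X2 X3 \<noteq> 0" unfolding iquad_eq_0 using L(3) by blast
    fix B assume B: "elt B \<in> idl p q" "B \<noteq> 0"
    obtain Y0 Y1 Y2 Y3 where Y: "B = iquad Y0 Y1 Y2 Y3" "mem_idl p q Y0 Y1 Y2 Y3" using B(1)
        by (rule idl_iquad)
    have "\<not> (Y0 = 0 \<and> Y1 = 0 \<and> Y2 = 0 \<and> Y3 = 0)" using B(2) unfolding Y(1) iquad_eq_0 .
    then have "S \<le> norm_form Y0 Y1 Y2 Y3" by (rule lower_boundD[OF low Y(2)])
    then show "trace_form (iquad X0 X1 X2 X3) (iquad X0 X1 X2 X3) \<le> trace_form B B"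
        unfolding Y(1) form_iquad_le L(2) .
  qed
  have den: "den = 4" using d by (simp add: den_def)
  have S_pos: "1 \<le> S" using norm_squares_pos unfolding S A by linarith
  let ?W = "{?w1, ?w2, ?w3, ?w4}"
  have ideal: "ideal (idl p q) OF" by (rule ideal_idl[OF p(1) q(1)])
  have minW: "elt A \<in> idl p q \<and> A \<noteq> 0 \<and> (\<forall>B. elt B \<in> idl p q \<longrightarrow> B \<noteq> 0
      \<longrightarrow> trace_form A A \<le> trace_form B B)"
    if A: "A \<in> ?W" for A
  proof -
    consider "A = ?w1" | "A = ?w2" | "A = ?w3" | "A = ?w4" using A by blast
    then show ?thesis
    proof cases
      case 1 show ?thesis unfolding 1 by (rule min[OF lats(1) nfs(1)]) simp
    next
      case 2 show ?thesis unfolding 2 by (rule min[OF lats(2) nfs(2)]) simp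
    next
      case 3 show ?thesis unfolding 3 by (rule min[OF lats(3) nfs(3)]) simp
    next
      case 4 show ?thesis unfolding 4 by (rule min[OF lats(4) nfs(4)]) simp
    qed
  qed
  have gap: "1 / 16 \<le> trace_form A A" if A: "elt A \<in> idl p q" "A \<noteq> 0" for A
  proof -
    obtain Y0 Y1 Y2 Y3 where Y: "A = iquad Y0 Y1 Y2 Y3" "mem_idl p q Y0 Y1 Y2 Y3" using A(1)
        by (rule idl_iquad)
    have "\<not> (Y0 = 0 \<and> Y1 = 0 \<and> Y2 = 0 \<and> Y3 = 0)" using A(2) unfolding Y(1) iquad_eq_0 .
    then have "S \<le> norm_form Y0 Y1 Y2 Y3" by (rule lower_boundD[OF low Y(2)])
    then have "(1 :: int) \<le> norm_form Y0 Y1 Y2 Y3" using S_pos by linarith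
    then have "(1 :: rat) \<le> of_int (norm_form Y0 Y1 Y2 Y3)" by simp
    then show ?thesis unfolding Y(1) form_iquad den by simp
  qed
  define mk where "mk A = minkowski \<tau> (elt A)" for A
  have gen: "mk ` basis4 \<subseteq> span (mk ` ?W)"
  proof -
    define e0 e1 e2 e3 where e: "e0 = mk (1, 0, 0, 0)" "e1 = mk (0, 1, 0, 0)" "e2 = mk (0, 0, 1, 0)"
        "e3 = mk (0, 0, 0, 1)"
    have iquad: "mk (iquad X0 X1 X2 X3) = (of_int X0 / 4) *\<^sub>R e0 + (of_int X1 / 4) *\<^sub>R e1
        + (of_int X2 / 4) *\<^sub>R e2 + (of_int X3 / 4) *\<^sub>R e3" for X0 X1 X2 X3
    proof -
      have "mk (w, x, y, z) = of_rat w *\<^sub>R e0 + of_rat x *\<^sub>R e1 + of_rat y *\<^sub>R e2 + of_rat z *\<^sub>R e3"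
          for w x y z
        unfolding mk_def e by (rule mk_linear[OF bij])
      then show ?thesis unfolding iquad_def den by (simp add: of_rat_divide)
    qed
    let ?S = "span (mk ` ?W)"
    have m: "mk ?w1 \<in> ?S" "mk ?w2 \<in> ?S" "mk ?w3 \<in> ?S" "mk ?w4 \<in> ?S"
      by (intro span_base imageI; simp)+
    let ?u0 = "(of_int (p * q) / 4) *\<^sub>R e0" and ?u1 = "(of_int q / 4) *\<^sub>R e1"
      and ?u2 = "(1 / 4) *\<^sub>R e2" and ?u3 = "(of_int \<eta> / 4) *\<^sub>R e3"
    have mu: "mk ?w1 = ?u0 + ?u1 + ?u2 + ?u3" "mk ?w2 = ?u0 + ?u1 - ?u2 - ?u3"
        "mk ?w3 = ?u0 - ?u1 + ?u2 - ?u3" "mk ?w4 = ?u0 - ?u1 - ?u2 + ?u3"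
      unfolding iquad by simp_all
    note comb = hadamard_combinations[OF mu]
    have in_S: "mk ?w1 + mk ?w2 + mk ?w3 + mk ?w4 \<in> ?S" "mk ?w1 + mk ?w2 - mk ?w3 - mk ?w4 \<in> ?S"
      "mk ?w1 - mk ?w2 + mk ?w3 - mk ?w4 \<in> ?S" "mk ?w1 - mk ?w2 - mk ?w3 + mk ?w4 \<in> ?S"
      by (intro span_add span_diff m)+
    have "e0 \<in> ?S" by (rule in_span_of_quadruple[OF in_S(1)[unfolded comb(1)]]) (use p q in simp)
    moreover have "e1 \<in> ?S" by (rule in_span_of_quadruple[OF in_S(2)[unfolded comb(2)]])
        (use q in simp)
    moreover have "e2 \<in> ?S" by (rule in_span_of_quadruple[OF in_S(3)[unfolded comb(3)]]) simp
    moreover have "e3 \<in> ?S" by (rule in_span_of_quadruple[OF in_S(4)[unfolded comb(4)]])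
        (use \<eta> in auto)
    ultimately show ?thesis unfolding e basis4_def image_insert image_empty by simp
  qed
  have "well_rounded (span (minkowski \<tau> ` F)) (minkowski \<tau> ` idl p q)"
  proof (rule well_roundedI[OF bij idl_subset_F])
    show "0 \<in> idl p q"
      using additive_subgroup.zero_closed[OF ideal.axioms(1)[OF ideal]] by simp
    show "x - y \<in> idl p q" if "x \<in> idl p q" "y \<in> idl p q" for x y
      using that by (simp add: idl_def c_diff OF_closed)
    show "(1 / 16 :: rat) > 0" by simp
    show "1 / 16 \<le> trace_form A A" if "elt A \<in> idl p q" "A \<noteq> 0" for A using that by (rule gap)
    show "finite ?W" by simp
    show "card ?W \<le> 4" by (simp add: card_insert_if)
    show "elt A \<in> idl p q \<and> A \<noteq> 0 \<and> (\<forall>B. elt B \<in> idl p q \<longrightarrow> B \<noteq> 0 \<longrightarrow> trace_form A A \<le> trace_form B B)"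
      if "A \<in> ?W" for A using that by (rule minW)
    show "(\<lambda>A. minkowski \<tau> (elt A)) ` basis4 \<subseteq> span ((\<lambda>A. minkowski \<tau> (elt A)) ` ?W)"
      using gen unfolding mk_def .
  qed
  then show ?thesis unfolding well_rounded_quartic_ideal_def using bij by blast
qed

lemma well_rounded_quarter_iff:
  assumes A: "A0 = p\<^sup>2 * q\<^sup>2" "A1 = q\<^sup>2 * d" "A2 = \<bar>a\<bar> * d" and S: "S = A0 + A1 + 2 * A2"
  shows "well_rounded_quartic_ideal F (idl p q) \<longleftrightarrow>
    S \<le> 16 * A1 \<and> S \<le> 8 * A2 \<and> S \<le> 4 * A1 + 4 * A2
    \<and> S \<le> 16 * A0 \<and> S \<le> 4 * A0 + 4 * A2 \<and> S \<le> 4 * A0 + 4 * A1"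
  using well_rounded_quarter_imp[OF _ A S] quarter_lower_bound[OF A S]
    well_rounded_quarter_if[OF A S] by blast

end

text \<open>
  For odd \<open>d\<close> the condition \<open>d \<equiv> 1\<close> modulo 4 holds automatically, as \<open>d\<close> is
  a sum of two squares.
\<close>

lemma well_rounded_idl_iff:
  assumes p: "p dvd d" "p \<ge> 1" and q: "q dvd a" "q \<ge> 1"
  shows "well_rounded_quartic_ideal F (idl p q) \<longleftrightarrow>
    [d = 1] (mod 4) \<and> [b = 0] (mod 2) \<and> [a + b = 1] (mod 4) \<and>
    p\<^sup>2 * q\<^sup>2 + q\<^sup>2 * d + 2 * \<bar>a\<bar> * d \<le>
      Min {16 * q\<^sup>2 * d, 8 * \<bar>a\<bar> * d, 4 * q\<^sup>2 * d + 4 * \<bar>a\<bar> * d, 16 * p\<^sup>2 * q\<^sup>2,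
        4 * p\<^sup>2 * q\<^sup>2 + 4 * \<bar>a\<bar> * d, 4 * p\<^sup>2 * q\<^sup>2 + 4 * q\<^sup>2 * d}"
proof (cases "odd d")
  case False
  then have "\<not> 4 dvd d - 1" by presburger
  then have "\<not> [d = 1] (mod 4)" by (simp add: cong_iff_dvd_diff)
  moreover have "\<not> well_rounded_quartic_ideal F (idl p q)"
    using False by (intro not_well_rounded_d_even p(2) q(2)) simp
  ultimately show ?thesis by blast
next
  case d: True
  obtain m where "d = 4 * m + 1" using d_mod4_odd[OF d] .
  then have d4: "[d = 1] (mod 4)" by (simp add: cong_iff_dvd_diff)
  have b2: "[b = 0] (mod 2) \<longleftrightarrow> even b" by (simp add: cong_iff_dvd_diff)
  show ?thesis
  proof (cases "even b \<and> [a + b = 1] (mod 4)")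
    case True
    then have b: "even b" and ab: "[a + b = 1] (mod 4)" by auto
    show ?thesis
      unfolding well_rounded_quarter_iff[OF d b ab p q refl refl refl refl]
        le_Min_six_iff mult.assoc
      using d4 b2 b ab by blast
  next
    case False
    then show ?thesis using not_well_rounded_half[OF d p q False] b2 by blast
  qed
qed

end
text \<open>
  The uniqueness statements identify the two ideals with \<open>idl p\<^sub>I 1\<close> and
  \<open>idl 1 q\<^sub>J\<close>, whose product is \<open>idl p\<^sub>I q\<^sub>J\<close>.
\<close>

theorem theorem1p4:
  fixes a b c d p\<^sub>I q\<^sub>J :: int and F :: "complex set"
  assumes "squarefree a" and "odd a"
    and "d = b\<^sup>2 + c\<^sup>2" and "squarefree d"
    and "b > 0" and "c > 0" and "gcd a d = 1"
    and F: "F = cyclic_quartic_field a b d"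
    and "p\<^sub>I \<ge> 1" and "p\<^sub>I dvd d"
    and "q\<^sub>J \<ge> 1" and "q\<^sub>J dvd a"
    and "\<And>q. prime q \<Longrightarrow> q dvd q\<^sub>J \<Longrightarrow> \<not> QuadRes q d"
  shows "(\<exists>!P. nonzero_ideal F P \<and> int (ideal_norm F P) = p\<^sub>I) \<and>
    (\<exists>!Q. nonzero_ideal F Q \<and> int (ideal_norm F Q) = q\<^sub>J\<^sup>2) \<and>
    (\<forall>P Q. nonzero_ideal F P \<and> int (ideal_norm F P) = p\<^sub>I \<and>
           nonzero_ideal F Q \<and> int (ideal_norm F Q) = q\<^sub>J\<^sup>2 \<longrightarrow>
      (well_rounded_quartic_ideal F (P \<cdot>\<^bsub>ring_of_integers F\<^esub> Q) \<longleftrightarrow>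
        [d = 1] (mod 4) \<and> [b = 0] (mod 2) \<and> [a + b = 1] (mod 4) \<and>
        p\<^sub>I\<^sup>2 * q\<^sub>J\<^sup>2 + q\<^sub>J\<^sup>2 * d + 2 * \<bar>a\<bar> * d \<le>
          Min {16 * q\<^sub>J\<^sup>2 * d, 8 * \<bar>a\<bar> * d, 4 * q\<^sub>J\<^sup>2 * d + 4 * \<bar>a\<bar> * d,
               16 * p\<^sub>I\<^sup>2 * q\<^sub>J\<^sup>2, 4 * p\<^sub>I\<^sup>2 * q\<^sub>J\<^sup>2 + 4 * \<bar>a\<bar> * d,
               4 * p\<^sub>I\<^sup>2 * q\<^sub>J\<^sup>2 + 4 * q\<^sub>J\<^sup>2 * d}))"
proof -
  interpret K: cyclic_quartic_data a b c d
    by (rule cyclic_quartic_data.intro) (fact assms)+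
  have FK: "F = K.F" by (simp only: F K.F_def)
  note p = \<open>p\<^sub>I dvd d\<close> \<open>p\<^sub>I \<ge> 1\<close> and q = \<open>q\<^sub>J dvd a\<close> \<open>q\<^sub>J \<ge> 1\<close>
  have P: "nonzero_ideal F P \<and> int (ideal_norm F P) = p\<^sub>I \<longleftrightarrow> P = K.idl p\<^sub>I 1" for P
  proof
    assume "nonzero_ideal F P \<and> int (ideal_norm F P) = p\<^sub>I"
    then have "ideal P K.OF" "int (ideal_norm K.F P) = p\<^sub>I" unfolding nonzero_ideal_def FK by auto
    then show "P = K.idl p\<^sub>I 1" using K.idl_unique_ramified[OF _ p] by blast
  next
    assume "P = K.idl p\<^sub>I 1"
    then show "nonzero_ideal F P \<and> int (ideal_norm F P) = p\<^sub>I"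
      using K.ideal_idl[OF p(1), of 1] K.idl_nonzero[OF p(2), of 1] K.ideal_norm_idl[OF p, of 1]
      by (simp add: nonzero_ideal_def FK)
  qed
  have Q: "nonzero_ideal F Q \<and> int (ideal_norm F Q) = q\<^sub>J\<^sup>2 \<longleftrightarrow> Q = K.idl 1 q\<^sub>J" for Q
  proof
    assume "nonzero_ideal F Q \<and> int (ideal_norm F Q) = q\<^sub>J\<^sup>2"
    then have "ideal Q K.OF" "int (ideal_norm K.F Q) = q\<^sub>J\<^sup>2" unfolding nonzero_ideal_def FK by auto
    then show "Q = K.idl 1 q\<^sub>J" using K.idl_unique_inert[OF _ q assms(13)] by blast
  next
    assume "Q = K.idl 1 q\<^sub>J"
    then show "nonzero_ideal F Q \<and> int (ideal_norm F Q) = q\<^sub>J\<^sup>2"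
      using K.ideal_idl[OF _ q(1), of 1] K.idl_nonzero[OF _ q(2), of 1]
        K.ideal_norm_idl[OF _ _ q, of 1]
      by (simp add: nonzero_ideal_def FK)
  qed
  show ?thesis
  proof (intro conjI allI impI)
    show "\<exists>!P. nonzero_ideal F P \<and> int (ideal_norm F P) = p\<^sub>I" unfolding P by simp
    show "\<exists>!Q. nonzero_ideal F Q \<and> int (ideal_norm F Q) = q\<^sub>J\<^sup>2" unfolding Q by simp
  next
    fix P' Q'
    assume "nonzero_ideal F P' \<and> int (ideal_norm F P') = p\<^sub>I \<and>
      nonzero_ideal F Q' \<and> int (ideal_norm F Q') = q\<^sub>J\<^sup>2"
    then have PQ: "P' = K.idl p\<^sub>I 1" "Q' = K.idl 1 q\<^sub>J" using P[of P'] Q[of Q'] by blast+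
    show "well_rounded_quartic_ideal F (P' \<cdot>\<^bsub>ring_of_integers F\<^esub> Q') \<longleftrightarrow>
        [d = 1] (mod 4) \<and> [b = 0] (mod 2) \<and> [a + b = 1] (mod 4) \<and>
        p\<^sub>I\<^sup>2 * q\<^sub>J\<^sup>2 + q\<^sub>J\<^sup>2 * d + 2 * \<bar>a\<bar> * d \<le>
          Min {16 * q\<^sub>J\<^sup>2 * d, 8 * \<bar>a\<bar> * d, 4 * q\<^sub>J\<^sup>2 * d + 4 * \<bar>a\<bar> * d,
               16 * p\<^sub>I\<^sup>2 * q\<^sub>J\<^sup>2, 4 * p\<^sub>I\<^sup>2 * q\<^sub>J\<^sup>2 + 4 * \<bar>a\<bar> * d,
               4 * p\<^sub>I\<^sup>2 * q\<^sub>J\<^sup>2 + 4 * q\<^sub>J\<^sup>2 * d}"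
      unfolding PQ FK K.idl_prod[OF p(1) q(1)] by (rule K.well_rounded_idl_iff[OF p q])
  qed
qed

end
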